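(* Let $T>0$, let $\mathbb V$ and $\mathbb X$ be (real) Hilbert spaces, $A:\mathcal D(A)\subseteq\mathbb X\to\mathbb X$ the generator of a $C_0$-semigroup on $\mathbb X$, $y_0,y_1\in\mathbb X$, and let $F:[0,T]\times\mathbb X\times\mathbb V\to\mathbb X$, $g_0:[0,T]\times\mathbb X\times\mathbb V\to\mathbb R$ be strongly measurable in $t$ and continuously differentiable in $(y,u)\in\mathbb X\times\mathbb V$. Suppose there are positive constants $L_3,L_4,L_5,L_6,\delta_2^*,\delta_3^*$ such that for all $(t,y,u)\in[0,T]\times\mathbb X\times\mathbb V$: $|F(t,0,u)|_{\mathbb X}\le L_3|u|_{\mathbb V}$, $|F_y(t,y,u)|_{\mathcal L(\mathbb X)}+|F_u(t,y,u)|_{\mathcal L(\mathbb V;\mathbb X)}\le L_3$, $|g_0(t,y,u)|\le L_3(1+|y|_{\mathbb X}^2+|u|_{\mathbb V}^2)$, $|g_{0,y}(t,y,u)|_{\mathbb X'}\le L_3(1+|y|_{\mathbb X}+|u|_{\mathbb V})$; for all $t\in[0,T]$, $u\in\mathbb V$ and $y_1',y_2'\in\mathbb X$ with $|y_1'-y_2'|_{\mathbb X}\le\delta_2^*$: $|F_y(t,y_1',u)-F_y(t,y_2',u)|_{\mathcal L(\mathbb X)}+|F_u(t,y_1',u)-F_u(t,y_2',u)|_{\mathcal L(\mathbb V;\mathbb X)}\le L_4|y_1'-y_2'|_{\mathbb X}$; for all $t\in[0,T]$, $y\in\mathbb X$, $u_1,u_2\in\mathbb V$: $|F_y(t,y,u_1)-F_y(t,y,u_2)|_{\mathcal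 L(\mathbb X)}+|F_u(t,y,u_1)-F_u(t,y,u_2)|_{\mathcal L(\mathbb V;\mathbb X)}\le L_5|u_1-u_2|_{\mathbb V}$; and for all $t\in[0,T]$, $y_1',y_2'\in\mathbb X$ with $|y_1'-y_2'|_{\mathbb X}\le\delta_3^*$, $u_1,u_2\in\mathbb V$: $|g_{0,y}(t,y_1',u_1)-g_{0,y}(t,y_2',u_2)|_{\mathbb X'}+|g_{0,u}(t,y_1',u_1)-g_{0,u}(t,y_2',u_2)|_{\mathbb V'}\le L_6(|y_1'-y_2'|_{\mathbb X}+|u_1-u_2|_{\mathbb V})$. For $u\in L^2(0,T;\mathbb V)$ let $y(\cdot;u)$ be the mild solution of $y_t=Ay+F(t,y,u(t))$ on $[0,T]$, $y(0)=y_0$, and $J(u)=\int_0^Tg_0(t,y(t;u),u(t))\,dt$. Let $\bar u$ minimize $J(u)$ over all $u\in L^2(0,T;\mathbb V)$ with $y(T;u)=y_1$, and let $\bar y=y(\cdot;\bar u)$. For $v\in L^2(0,T;\mathbb V)$ let $\hat\xi(\cdot;v)$ be the mild solution of $$\hat\xi_t=A\hat\xi+F_y(t,\bar y,\bar u)\hat\xi+F_u(t,\bar y,\bar u)v\ \text{ on }[0,T],\qquad\hat\xi(0)=0.$$ If the set $\{\hat\xi(T;v): v\in L^2(0,T;\mathbb V),\ |v|_{L^2(0,T;\mathbb V)}\le1\}$ is finite codimensional in $\mathbb X$, then there is a pair $(z_0,z)\in[0,+\infty)\times\mathbb X'$, $(z_0,z)\ne(0,0)$, such that $$H_u(t,\bar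 y(t),\bar u(t),z_0,\psi(t))=0\quad\text{for a.e. }t\in(0,T),$$ where $H(t,y,u,z_0,\psi)=\langle\psi,F(t,y,u)\rangle_{\mathbb X',\mathbb X}-z_0g_0(t,y,u)$ and $\psi$ is the mild solution of $$\psi_t=-A^*\psi-F_y(t,\bar y(t),\bar u(t))^*\psi+z_0g_{0,y}(t,\bar y(t),\bar u(t))\ \text{ on }[0,T],\qquad\psi(T)=-z.$$ Moreover: (i) If $z_0\ne0$, then $$H_u(t,\bar y(t),\bar u(t),1,\tilde\psi(t))=0\quad\text{for a.e. }t\in(0,T),$$ where $\tilde\psi$ is the mild solution of $$\tilde\psi_t=-A^*\tilde\psi-F_y(t,\bar y(t),\bar u(t))^*\tilde\psi+g_{0,y}(t,\bar y(t),\bar u(t))\ \text{ on }[0,T],\qquad\tilde\psi(T)=-z/z_0.$$ (ii) If $z\neq0$, there is a sequence $\{u^k\}_{k=1}^\infty\subseteq L^2(0,T;\mathbb V)$ converging to $\bar u$ in $L^2(0,T;\mathbb V)$ such that $y(T;u^k)\ne y_1$, $\lim_ky(T;u^k)=y_1$, $\lim_kJ(u^k)=J(\bar u)$, and $(\hat z,\,y(T;u^k)-y_1)_{\mathbb X}>0$ for all $k\in\mathbb N$, where $\hat z\in\mathbb X$ corresponds to $z$ by the Riesz–Fréchet isomorphism.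
   Context: Finite codimensionality: a linear subspace $X_1$ of a Banach space $X$ is finite codimensional if there are an integer $m\ge0$ and linearly independent $x_1,\dots,x_m\in X\setminus X_1$ with $\overline{X_1}+\mathrm{span}\{x_1,\dots,x_m\}=X$. A subset $D\subseteq X$ is finite codimensional in $X$ if there is $x_0\in\overline{\mathrm{co}}\,D$ such that (i) $\overline{\mathrm{span}}\{D-x_0\}$ is a finite codimensional subspace of $X$, and (ii) $\overline{\mathrm{co}}(D-x_0)$ has at least one interior point relative to $\overline{\mathrm{span}}\{D-x_0\}$. Subscripts $y,u$ on $F$, $g_0$, $H$ denote partial Fréchet derivatives; subscript $t$ on $y,\hat\xi,\psi,\tilde\psi$ denotes the time derivative.
   Formalization: The formal theorem also assumes that F_y*φ, F_u*φ (for each φ in X'), g_{0,y} and g_{0,u} are strongly measurable in t; this is automatic for separable X and V, and without it the claim fails for some non-separable V. *)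

theory Defs
  imports "HOL-Analysis.Analysis"
begin

section \<open>Strong measurability and the Bochner integral\<close>

text \<open>The Bochner integral of the library is restricted to second countable spaces.  The Hilbert
  spaces considered here may be non-separable, so strong measurability (almost everywhere limit of
  simple functions) and the Bochner integral are defined here without that restriction.\<close>

definition strongly_measurable :: "'a measure \<Rightarrow> ('a \<Rightarrow> 'b::topological_space) \<Rightarrow> bool" where
  "strongly_measurable M f \<longleftrightarrow>
     (\<exists>s. (\<forall>i. simple_function M (s i)) \<and> (AE t in M. (\<lambda>i::nat. s i t) \<longlonglongrightarrow> f t))"

definition bochner_has_integral ::
  "'a measure \<Rightarrow> ('a \<Rightarrow> 'b::real_normed_vector) \<Rightarrow> 'b \<Rightarrow> bool" where
  "bochner_has_integral M f x \<longleftrightarrow>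
     strongly_measurable M f \<and>
     (\<exists>s. (\<forall>i::nat. Bochner_Integration.simple_bochner_integrable M (s i)) \<and>
          (\<lambda>i. \<integral>\<^sup>+ t. ennreal (norm (f t - s i t)) \<partial>M) \<longlonglongrightarrow> 0 \<and>
          (\<lambda>i. Bochner_Integration.simple_bochner_integral M (s i)) \<longlonglongrightarrow> x)"

text \<open>Elements of \<open>L\<^sup>2(0,T;V)\<close> are represented by functions on the real line, whose values outside
  \<open>[0,T]\<close> are irrelevant; \<open>L2_norm\<close> is a seminorm on these representatives.\<close>

definition L2_space :: "real \<Rightarrow> (real \<Rightarrow> 'v::real_normed_vector) set" where
  "L2_space T = {u. strongly_measurable (lebesgue_on {0..T}) u \<and>
                    integrable (lebesgue_on {0..T}) (\<lambda>t. (norm (u t))\<^sup>2)}"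

definition L2_norm :: "real \<Rightarrow> (real \<Rightarrow> 'v::real_normed_vector) \<Rightarrow> real" where
  "L2_norm T u = sqrt (\<integral>t. (norm (u t))\<^sup>2 \<partial>lebesgue_on {0..T})"


section \<open>Semigroups and mild solutions\<close>

definition C0_semigroup :: "(real \<Rightarrow> ('x::real_normed_vector \<Rightarrow>\<^sub>L 'x)) \<Rightarrow> bool" where
  "C0_semigroup S \<longleftrightarrow>
     S 0 = id_blinfun \<and>
     (\<forall>s\<ge>0. \<forall>t\<ge>0. S (s + t) = S s o\<^sub>L S t) \<and>
     (\<forall>x. ((\<lambda>t. S t x) \<longlongrightarrow> x) (at_right 0))"

text \<open>\<open>D\<close> is the domain of the operator \<open>A\<close>; the values of \<open>A\<close> off \<open>D\<close> are irrelevant.\<close>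

definition generator_of ::
  "'x set \<Rightarrow> ('x \<Rightarrow> 'x) \<Rightarrow> (real \<Rightarrow> ('x::real_normed_vector \<Rightarrow>\<^sub>L 'x)) \<Rightarrow> bool" where
  "generator_of D A S \<longleftrightarrow>
     D = {x. \<exists>l. ((\<lambda>h. (S h x - x) /\<^sub>R h) \<longlongrightarrow> l) (at_right 0)} \<and>
     (\<forall>x\<in>D. ((\<lambda>h. (S h x - x) /\<^sub>R h) \<longlongrightarrow> A x) (at_right 0))"

text \<open>Mild solution of \<open>x' = A x + f(t,x)\<close> on \<open>[0,T]\<close>, \<open>x(0) = x0\<close>, where \<open>A\<close> generates \<open>S\<close>:
  \<open>x(t) = S(t) x0 + \<integral>\<^bsub>[0,t]\<^esub> S(t-s) f(s,x(s)) ds\<close>.\<close>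

definition mild_solution ::
  "real \<Rightarrow> (real \<Rightarrow> ('x::real_normed_vector \<Rightarrow>\<^sub>L 'x)) \<Rightarrow> (real \<Rightarrow> 'x \<Rightarrow> 'x) \<Rightarrow> 'x \<Rightarrow> (real \<Rightarrow> 'x) \<Rightarrow> bool"
where
  "mild_solution T S f x0 x \<longleftrightarrow>
     continuous_on {0..T} x \<and>
     (\<forall>t\<in>{0..T}. bochner_has_integral (lebesgue_on {0..t}) (\<lambda>s. S (t - s) (f s (x s)))
                    (x t - S t x0))"

definition dual_op ::
  "('a::real_normed_vector \<Rightarrow>\<^sub>L 'b::real_normed_vector) \<Rightarrow> ('b \<Rightarrow>\<^sub>L real) \<Rightarrow> ('a \<Rightarrow>\<^sub>L real)" where
  "dual_op B \<phi> = \<phi> o\<^sub>L B"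

text \<open>Mild solution of \<open>\<psi>' = - A\<^sup>*\<psi> - f(t,\<psi>)\<close> on \<open>[0,T]\<close>, \<open>\<psi>(T) = \<psi>T\<close>, in the dual space:
  \<open>\<psi>(t) = S(T-t)\<^sup>* \<psi>T + \<integral>\<^bsub>[t,T]\<^esub> S(s-t)\<^sup>* f(s,\<psi>(s)) ds\<close>.
  On a reflexive space the dual operators \<open>S(t)\<^sup>*\<close> form the \<open>C\<^sub>0\<close>-semigroup generated by \<open>A\<^sup>*\<close>.\<close>

definition adjoint_mild_solution ::
  "real \<Rightarrow> (real \<Rightarrow> ('x::real_normed_vector \<Rightarrow>\<^sub>L 'x)) \<Rightarrow> (real \<Rightarrow> ('x \<Rightarrow>\<^sub>L real) \<Rightarrow> ('x \<Rightarrow>\<^sub>L real))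
     \<Rightarrow> ('x \<Rightarrow>\<^sub>L real) \<Rightarrow> (real \<Rightarrow> ('x \<Rightarrow>\<^sub>L real)) \<Rightarrow> bool"
where
  "adjoint_mild_solution T S f \<psi>T \<psi> \<longleftrightarrow>
     continuous_on {0..T} \<psi> \<and>
     (\<forall>t\<in>{0..T}. bochner_has_integral (lebesgue_on {t..T}) (\<lambda>s. dual_op (S (s - t)) (f s (\<psi> s)))
                    (\<psi> t - dual_op (S (T - t)) \<psi>T))"


section \<open>Derivatives, cost functional and Hamiltonian\<close>

text \<open>\<open>f\<close> is continuously differentiable as a function on the product space, and its partial
  Frechet derivatives are \<open>fy\<close> and \<open>fu\<close>.\<close>

definition C1_with_partials ::
  "('x::real_normed_vector \<Rightarrow> 'v::real_normed_vector \<Rightarrow> 'c::real_normed_vector)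
     \<Rightarrow> ('x \<Rightarrow> 'v \<Rightarrow> ('x \<Rightarrow>\<^sub>L 'c)) \<Rightarrow> ('x \<Rightarrow> 'v \<Rightarrow> ('v \<Rightarrow>\<^sub>L 'c)) \<Rightarrow> bool" where
  "C1_with_partials f fy fu \<longleftrightarrow>
     (\<exists>f' :: 'x \<times> 'v \<Rightarrow> (('x \<times> 'v) \<Rightarrow>\<^sub>L 'c).
        (\<forall>p. ((\<lambda>q. f (fst q) (snd q)) has_derivative blinfun_apply (f' p)) (at p)) \<and>
        continuous_on UNIV f') \<and>
     (\<forall>y u. ((\<lambda>y'. f y' u) has_derivative blinfun_apply (fy y u)) (at y)) \<and>
     (\<forall>y u. ((\<lambda>u'. f y u') has_derivative blinfun_apply (fu y u)) (at u))"

text \<open>Strong measurability in time of the derivatives of a Caratheodory function, in the form needed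
  for the adjoint equation and the Hamiltonian: as functions of \<open>t\<close>, \<open>fy(t,y,u)\<^sup>* \<phi>\<close> and \<open>fu(t,y,u)\<^sup>* \<phi>\<close>
  are strongly measurable (for real-valued \<open>f\<close> this says that \<open>fy\<close> and \<open>fu\<close> are).  If \<open>X\<close> and \<open>V\<close> are
  separable Hilbert spaces, this follows from the strong measurability of \<open>f\<close> in \<open>t\<close>: difference
  quotients give weak measurability, and the Pettis measurability theorem applies.  It has to be
  required in the non-separable case: on the square summable families on \<open>[0,1]\<close> with unit vectors
  \<open>e\<^sub>t\<close>, the function \<open>f(t,u) = (u, e\<^sub>t)\<close> vanishes for almost every \<open>t\<close>, for each \<open>u\<close>, but
  \<open>fu(t,u) = (-, e\<^sub>t)\<close> is nowhere zero and not strongly measurable.\<close>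

definition partials_strongly_measurable ::
  "real \<Rightarrow> (real \<Rightarrow> 'x::real_normed_vector \<Rightarrow> 'v::real_normed_vector \<Rightarrow> ('x \<Rightarrow>\<^sub>L 'c::real_normed_vector))
     \<Rightarrow> (real \<Rightarrow> 'x \<Rightarrow> 'v \<Rightarrow> ('v \<Rightarrow>\<^sub>L 'c)) \<Rightarrow> bool" where
  "partials_strongly_measurable T fy fu \<longleftrightarrow>
     (\<forall>y u \<phi>. strongly_measurable (lebesgue_on {0..T}) (\<lambda>t. dual_op (fy t y u) \<phi>) \<and>
              strongly_measurable (lebesgue_on {0..T}) (\<lambda>t. dual_op (fu t y u) \<phi>))"

definition cost ::
  "real \<Rightarrow> (real \<Rightarrow> 'x \<Rightarrow> 'v \<Rightarrow> real) \<Rightarrow> (real \<Rightarrow> 'x) \<Rightarrow> (real \<Rightarrow> 'v) \<Rightarrow> real" where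
  "cost T g0 y u = (\<integral>t. g0 t (y t) (u t) \<partial>lebesgue_on {0..T})"

definition Hamiltonian ::
  "(real \<Rightarrow> 'x::real_normed_vector \<Rightarrow> 'v \<Rightarrow> 'x) \<Rightarrow> (real \<Rightarrow> 'x \<Rightarrow> 'v \<Rightarrow> real)
     \<Rightarrow> real \<Rightarrow> 'x \<Rightarrow> 'v \<Rightarrow> real \<Rightarrow> ('x \<Rightarrow>\<^sub>L real) \<Rightarrow> real" where
  "Hamiltonian F g0 t y u z0 \<psi> = \<psi> (F t y u) - z0 * g0 t y u"


section \<open>Finite codimensionality\<close>

definition finite_codim_subspace :: "'x::real_normed_vector set \<Rightarrow> bool" where
  "finite_codim_subspace X1 \<longleftrightarrow>
     subspace X1 \<and>
     (\<exists>B. finite B \<and> independent B \<and> B \<subseteq> - X1 \<and>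
          {a + b |a b. a \<in> closure X1 \<and> b \<in> span B} = UNIV)"

definition finite_codimensional :: "'x::real_normed_vector set \<Rightarrow> bool" where
  "finite_codimensional D \<longleftrightarrow>
     (\<exists>x0 \<in> closure (convex hull D).
        let E = (\<lambda>x. x - x0) ` D; L = closure (span E)
        in finite_codim_subspace L \<and> (top_of_set L) interior_of (closure (convex hull E)) \<noteq> {})"

end

theory Submission
  imports Defs
begin

text \<open>The end-point map \<open>E(u) = y(T;u)\<close> is differentiable with a locally Lipschitz derivative \<open>\<Lambda>\<close> at
  \<open>ubar\<close>, although the superposition operators are only differentiable from \<open>L\<^sup>2\<close> to \<open>L\<^sup>1\<close>. Finite
  codimensionality says that the closed span \<open>L\<close> of the range of \<open>\<Lambda>\<close> has finite codimension and that
  \<open>\<Lambda> \<Lambda>\<^sup>*\<close> is coercive on \<open>L\<close>. Either some \<open>z\<close> in the finite-dimensional annihilator of \<open>L\<close> satisfies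
  \<open>\<langle>z, E(u) - y1\<rangle> > 0\<close> for controls \<open>u\<close> arbitrarily close to \<open>ubar\<close>, and then \<open>(0, z)\<close> is a multiplier; or
  \<open>E(u) - y1\<close> lies in \<open>L\<close> for all \<open>u\<close> near \<open>ubar\<close>, and then the problem is regular and has a multiplier
  \<open>(1, z)\<close>, where a nonzero \<open>z \<in> L\<close> is approached along a direction \<open>v\<close> with \<open>\<langle>z, \<Lambda> v\<rangle> > 0\<close>. The adjoint
  \<open>\<Lambda>\<^sup>*\<close> is explicit in terms of the adjoint equation, so that all limit processes take place in the
  state space and the completeness of \<open>L\<^sup>2\<close> is not needed.\<close>

section \<open>Strong measurability and the Bochner integral\<close>

text \<open>The obstacle is a loss of integrability: the Taylor remainder of the superposition
  operator is bounded by a product of two \<open>L2\<close> functions and no better. The mild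
  formulation absorbs it, since Gronwall's estimate sends an \<open>L1\<close> forcing to the
  supremum norm of the state; hence the end-point map has a quadratic remainder in the
  \<open>L2\<close> seminorm. Conclusion (ii) asks for a strict sign along a sequence of controls,
  so the case distinction is made on that sign itself. When no annihilator of \<open>L\<close>
  attains it, both signs of the finitely many vectors that cut out \<open>L\<close> fail, which
  confines the nearby end points to \<open>L\<close>; there coercivity permits a Newton-like
  correction of the end point. The correction is sought among the controls obtained from r in
  \<open>L\<close> by the adjoint of the derivative. Its unknown thus lies in a closed subspace of
  the Hilbert state space, where a contraction argument is available, while controls remain
  functions with a seminorm. In the regular case the multiplier expresses that the part of the
  negative cost gradient lying in the kernel of the derivative has seminorm zero.\<close>

abbreviation (input) simple_bochner_integrable :: "'a measure \<Rightarrow> ('a \<Rightarrow> 'b::real_vector)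
    \<Rightarrow> bool" where
  "simple_bochner_integrable \<equiv> Bochner_Integration.simple_bochner_integrable"

abbreviation (input) simple_bochner_integral :: "'a measure \<Rightarrow> ('a \<Rightarrow> 'b::real_vector)
    \<Rightarrow> 'b" where
  "simple_bochner_integral \<equiv> Bochner_Integration.simple_bochner_integral"

section \<open>Strong measurability over finite complete measures\<close>

text \<open>Finiteness turns almost everywhere convergence into convergence in measure, since
  constants are integrable bounds. Completeness makes a function measurable as soon as it agrees
  almost everywhere with a measurable one. Together they give closure under limits without
  separability of the value space.\<close>

locale finite_complete_measure = finite_measure M + complete_measure M for M :: "'a measure"
begin

lemma measurable_AE_cong:
  fixes f g :: "'a \<Rightarrow> 'b::topological_space"
  assumes f: "f \<in> borel_measurable M" and ae: "AE x in M. f x = g x"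
  shows "g \<in> borel_measurable M"
proof (rule measurableI)
  fix A :: "'b set" assume A: "A \<in> sets borel"
  show "g -` A \<inter> space M \<in> sets M"
  proof (rule in_sets_AE)
    show "f -` A \<inter> space M \<in> sets M" using f A by (rule measurable_sets)
    show "AE x in M. (x \<in> f -` A \<inter> space M) = (x \<in> g -` A \<inter> space M)"
      using ae by eventually_elim auto
  qed auto
qed auto

lemma borel_measurable_AE_limit:
  fixes f :: "nat \<Rightarrow> 'a \<Rightarrow> real"
  assumes f: "\<And>i. f i \<in> borel_measurable M" and lim: "AE x in M. (\<lambda>i. f i x) \<longlonglongrightarrow> g x"
  shows "g \<in> borel_measurable M"
proof (rule measurable_AE_cong)
  show "(\<lambda>x. lim (\<lambda>i. f i x)) \<in> borel_measurable M"
    using f by (rule borel_measurable_lim_metric)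
  show "AE x in M. lim (\<lambda>i. f i x) = g x"
    using lim by eventually_elim (rule limI)
qed

lemma strongly_measurable_norm:
  fixes f :: "'a \<Rightarrow> 'b::real_normed_vector"
  assumes "strongly_measurable M f"
  shows "(\<lambda>x. norm (f x)) \<in> borel_measurable M"
proof -
  obtain s where s: "\<And>i. simple_function M (s i)" "AE t in M. (\<lambda>i::nat. s i t) \<longlonglongrightarrow> f t"
    using assms unfolding strongly_measurable_def by blast
  show ?thesis
  proof (rule borel_measurable_AE_limit)
    show "(\<lambda>x. norm (s i x)) \<in> borel_measurable M" for i
      by (intro borel_measurable_simple_function simple_function_compose1[OF s(1)])
    show "AE x in M. (\<lambda>i. norm (s i x)) \<longlonglongrightarrow> norm (f x)"
      using s(2) by eventually_elim (rule tendsto_norm)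
  qed
qed

lemma strongly_measurable_real:
  fixes f :: "'a \<Rightarrow> real"
  assumes "strongly_measurable M f"
  shows "f \<in> borel_measurable M"
proof -
  obtain s where s: "\<And>i. simple_function M (s i)" "AE t in M. (\<lambda>i::nat. s i t) \<longlonglongrightarrow> f t"
    using assms unfolding strongly_measurable_def by blast
  show ?thesis
    by (rule borel_measurable_AE_limit[OF borel_measurable_simple_function[OF s(1)] s(2)])
qed

lemma strongly_measurable_simple:
  "simple_function M f \<Longrightarrow> strongly_measurable M f"
  unfolding strongly_measurable_def by (intro exI[of _ "\<lambda>_. f"]) auto

lemma strongly_measurable_const [simp]: "strongly_measurable M (\<lambda>_. c)"
  by (rule strongly_measurable_simple) simp

lemma strongly_measurable_AE_cong:
  assumes "strongly_measurable M f" "AE x in M. f x = g x"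
  shows "strongly_measurable M g"
proof -
  obtain s where s: "\<And>i. simple_function M (s i)" "AE t in M. (\<lambda>i::nat. s i t) \<longlonglongrightarrow> f t"
    using assms unfolding strongly_measurable_def by blast
  have "AE t in M. (\<lambda>i::nat. s i t) \<longlonglongrightarrow> g t"
    using s(2) assms(2) by eventually_elim auto
  with s(1) show ?thesis unfolding strongly_measurable_def by blast
qed

text \<open>A function of two simple functions is simple, and continuity carries the almost
  everywhere limits through. Pairs, sums, products, inner products and operator evaluation are all
  instances.\<close>

lemma strongly_measurable_compose2:
  fixes f :: "'a \<Rightarrow> 'b::metric_space" and g :: "'a \<Rightarrow> 'c::metric_space" and h :: "'b
      \<Rightarrow> 'c \<Rightarrow> 'd::topological_space"
  assumes f: "strongly_measurable M f" and g: "strongly_measurable M g"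
    and h: "continuous_on UNIV (\<lambda>p. h (fst p) (snd p))"
  shows "strongly_measurable M (\<lambda>x. h (f x) (g x))"
proof -
  obtain s where s: "\<And>i. simple_function M (s i)" "AE t in M. (\<lambda>i::nat. s i t) \<longlonglongrightarrow> f t"
    using f unfolding strongly_measurable_def by blast
  obtain r where r: "\<And>i. simple_function M (r i)" "AE t in M. (\<lambda>i::nat. r i t) \<longlonglongrightarrow> g t"
    using g unfolding strongly_measurable_def by blast
  have "simple_function M (\<lambda>t. h (s i t) (r i t))" for i
    using s(1) r(1) by (rule simple_function_compose2)
  moreover have "AE t in M. (\<lambda>i::nat. h (s i t) (r i t)) \<longlonglongrightarrow> h (f t) (g t)"
    using s(2) r(2)
  proof eventually_elim
    case (elim t)
    have "isCont (\<lambda>p. h (fst p) (snd p)) (f t, g t)"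
      using h by (simp add: continuous_on_eq_continuous_at)
    from isCont_tendsto_compose[OF this tendsto_Pair[OF elim]] show ?case by simp
  qed
  ultimately show ?thesis
    unfolding strongly_measurable_def by (intro exI[of _ "\<lambda>i t. h (s i t) (r i t)"]) auto
qed

lemma strongly_measurable_compose:
  fixes f :: "'a \<Rightarrow> 'b::metric_space" and h :: "'b \<Rightarrow> 'd::topological_space"
  assumes f: "strongly_measurable M f" and h: "continuous_on UNIV h"
  shows "strongly_measurable M (\<lambda>x. h (f x))"
  using strongly_measurable_compose2[OF f f, of "\<lambda>a b. h a"]
    continuous_on_compose2[OF h continuous_on_fst[OF continuous_on_id], of UNIV] by simp

lemma strongly_measurable_Pair:
  fixes f :: "'a \<Rightarrow> 'b::metric_space" and g :: "'a \<Rightarrow> 'c::metric_space"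
  shows "strongly_measurable M f \<Longrightarrow> strongly_measurable M g \<Longrightarrow>
      strongly_measurable M (\<lambda>x. (f x, g x))"
  by (erule (1) strongly_measurable_compose2) simp

lemma strongly_measurable_add:
  fixes f g :: "'a \<Rightarrow> 'b::real_normed_vector"
  shows "strongly_measurable M f \<Longrightarrow> strongly_measurable M g \<Longrightarrow>
      strongly_measurable M (\<lambda>x. f x + g x)"
  by (erule (1) strongly_measurable_compose2) (intro continuous_intros)

lemma strongly_measurable_diff:
  fixes f g :: "'a \<Rightarrow> 'b::real_normed_vector"
  shows "strongly_measurable M f \<Longrightarrow> strongly_measurable M g \<Longrightarrow>
      strongly_measurable M (\<lambda>x. f x - g x)"
  by (erule (1) strongly_measurable_compose2) (intro continuous_intros)

lemma strongly_measurable_scaleR: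
  fixes f :: "'a \<Rightarrow> real" and g :: "'a \<Rightarrow> 'b::real_normed_vector"
  shows "strongly_measurable M f \<Longrightarrow> strongly_measurable M g \<Longrightarrow>
      strongly_measurable M (\<lambda>x. f x *\<^sub>R g x)"
  by (erule (1) strongly_measurable_compose2) (intro continuous_intros)

lemma strongly_measurable_inner:
  fixes f g :: "'a \<Rightarrow> 'b::real_inner"
  shows "strongly_measurable M f \<Longrightarrow> strongly_measurable M g \<Longrightarrow>
      strongly_measurable M (\<lambda>x. f x \<bullet> g x)"
  by (erule (1) strongly_measurable_compose2) (intro continuous_intros)

lemma strongly_measurable_blinfun_apply:
  fixes g :: "'a \<Rightarrow> 'b::real_normed_vector"
  shows "strongly_measurable M f \<Longrightarrow> strongly_measurable M g \<Longrightarrow>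
      strongly_measurable M (\<lambda>x. blinfun_apply (f x) (g x))"
  by (erule (1) strongly_measurable_compose2) (intro continuous_intros)

lemma strongly_measurable_sum:
  fixes f :: "'i \<Rightarrow> 'a \<Rightarrow> 'b::real_normed_vector"
  assumes "\<And>i. i \<in> I \<Longrightarrow> strongly_measurable M (f i)"
  shows "strongly_measurable M (\<lambda>x. \<Sum>i\<in>I. f i x)"
  using assms by (induction I rule: infinite_finite_induct) (auto intro: strongly_measurable_add)

text \<open>The capped integral measures distance in the sense of convergence in measure; the cap at
  1 supplies the integrable bound for dominated convergence although \<open>f\<close> may fail to be
  integrable.\<close>

lemma integral_min_tendsto_0:
  fixes f :: "'a \<Rightarrow> 'b::real_normed_vector"
  assumes f: "strongly_measurable M f" and s: "\<And>i. simple_function M (s i)"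
    and lim: "AE t in M. (\<lambda>i::nat. s i t) \<longlonglongrightarrow> f t"
  shows "(\<lambda>i. \<integral>t. min 1 (norm (f t - s i t)) \<partial>M) \<longlonglongrightarrow> 0"
proof -
  have m: "(\<lambda>t. min 1 (norm (f t - s i t))) \<in> borel_measurable M" for i
    by (intro borel_measurable_min borel_measurable_const strongly_measurable_norm
         strongly_measurable_diff f strongly_measurable_simple s)
  have "(\<lambda>i. \<integral>t. min 1 (norm (f t - s i t)) \<partial>M)
      \<longlonglongrightarrow> (\<integral>t. 0 \<partial>M)"
  proof (rule integral_dominated_convergence[where w="\<lambda>_. 1"])
    show "AE t in M. (\<lambda>i. min 1 (norm (f t - s i t))) \<longlonglongrightarrow> 0"
      using lim
    proof eventually_elim
      case (elim t)
      then have "(\<lambda>i. min 1 (norm (f t - s i t))) \<longlonglongrightarrow> min 1 (norm (f t - f t))"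
        by (intro tendsto_intros)
      then show ?case by simp
    qed
  qed (use m in auto)
  then show ?thesis by simp
qed

text \<open>Without separability this needs finiteness of the measure: one passes to simple functions
  that are close to the members of the sequence in measure.\<close>
lemma strongly_measurable_AE_limit:
  fixes f :: "nat \<Rightarrow> 'a \<Rightarrow> 'b::real_normed_vector"
  assumes f: "\<And>n. strongly_measurable M (f n)" and lim: "AE x in M. (\<lambda>n. f n x) \<longlonglongrightarrow> g x"
  shows "strongly_measurable M g"
proof -
  have "\<exists>s. simple_function M s \<and> (\<integral>t. min 1 (norm (f n t - s t)) \<partial>M) < (1/2)^n" for n
  proof -
    obtain s where s: "\<And>i. simple_function M (s i)"
        "AE t in M. (\<lambda>i::nat. s i t) \<longlonglongrightarrow> f n t"
      using f unfolding strongly_measurable_def by blast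
    have "eventually (\<lambda>i. (\<integral>t. min 1 (norm (f n t - s i t)) \<partial>M) < (1/2)^n) sequentially"
      by (rule order_tendstoD[OF integral_min_tendsto_0[OF f s]]) simp
    then obtain i where "(\<integral>t. min 1 (norm (f n t - s i t)) \<partial>M) < (1/2)^n"
      unfolding eventually_sequentially by blast
    then show ?thesis using s(1)[of i] by blast
  qed
  then have "\<exists>s. \<forall>n. simple_function M (s n) \<and> (\<integral>t. min 1 (norm (f n t
      - s n t)) \<partial>M) < (1/2)^n"
    by (rule choice[OF allI])
  then obtain s where s: "\<And>n. simple_function M (s n)"
    and le: "\<And>n. (\<integral>t. min 1 (norm (f n t - s n t)) \<partial>M) < (1/2)^n"
    by blast
  \<comment> \<open>The capped errors have integrals below \<open>(1/2)^n\<close>, so their sum has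
    finite integral and is finite almost everywhere. Where it is finite they tend to 0, and a capped
    error below 1 is the true error.\<close>
  define a where "a n t = min 1 (norm (f n t - s n t))" for n t
  have m: "a n \<in> borel_measurable M" for n
    unfolding a_def
    by (intro borel_measurable_min borel_measurable_const strongly_measurable_norm
         strongly_measurable_diff f strongly_measurable_simple s)
  have i: "integrable M (a n)" for n
    by (rule integrable_const_bound[where B=1]) (use m in \<open>auto simp: a_def\<close>)
  have a0: "a n t \<ge> 0" for n t by (simp add: a_def)
  have "(\<integral>\<^sup>+t. (\<Sum>n. ennreal (a n t)) \<partial>M)
      = (\<Sum>n. \<integral>\<^sup>+t. ennreal (a n t) \<partial>M)"
    by (intro nn_integral_suminf measurable_compose[OF m measurable_ennreal])
  also have "\<dots> = (\<Sum>n. ennreal (\<integral>t. a n t \<partial>M))"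
    by (intro suminf_cong nn_integral_eq_integral i) (simp add: a0)
  also have "\<dots> \<le> (\<Sum>n. ennreal ((1/2)^n))"
    by (intro suminf_le ennreal_leI) (use le in \<open>auto simp: a_def less_imp_le\<close>)
  also have "\<dots> = ennreal (\<Sum>n. (1/2)^n)"
    by (intro suminf_ennreal2) (auto intro: summable_geometric)
  finally have "(\<integral>\<^sup>+t. (\<Sum>n. ennreal (a n t)) \<partial>M) \<noteq> \<infinity>"
    using neq_top_trans[OF ennreal_neq_top] by simp
  then have "AE t in M. (\<Sum>n. ennreal (a n t)) \<noteq> \<infinity>"
    by (intro nn_integral_PInf_AE borel_measurable_suminf_order measurable_compose[OF m measurable_ennreal])
  with lim have "AE t in M. (\<lambda>n. s n t) \<longlonglongrightarrow> g t"
  proof eventually_elim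
    case (elim t)
    have "summable (\<lambda>n. a n t)"
      using elim(2) by (intro summable_suminf_not_top) (auto simp: a0)
    then have "(\<lambda>n. a n t) \<longlonglongrightarrow> 0" by (rule summable_LIMSEQ_zero)
    then have "(\<lambda>n. norm (f n t - s n t)) \<longlonglongrightarrow> 0"
    proof (rule Lim_transform_eventually)
      have "eventually (\<lambda>n. a n t < 1) sequentially"
        by (rule order_tendstoD[OF \<open>(\<lambda>n. a n t) \<longlonglongrightarrow> 0\<close>]) simp
      then show "eventually (\<lambda>n. a n t = norm (f n t - s n t)) sequentially"
        by eventually_elim (auto simp: a_def min_def split: if_splits)
    qed
    then have "(\<lambda>n. f n t - (f n t - s n t)) \<longlonglongrightarrow> g t - 0"
      by (intro tendsto_diff elim(1)) (rule tendsto_norm_zero_cancel)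
    then show ?case by simp
  qed
  then show ?thesis using s unfolding strongly_measurable_def by blast
qed

text \<open>For a simple \<open>y\<close> the composition is a finite sum of the functions
  \<open>f t c\<close>, each cut off to a level set of \<open>y\<close>. A general \<open>y\<close>
  is an almost everywhere limit of simple ones, and continuity in the second argument passes to that
  limit.\<close>

lemma strongly_measurable_Caratheodory:
  fixes f :: "'a \<Rightarrow> 'c::metric_space \<Rightarrow> 'b::real_normed_vector"
  assumes f: "\<And>c. strongly_measurable M (\<lambda>t. f t c)"
    and cont: "\<And>t. t \<in> space M \<Longrightarrow> continuous_on UNIV (f t)" and y: "strongly_measurable M y"
  shows "strongly_measurable M (\<lambda>t. f t (y t))"
proof -
  obtain s where s: "\<And>i. simple_function M (s i)" "AE t in M. (\<lambda>i::nat. s i t) \<longlonglongrightarrow> y t"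
    using y unfolding strongly_measurable_def by blast
  show ?thesis
  proof (rule strongly_measurable_AE_limit)
    fix i
    have fin: "finite (s i ` space M)" using s(1)[of i] by (simp add: simple_function_def)
    have "strongly_measurable M (\<lambda>t. \<Sum>c\<in>s i ` space M. indicator (s i -` {c} \<inter> space M)
        t *\<^sub>R f t c)"
      by (intro strongly_measurable_sum strongly_measurable_scaleR f strongly_measurable_simple
           simple_function_indicator simple_functionD(2)[OF s(1)])
    moreover have "(\<Sum>c\<in>s i ` space M. indicator (s i -` {c} \<inter> space M) t *\<^sub>R f t c) = f t (s i t)"
      if "t \<in> space M" for t
    proof -
      have "(\<Sum>c\<in>s i ` space M. indicator (s i -` {c} \<inter> space M) t *\<^sub>R f t c)
        = (\<Sum>c\<in>s i ` space M. if c = s i t then f t (s i t) else 0)"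
        by (rule sum.cong) (use that in \<open>auto split: split_indicator\<close>)
      also have "\<dots> = f t (s i t)" using that fin by (subst sum.delta) auto
      finally show ?thesis .
    qed
    ultimately show "strongly_measurable M (\<lambda>t. f t (s i t))"
      by (elim strongly_measurable_AE_cong) auto
  next
    show "AE t in M. (\<lambda>i. f t (s i t)) \<longlonglongrightarrow> f t (y t)"
      using s(2) AE_space
    proof eventually_elim
      case (elim t)
      have "isCont (f t) (y t)" using cont[OF elim(2)] by (simp add: continuous_on_eq_continuous_at)
      from isCont_tendsto_compose[OF this elim(1)] show ?case .
    qed
  qed
qed

section \<open>The Bochner integral without separability\<close>

lemma measurable_norm_diff_simple:
  fixes f :: "'a \<Rightarrow> 'b::real_normed_vector"
  shows "strongly_measurable M f \<Longrightarrow> simple_function M s \<Longrightarrow>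
    (\<lambda>t. ennreal (norm (f t - s t))) \<in> borel_measurable M"
  by (rule measurable_compose[OF strongly_measurable_norm[OF strongly_measurable_diff[OF _ strongly_measurable_simple]]
    measurable_ennreal])

lemma measurable_norm_simple:
  fixes s :: "'a \<Rightarrow> 'b::real_normed_vector"
  shows "simple_function M s \<Longrightarrow> (\<lambda>t. ennreal (norm (s t))) \<in> borel_measurable M"
  by (rule measurable_compose[OF strongly_measurable_norm[OF strongly_measurable_simple] measurable_ennreal])

text \<open>The support condition of simple Bochner integrability is automatic in a finite measure,
  so that later arguments carry \<open>simple_function\<close> alone.\<close>

lemma simple_bochner_integrable_simple:
  "simple_function M s \<Longrightarrow> simple_bochner_integrable M s"
  by (intro simple_bochner_integrable.intros) simp_all

lemma bochner_has_integralI: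
  fixes f :: "'a \<Rightarrow> 'b::real_normed_vector"
  assumes "strongly_measurable M f" "\<And>i::nat. simple_function M (s i)"
    "(\<lambda>i. \<integral>\<^sup>+ t. ennreal (norm (f t - s i t)) \<partial>M) \<longlonglongrightarrow> 0"
    "(\<lambda>i. simple_bochner_integral M (s i)) \<longlonglongrightarrow> x"
  shows "bochner_has_integral M f x"
  unfolding bochner_has_integral_def using assms simple_bochner_integrable_simple by blast

lemma bochner_has_integralE:
  fixes f :: "'a \<Rightarrow> 'b::real_normed_vector"
  assumes "bochner_has_integral M f x"
  obtains s where "strongly_measurable M f" "\<And>i::nat. simple_function M (s i)"
    "(\<lambda>i. \<integral>\<^sup>+ t. ennreal (norm (f t - s i t)) \<partial>M) \<longlonglongrightarrow> 0"
    "(\<lambda>i. simple_bochner_integral M (s i)) \<longlonglongrightarrow> x"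
proof -
  obtain s where s: "strongly_measurable M f" "\<And>i::nat. simple_bochner_integrable M (s i)"
    "(\<lambda>i. \<integral>\<^sup>+ t. ennreal (norm (f t - s i t)) \<partial>M) \<longlonglongrightarrow> 0"
    "(\<lambda>i. simple_bochner_integral M (s i)) \<longlonglongrightarrow> x"
    using assms unfolding bochner_has_integral_def by blast
  have "simple_function M (s i)" for i
    using s(2)[of i] by (rule simple_bochner_integrable.cases)
  with s that show thesis by blast
qed

lemma bochner_has_integral_strongly_measurable:
  "bochner_has_integral M f x \<Longrightarrow> strongly_measurable M f"
  by (simp add: bochner_has_integral_def)

text \<open>Here \<open>f\<close> is the intermediate point of a triangle inequality. With
  \<open>r = 0\<close> the estimate yields the norm bound for the integral; with two members of an
  approximating sequence it yields the Cauchy property.\<close>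

lemma norm_simple_bochner_integral_diff_le:
  fixes s r :: "'a \<Rightarrow> 'b::real_normed_vector"
  assumes s: "simple_function M s" and r: "simple_function M r" and f: "strongly_measurable M f"
  shows "ennreal (norm (simple_bochner_integral M s - simple_bochner_integral M r))
    \<le> (\<integral>\<^sup>+ t. ennreal (norm (f t - s t)) \<partial>M)
        + (\<integral>\<^sup>+ t. ennreal (norm (f t - r t)) \<partial>M)"
proof -
  note si = simple_bochner_integrable_simple[OF s] and ri = simple_bochner_integrable_simple[OF r]
  have di: "simple_bochner_integrable M (\<lambda>t. s t - r t)"
    by (rule simple_bochner_integrable_compose2[where p="(-)", OF _ si ri]) simp
  have "ennreal (norm (simple_bochner_integral M s - simple_bochner_integral M r))
    = ennreal (norm (simple_bochner_integral M (\<lambda>t. s t - r t)))"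
    by (simp add: simple_bochner_integral_diff[OF si ri])
  also have "\<dots> \<le> ennreal (simple_bochner_integral M (\<lambda>t. norm (s t - r t)))"
    by (intro ennreal_leI simple_bochner_integral_norm_bound di)
  also have "\<dots> = (\<integral>\<^sup>+ t. ennreal (norm (s t - r t)) \<partial>M)"
    by (rule simple_bochner_integral_eq_nn_integral[OF simple_bochner_integrable_simple[OF
       simple_function_compose2[where h="\<lambda>a b. norm (a - b)", OF s r]]]) simp
  also have "\<dots> \<le> (\<integral>\<^sup>+ t. ennreal (norm (f t - s t)) + ennreal (norm (f t - r t)) \<partial>M)"
  proof (rule nn_integral_mono)
    fix t
    have "norm (s t - r t) \<le> norm (f t - s t) + norm (f t - r t)"
      using norm_triangle_ineq4[of "f t - r t" "f t - s t"] by simp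
    then show "ennreal (norm (s t - r t)) \<le> ennreal (norm (f t - s t)) + ennreal (norm (f t - r t))"
      by (simp flip: ennreal_plus)
  qed
  also have "\<dots> = (\<integral>\<^sup>+ t. ennreal (norm (f t - s t)) \<partial>M)
      + (\<integral>\<^sup>+ t. ennreal (norm (f t - r t)) \<partial>M)"
    by (rule nn_integral_add[OF measurable_norm_diff_simple[OF f s] measurable_norm_diff_simple[OF f r]])
  finally show ?thesis .
qed

lemma simple_function_integrable_norm:
  fixes s :: "'a \<Rightarrow> 'b::real_normed_vector"
  assumes "simple_function M s"
  shows "integrable M (\<lambda>t. norm (s t))"
proof -
  have n: "simple_function M (\<lambda>t. norm (s t))" using assms by (rule simple_function_compose1)
  have "finite ((\<lambda>t. norm (s t)) ` space M)" using n by (simp add: simple_function_def)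
  then have "norm (s t) \<le> Max ((\<lambda>t. norm (s t)) ` space M)" if "t \<in> space M" for t
    using that by (intro Max_ge) auto
  then show ?thesis
    by (intro integrable_const_bound[where B="Max ((\<lambda>t. norm (s t)) ` space M)"]) (auto intro:
        borel_measurable_simple_function n)
qed

lemma bochner_has_integral_integrable_norm:
  fixes f :: "'a \<Rightarrow> 'b::real_normed_vector"
  assumes "bochner_has_integral M f x"
  shows "integrable M (\<lambda>t. norm (f t))"
proof -
  obtain s where s: "strongly_measurable M f" "\<And>i::nat. simple_function M (s i)"
    "(\<lambda>i. \<integral>\<^sup>+ t. ennreal (norm (f t - s i t)) \<partial>M) \<longlonglongrightarrow> 0"
    using assms by (rule bochner_has_integralE) blast
  have "eventually (\<lambda>i. (\<integral>\<^sup>+ t. ennreal (norm (f t - s i t)) \<partial>M) < 1) sequentially"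
    by (rule order_tendstoD[OF s(3)]) simp
  then obtain i where i: "(\<integral>\<^sup>+ t. ennreal (norm (f t - s i t)) \<partial>M) < 1"
    by (auto simp: eventually_sequentially)
  have "(\<integral>\<^sup>+ t. ennreal (norm (f t)) \<partial>M)
      \<le> (\<integral>\<^sup>+ t. ennreal (norm (f t - s i t)) + ennreal (norm (s i t)) \<partial>M)"
  proof (rule nn_integral_mono)
    fix t
    have "norm (f t) \<le> norm (f t - s i t) + norm (s i t)"
      using norm_triangle_ineq[of "f t - s i t" "s i t"] by simp
    then show "ennreal (norm (f t)) \<le> ennreal (norm (f t - s i t)) + ennreal (norm (s i t))"
      by (simp flip: ennreal_plus)
  qed
  also have "\<dots> = (\<integral>\<^sup>+ t. ennreal (norm (f t - s i t)) \<partial>M)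
      + (\<integral>\<^sup>+ t. ennreal (norm (s i t)) \<partial>M)"
    by (rule nn_integral_add[OF measurable_norm_diff_simple[OF s(1,2)] measurable_norm_simple[OF s(2)]])
  also have "\<dots> < \<infinity>"
  proof -
    have "(\<integral>\<^sup>+ t. ennreal (norm (s i t)) \<partial>M) < \<infinity>"
      using simple_function_integrable_norm[OF s(2)[of i]] unfolding integrable_iff_bounded by simp
    moreover have "(\<integral>\<^sup>+ t. ennreal (norm (f t - s i t)) \<partial>M) < \<infinity>"
      using less_trans[OF i ennreal_one_less_top] by simp
    ultimately show ?thesis by (simp add: ennreal_add_less_top)
  qed
  finally show ?thesis
    by (intro integrableI_bounded strongly_measurable_norm s(1)) simp
qed

lemma bochner_has_integral_norm_le:
  fixes f :: "'a \<Rightarrow> 'b::real_normed_vector"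
  assumes "bochner_has_integral M f x"
  shows "norm x \<le> (\<integral>t. norm (f t) \<partial>M)"
proof -
  obtain s where s: "strongly_measurable M f" "\<And>i::nat. simple_function M (s i)"
    "(\<lambda>i. \<integral>\<^sup>+ t. ennreal (norm (f t - s i t)) \<partial>M) \<longlonglongrightarrow> 0"
    "(\<lambda>i. simple_bochner_integral M (s i)) \<longlonglongrightarrow> x"
    using assms by (rule bochner_has_integralE) blast
  have "ennreal (norm x) \<le> 0 + (\<integral>\<^sup>+ t. ennreal (norm (f t)) \<partial>M)"
  proof (rule tendsto_le[OF sequentially_bot])
    show "(\<lambda>i. ennreal (norm (simple_bochner_integral M (s i)))) \<longlonglongrightarrow> ennreal (norm x)"
      by (intro tendsto_ennrealI tendsto_norm s)
    show "(\<lambda>i. (\<integral>\<^sup>+ t. ennreal (norm (f t - s i t)) \<partial>M)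
        + (\<integral>\<^sup>+ t. ennreal (norm (f t)) \<partial>M))
      \<longlonglongrightarrow> 0 + (\<integral>\<^sup>+ t. ennreal (norm (f t)) \<partial>M)"
      by (intro tendsto_add s tendsto_const)
    have z: "simple_bochner_integral M (\<lambda>_. 0::'b) = 0"
      by (simp add: Bochner_Integration.simple_bochner_integral_def) (rule sum.neutral, auto)
    show "\<forall>\<^sub>F i in sequentially. ennreal (norm (simple_bochner_integral M (s i)))
       \<le> (\<integral>\<^sup>+ t. ennreal (norm (f t - s i t)) \<partial>M)
           + (\<integral>\<^sup>+ t. ennreal (norm (f t)) \<partial>M)"
      using norm_simple_bochner_integral_diff_le[OF s(2) simple_function_const[of _ "0::'b"] s(1)] z
      by simp
  qed
  also have "0 + (\<integral>\<^sup>+ t. ennreal (norm (f t)) \<partial>M) = ennreal (\<integral>t. norm (f t) \<partial>M)"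
    using bochner_has_integral_integrable_norm[OF assms] by (simp add: nn_integral_eq_integral)
  finally show ?thesis by (simp add: integral_nonneg_AE)
qed

lemma bochner_has_integral_bounded_linear:
  fixes f :: "'a \<Rightarrow> 'b::real_normed_vector"
  assumes "bochner_has_integral M f x" and h: "bounded_linear h"
  shows "bochner_has_integral M (\<lambda>t. h (f t)) (h x)"
proof -
  interpret h: bounded_linear h by fact
  obtain s where s: "strongly_measurable M f" "\<And>i::nat. simple_function M (s i)"
    "(\<lambda>i. \<integral>\<^sup>+ t. ennreal (norm (f t - s i t)) \<partial>M) \<longlonglongrightarrow> 0"
    "(\<lambda>i. simple_bochner_integral M (s i)) \<longlonglongrightarrow> x"
    using assms(1) by (rule bochner_has_integralE) blast
  obtain K where K: "\<And>y. norm (h y) \<le> norm y * K" "K \<ge> 0" using h.nonneg_bounded by blast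
  show ?thesis
  proof (rule bochner_has_integralI)
    show "strongly_measurable M (\<lambda>t. h (f t))"
      by (intro strongly_measurable_compose[OF s(1)] h.continuous_on continuous_on_id)
    show "simple_function M (\<lambda>t. h (s i t))" for i
      using s(2) by (rule simple_function_compose1)
    have "simple_bochner_integral M (\<lambda>t. h (s i t)) = h (simple_bochner_integral M (s i))" for i
      by (intro simple_bochner_integral_linear simple_bochner_integrable_simple s(2) h.linear)
    then show "(\<lambda>i. simple_bochner_integral M (\<lambda>t. h (s i t))) \<longlonglongrightarrow> h x"
      using h.tendsto[OF s(4)] by simp
    show "(\<lambda>i. \<integral>\<^sup>+ t. ennreal (norm (h (f t) - h (s i t))) \<partial>M) \<longlonglongrightarrow> 0"
    proof (rule tendsto_sandwich[OF _ _ tendsto_const])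
      show "\<forall>\<^sub>F i in sequentially. (\<integral>\<^sup>+ t. ennreal (norm (h (f t) - h (s i t))) \<partial>M)
          \<le> (\<integral>\<^sup>+ t. ennreal (norm (f t - s i t)) \<partial>M) * ennreal K"
      proof (intro always_eventually allI)
        fix i
        have "(\<integral>\<^sup>+ t. ennreal (norm (h (f t) - h (s i t))) \<partial>M)
          \<le> (\<integral>\<^sup>+ t. ennreal (norm (f t - s i t)) * ennreal K \<partial>M)"
        proof (rule nn_integral_mono)
          fix t
          have "norm (h (f t) - h (s i t)) \<le> norm (f t - s i t) * K"
            using K(1)[of "f t - s i t"] by (simp add: h.diff)
          then show "ennreal (norm (h (f t) - h (s i t))) \<le> ennreal (norm (f t - s i t)) * ennreal K"
            using ennreal_leI by (simp add: K(2) flip: ennreal_mult)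
        qed
        also have "\<dots> = (\<integral>\<^sup>+ t. ennreal (norm (f t - s i t)) \<partial>M) * ennreal K"
          by (rule nn_integral_multc[OF measurable_norm_diff_simple[OF s(1,2)]])
        finally show "(\<integral>\<^sup>+ t. ennreal (norm (h (f t) - h (s i t))) \<partial>M)
          \<le> (\<integral>\<^sup>+ t. ennreal (norm (f t - s i t)) \<partial>M) * ennreal K" .
      qed
      have "(\<lambda>i. (\<integral>\<^sup>+ t. ennreal (norm (f t
          - s i t)) \<partial>M) * ennreal K) \<longlonglongrightarrow> 0 * ennreal K"
        by (intro tendsto_mult_ennreal s tendsto_const) auto
      then show "(\<lambda>i. (\<integral>\<^sup>+ t. ennreal (norm (f t
          - s i t)) \<partial>M) * ennreal K) \<longlonglongrightarrow> 0"
        by simp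
    qed simp
  qed
qed

lemma bochner_has_integral_add:
  fixes f g :: "'a \<Rightarrow> 'b::real_normed_vector"
  assumes "bochner_has_integral M f x" "bochner_has_integral M g y"
  shows "bochner_has_integral M (\<lambda>t. f t + g t) (x + y)"
proof -
  obtain s where s: "strongly_measurable M f" "\<And>i::nat. simple_function M (s i)"
    "(\<lambda>i. \<integral>\<^sup>+ t. ennreal (norm (f t - s i t)) \<partial>M) \<longlonglongrightarrow> 0"
    "(\<lambda>i. simple_bochner_integral M (s i)) \<longlonglongrightarrow> x"
    using assms(1) by (rule bochner_has_integralE) blast
  obtain r where r: "strongly_measurable M g" "\<And>i::nat. simple_function M (r i)"
    "(\<lambda>i. \<integral>\<^sup>+ t. ennreal (norm (g t - r i t)) \<partial>M) \<longlonglongrightarrow> 0"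
    "(\<lambda>i. simple_bochner_integral M (r i)) \<longlonglongrightarrow> y"
    using assms(2) by (rule bochner_has_integralE) blast
  show ?thesis
  proof (rule bochner_has_integralI)
    show "strongly_measurable M (\<lambda>t. f t + g t)"
      by (intro strongly_measurable_add s r)
    show "simple_function M (\<lambda>t. s i t + r i t)" for i
      using s(2) r(2) by (rule simple_function_compose2)
    have "simple_bochner_integral M (\<lambda>t. s i t + r i t)
        = simple_bochner_integral M (s i) + simple_bochner_integral M (r i)" for i
      by (intro simple_bochner_integral_add simple_bochner_integrable_simple s r)
    then show "(\<lambda>i. simple_bochner_integral M (\<lambda>t. s i t + r i t)) \<longlonglongrightarrow> x + y"
      using tendsto_add[OF s(4) r(4)] by simp
    show "(\<lambda>i. \<integral>\<^sup>+ t. ennreal (norm (f t + g t - (s i t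
        + r i t))) \<partial>M) \<longlonglongrightarrow> 0"
    proof (rule tendsto_sandwich[OF _ _ tendsto_const])
      show "\<forall>\<^sub>F i in sequentially. (\<integral>\<^sup>+ t. ennreal (norm (f t + g t - (s i t
          + r i t))) \<partial>M)
          \<le> (\<integral>\<^sup>+ t. ennreal (norm (f t - s i t)) \<partial>M)
              + (\<integral>\<^sup>+ t. ennreal (norm (g t - r i t)) \<partial>M)"
      proof (intro always_eventually allI)
        fix i
        have "(\<integral>\<^sup>+ t. ennreal (norm (f t + g t - (s i t + r i t))) \<partial>M)
          \<le> (\<integral>\<^sup>+ t. ennreal (norm (f t - s i t)) + ennreal (norm (g t - r i t)) \<partial>M)"
        proof (rule nn_integral_mono)
          fix t
          have "norm (f t + g t - (s i t + r i t)) \<le> norm (f t - s i t) + norm (g t - r i t)"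
            unfolding add_diff_add by (rule norm_triangle_ineq)
          then show "ennreal (norm (f t + g t - (s i t + r i t)))
              \<le> ennreal (norm (f t - s i t)) + ennreal (norm (g t - r i t))"
            by (simp flip: ennreal_plus)
        qed
        also have "\<dots> = (\<integral>\<^sup>+ t. ennreal (norm (f t - s i t)) \<partial>M)
            + (\<integral>\<^sup>+ t. ennreal (norm (g t - r i t)) \<partial>M)"
          by (rule nn_integral_add[OF measurable_norm_diff_simple[OF s(1,2)] measurable_norm_diff_simple[OF r(1,2)]])
        finally show "(\<integral>\<^sup>+ t. ennreal (norm (f t + g t - (s i t + r i t))) \<partial>M)
          \<le> (\<integral>\<^sup>+ t. ennreal (norm (f t - s i t)) \<partial>M)
              + (\<integral>\<^sup>+ t. ennreal (norm (g t - r i t)) \<partial>M)" .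
      qed
      show "(\<lambda>i. (\<integral>\<^sup>+ t. ennreal (norm (f t - s i t)) \<partial>M)
          + (\<integral>\<^sup>+ t. ennreal (norm (g t - r i t)) \<partial>M)) \<longlonglongrightarrow> 0"
        using tendsto_add[OF s(3) r(3)] by simp
    qed simp
  qed
qed

lemma bochner_has_integral_scaleR:
  "bochner_has_integral M f x \<Longrightarrow> bochner_has_integral M (\<lambda>t. c *\<^sub>R f t) (c *\<^sub>R x)"
  using bochner_has_integral_bounded_linear[OF _ bounded_linear_scaleR_right] .

lemma bochner_has_integral_diff:
  assumes "bochner_has_integral M f x" "bochner_has_integral M g y"
  shows "bochner_has_integral M (\<lambda>t. f t - g t) (x - y)"
  using bochner_has_integral_add[OF assms(1) bochner_has_integral_scaleR[OF assms(2), of "-1"]] by simp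

lemma bochner_has_integral_AE_cong:
  fixes f g :: "'a \<Rightarrow> 'b::real_normed_vector"
  assumes "bochner_has_integral M f x" "AE t in M. f t = g t"
  shows "bochner_has_integral M g x"
proof -
  obtain s where s: "strongly_measurable M f" "\<And>i::nat. simple_function M (s i)"
    "(\<lambda>i. \<integral>\<^sup>+ t. ennreal (norm (f t - s i t)) \<partial>M) \<longlonglongrightarrow> 0"
    "(\<lambda>i. simple_bochner_integral M (s i)) \<longlonglongrightarrow> x"
    using assms(1) by (rule bochner_has_integralE) blast
  have "(\<integral>\<^sup>+ t. ennreal (norm (f t - s i t)) \<partial>M)
      = (\<integral>\<^sup>+ t. ennreal (norm (g t - s i t)) \<partial>M)" for i
    by (rule nn_integral_cong_AE) (use assms(2) in eventually_elim, simp)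
  then show ?thesis
    using s strongly_measurable_AE_cong[OF s(1) assms(2)] by (intro bochner_has_integralI) auto
qed

lemma bochner_has_integral_unique:
  assumes "bochner_has_integral M f x" "bochner_has_integral M f y"
  shows "x = y"
  using bochner_has_integral_norm_le[OF bochner_has_integral_diff[OF assms]] by simp

lemma bochner_has_integral_real:
  fixes f :: "'a \<Rightarrow> real"
  assumes "bochner_has_integral M f x"
  shows "integrable M f" "integral\<^sup>L M f = x"
proof -
  have m: "f \<in> borel_measurable M"
    by (intro strongly_measurable_real bochner_has_integral_strongly_measurable[OF assms])
  have "has_bochner_integral M f x"
    using assms m unfolding bochner_has_integral_def by (auto intro: has_bochner_integral.intros)
  then show "integrable M f" "integral\<^sup>L M f = x"
    by (simp_all add: has_bochner_integral_iff)
qed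

text \<open>The approximants are cut off where their norm exceeds twice that of \<open>f\<close>.
  This leaves the limit unchanged and bounds the errors by three times the norm of \<open>f\<close>,
  so the errors tend to 0 in \<open>L1\<close>. The simple integrals are then Cauchy and
  completeness of the value space supplies the limit.\<close>

lemma bochner_has_integral_exists:
  fixes f :: "'a \<Rightarrow> 'b::banach"
  assumes f: "strongly_measurable M f" and int: "integrable M (\<lambda>t. norm (f t))"
  shows "\<exists>x. bochner_has_integral M f x"
proof -
  obtain s where s: "\<And>i. simple_function M (s i)" "AE t in M. (\<lambda>i::nat. s i t) \<longlonglongrightarrow> f t"
    using f unfolding strongly_measurable_def by blast
  define A where "A i = {t \<in> space M. norm (s i t) \<le> 2 * norm (f t)}" for i
  define r where "r i t = indicator (A i) t *\<^sub>R s i t" for i t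
  have A: "A i \<in> sets M" for i
    unfolding A_def by (intro borel_measurable_le borel_measurable_times borel_measurable_const
      strongly_measurable_norm f strongly_measurable_simple s(1))
  have r: "simple_function M (r i)" for i
    unfolding r_def
      by (intro simple_function_compose2[where h="(*\<^sub>R)"] simple_function_indicator A s(1))
  have rlim: "AE t in M. (\<lambda>i. r i t) \<longlonglongrightarrow> f t"
    using s(2) AE_space
  proof eventually_elim
    case (elim t)
    show ?case
    proof (cases "f t = 0")
      case True
      have "norm (r i t) \<le> norm (s i t)" for i by (simp add: r_def indicator_def)
      moreover have "(\<lambda>i. norm (s i t)) \<longlonglongrightarrow> 0"
        using tendsto_norm[OF elim(1)] True by simp
      ultimately have "(\<lambda>i. r i t) \<longlonglongrightarrow> 0"
        by (auto intro!: Lim_null_comparison[where g="\<lambda>i. norm (s i t)"])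
      then show ?thesis using True by simp
    next
      case False
      have "eventually (\<lambda>i. norm (s i t) < 2 * norm (f t)) sequentially"
        by (rule order_tendstoD[OF tendsto_norm[OF elim(1)]]) (use False in simp)
      then have "eventually (\<lambda>i. s i t = r i t) sequentially"
        by eventually_elim (use elim(2) in \<open>simp add: r_def A_def\<close>)
      with elim(1) show ?thesis by (rule Lim_transform_eventually)
    qed
  qed
  have rn: "norm (f t - r i t) \<le> 3 * norm (f t)" for i t
  proof -
    have "norm (r i t) \<le> 2 * norm (f t)" by (simp add: r_def A_def indicator_def)
    then show ?thesis using norm_triangle_ineq4[of "f t" "r i t"] by linarith
  qed
  have m: "(\<lambda>t. norm (f t - r i t)) \<in> borel_measurable M" for i
    by (intro strongly_measurable_norm strongly_measurable_diff f strongly_measurable_simple r)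
  have li: "(\<lambda>i. \<integral>t. norm (f t - r i t) \<partial>M)
      \<longlonglongrightarrow> (\<integral>t. 0 \<partial>M)"
  proof (rule integral_dominated_convergence[where w="\<lambda>t. 3 * norm (f t)"])
    show "AE t in M. (\<lambda>i. norm (f t - r i t)) \<longlonglongrightarrow> 0"
      using rlim
    proof eventually_elim
      case (elim t)
      have "(\<lambda>i. norm (f t - r i t)) \<longlonglongrightarrow> norm (f t - f t)"
        by (intro tendsto_intros elim)
      then show ?case by simp
    qed
  qed (use m int rn in auto)
  have int': "integrable M (\<lambda>t. norm (f t - r i t))" for i
    by (rule Bochner_Integration.integrable_bound[where f="\<lambda>t. 3 * norm (f t)"]) (use m int rn in auto)
  have eq: "(\<integral>\<^sup>+ t. ennreal (norm (f t - r i t)) \<partial>M)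
      = ennreal (\<integral>t. norm (f t - r i t) \<partial>M)" for i
    by (intro nn_integral_eq_integral int') simp
  have lim0: "(\<lambda>i. \<integral>\<^sup>+ t. ennreal (norm (f t - r i t)) \<partial>M) \<longlonglongrightarrow> 0"
    unfolding eq using tendsto_ennrealI[OF li] by simp
  have "Cauchy (\<lambda>i. simple_bochner_integral M (r i))"
  proof (rule metric_CauchyI)
    fix e :: real assume "e > 0"
    have "eventually (\<lambda>i. (\<integral>t. norm (f t - r i t) \<partial>M) < e/2) sequentially"
      by (rule order_tendstoD[OF li]) (use \<open>e > 0\<close> in simp)
    then obtain N where N: "\<And>i. i \<ge> N \<Longrightarrow> (\<integral>t. norm (f t - r i t) \<partial>M) < e/2"
      by (auto simp: eventually_sequentially)
    show "\<exists>N. \<forall>m\<ge>N. \<forall>n\<ge>N. dist (simple_bochner_integral M (r m))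
        (simple_bochner_integral M (r n)) < e"
    proof (intro exI[of _ N] allI impI)
      fix m n assume mn: "m \<ge> N" "n \<ge> N"
      have "norm (simple_bochner_integral M (r m) - simple_bochner_integral M (r n))
        \<le> (\<integral>t. norm (f t - r m t) \<partial>M) + (\<integral>t. norm (f t - r n t) \<partial>M)"
        using norm_simple_bochner_integral_diff_le[OF r r f, of m n]
        by (simp add: eq integral_nonneg_AE flip: ennreal_plus)
      then show "dist (simple_bochner_integral M (r m)) (simple_bochner_integral M (r n)) < e"
        using N[OF mn(1)] N[OF mn(2)] by (simp add: dist_norm)
    qed
  qed
  then obtain x where "(\<lambda>i. simple_bochner_integral M (r i)) \<longlonglongrightarrow> x"
    by (auto simp: Cauchy_convergent_iff convergent_def)
  then show ?thesis using bochner_has_integralI[OF f r lim0] by blast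
qed

end

section \<open>Hilbert spaces and semigroups\<close>

text \<open>Direct method: minimize \<open>q w = w . w - 2 phi w\<close> over \<open>W\<close>. The
  parallelogram identity makes a minimizing sequence Cauchy, and the first order condition at the
  limit is the representation. With \<open>phi\<close> an inner product with x the result is the
  orthogonal projection of x; with \<open>W = UNIV\<close> it is the Riesz theorem.\<close>

lemma riesz_on_closed_subspace:
  fixes \<phi> :: "'x::{real_inner, banach} \<Rightarrow>\<^sub>L real"
  assumes W: "subspace W" and cl: "closed W"
  shows "\<exists>p\<in>W. \<forall>w\<in>W. \<phi> w = p \<bullet> w"
proof -
  define q where "q w = w \<bullet> w - 2 * \<phi> w" for w
  have qb: "- ((norm \<phi>)\<^sup>2) \<le> q w" for w
  proof -
    have "\<phi> w \<le> norm \<phi> * norm w" using norm_blinfun[of \<phi> w] by (simp add: abs_le_iff)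
    moreover have "2 * (norm \<phi> * norm w) \<le> w \<bullet> w + (norm \<phi>)\<^sup>2"
      using sum_squares_bound[of "norm \<phi>" "norm w"] by (simp add: power2_norm_eq_inner)
    ultimately show ?thesis unfolding q_def by linarith
  qed
  define m where "m = (INF w\<in>W. q w)"
  have bdd: "bdd_below (q ` W)" by (rule bdd_belowI2[where m="- ((norm \<phi>)\<^sup>2)"]) (rule qb)
  have ne: "q ` W \<noteq> {}" using W subspace_0 by blast
  have mle: "m \<le> q w" if "w \<in> W" for w unfolding m_def using bdd that by (rule cINF_lower)
  have ex: "\<exists>w\<in>W. q w < m + inverse (Suc n)" for n
    using cInf_lessD[OF ne, of "m + inverse (Suc n)"] by (auto simp: m_def)
  then have "\<forall>n. \<exists>w. w \<in> W \<and> q w < m + inverse (Suc n)" by blast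
  then obtain w where wW: "\<And>n. w n \<in> W" and wq: "\<And>n. q (w n) < m + inverse (Suc n)"
    unfolding choice_iff by blast
  have par: "(norm (a - b))\<^sup>2 = 2 * q a + 2 * q b - 4 * q ((1/2) *\<^sub>R (a + b))" for a b
  proof -
    have 1: "(norm (a - b))\<^sup>2 = a \<bullet> a - 2 * (a \<bullet> b) + b \<bullet> b"
      by (simp add: power2_norm_eq_inner inner_diff_left inner_diff_right inner_commute[of b a])
    have 2: "((1/2) *\<^sub>R (a + b)) \<bullet> ((1/2) *\<^sub>R (a + b))
        = (a \<bullet> a + 2 * (a \<bullet> b) + b \<bullet> b) / 4"
      by (simp add: inner_add_left inner_add_right inner_commute[of b a]) (simp add: field_simps)
    have 3: "\<phi> ((1/2) *\<^sub>R (a + b)) = (\<phi> a + \<phi> b) / 2"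
      by (simp add: blinfun.scaleR_right blinfun.add_right)
    show ?thesis unfolding q_def 1 2 3 by (simp add: add_divide_distrib)
  qed
  have close: "(norm (w i - w j))\<^sup>2 \<le> 2 * inverse (Suc i) + 2 * inverse (Suc j)" for i j
  proof -
    have "(1/2) *\<^sub>R (w i + w j) \<in> W" using W wW by (intro subspace_mul subspace_add)
    then have "m \<le> q ((1/2) *\<^sub>R (w i + w j))" by (rule mle)
    then show ?thesis unfolding par using wq[of i] wq[of j] by linarith
  qed
  have "Cauchy w"
  proof (rule metric_CauchyI)
    fix e :: real assume e: "e > 0"
    obtain N where N: "inverse (real (Suc N)) < e\<^sup>2 / 4"
      using reals_Archimedean[of "e\<^sup>2/4"] e by auto
    have "norm (w i - w j) < e" if "i \<ge> N" "j \<ge> N" for i j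
    proof -
      have "inverse (real (Suc i)) \<le> inverse (real (Suc N))" "inverse (real (Suc j)) \<le> inverse (real (Suc N))"
        using that by (auto intro!: le_imp_inverse_le)
      then have "(norm (w i - w j))\<^sup>2 < e\<^sup>2" using close[of i j] N by linarith
      then show ?thesis by (rule power2_less_imp_less) (use e in simp)
    qed
    then show "\<exists>N. \<forall>m\<ge>N. \<forall>n\<ge>N. dist (w m) (w n) < e" by (auto simp: dist_norm)
  qed
  then obtain p where p: "w \<longlonglongrightarrow> p" by (auto simp: Cauchy_convergent_iff convergent_def)
  have pW: "p \<in> W" using closed_sequentially[OF cl _ p] wW by blast
  have "(\<lambda>n. q (w n)) \<longlonglongrightarrow> q p" unfolding q_def by (intro tendsto_intros p)
  moreover have "(\<lambda>n. m + inverse (Suc n)) \<longlonglongrightarrow> m + 0"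
    by (intro tendsto_intros LIMSEQ_inverse_real_of_nat)
  ultimately have qp: "q p \<le> m"
    by (intro tendsto_le[OF sequentially_bot _ \<open>(\<lambda>n. q (w n))
        \<longlonglongrightarrow> q p\<close>]) (use wq in \<open>auto intro!: always_eventually less_imp_le\<close>)
  have "\<phi> v = p \<bullet> v" if v: "v \<in> W" for v
  proof (rule ccontr)
    define b where "b = p \<bullet> v - \<phi> v"
    assume "\<phi> v \<noteq> p \<bullet> v"
    then have b: "b \<noteq> 0" by (simp add: b_def)
    have ineq: "0 \<le> t\<^sup>2 * (v \<bullet> v) + 2 * t * b" for t
    proof -
      have "p + t *\<^sub>R v \<in> W" using W pW v by (intro subspace_add subspace_mul)
      then have "q p \<le> q (p + t *\<^sub>R v)" using mle[of "p + t *\<^sub>R v"] qp by linarith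
      moreover have "(p + t *\<^sub>R v) \<bullet> (p + t *\<^sub>R v)
          = p \<bullet> p + 2 * t * (p \<bullet> v) + t\<^sup>2 * (v \<bullet> v)"
        by (simp add: inner_add_left inner_add_right inner_commute[of v p] power2_eq_square algebra_simps)
      moreover have "\<phi> (p + t *\<^sub>R v) = \<phi> p + t * \<phi> v"
        by (simp add: blinfun.add_right blinfun.scaleR_right)
      ultimately show ?thesis unfolding q_def b_def by (simp add: right_diff_distrib algebra_simps)
    qed
    \<comment> \<open>The minimizer of the quadratic in \<open>ineq\<close> has denominator
      \<open>v . v\<close>; the added 1 keeps the denominator positive without a case split and
      still makes the quadratic negative.\<close>
    define t where "t = - b / (v \<bullet> v + 1)"
    have pos: "v \<bullet> v + 1 > 0" by (simp add: add_nonneg_pos)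
    have tb: "t * (v \<bullet> v + 1) = - b" using pos by (simp add: t_def)
    have "0 \<le> t\<^sup>2 * (v \<bullet> v) + 2 * t * b" by (rule ineq)
    also have "2 * t * b = - 2 * t * (t * (v \<bullet> v + 1))"
      unfolding tb by simp
    also have "\<dots> = - 2 * t\<^sup>2 * (v \<bullet> v + 1)" by (simp add: power2_eq_square)
    finally have "0 \<le> - (t\<^sup>2 * (v \<bullet> v)) - 2 * t\<^sup>2" by (simp add: algebra_simps)
    moreover have "t\<^sup>2 * (v \<bullet> v) \<ge> 0" by simp
    moreover have "t\<^sup>2 > 0"
    proof -
      have "t \<noteq> 0" unfolding t_def using b pos by simp
      then show ?thesis by simp
    qed
    ultimately show False by linarith
  qed
  with pW show ?thesis by blast
qed

lemma orthogonal_projection_exists: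
  fixes x :: "'x::{real_inner, banach}"
  assumes "subspace W" "closed W"
  shows "\<exists>p\<in>W. \<forall>w\<in>W. (x - p) \<bullet> w = 0"
  using riesz_on_closed_subspace[OF assms, of "blinfun_inner_right x"] by (auto simp: inner_diff_left)

definition riesz :: "('x::{real_inner, banach} \<Rightarrow>\<^sub>L real) \<Rightarrow> 'x" where
  "riesz \<phi> = (SOME p. \<forall>x. \<phi> x = p \<bullet> x)"

lemma riesz_inner: "riesz \<phi> \<bullet> x = \<phi> x"
proof -
  have "\<exists>p. \<forall>x. \<phi> x = p \<bullet> x"
    using riesz_on_closed_subspace[of UNIV \<phi>] by auto
  then have "\<forall>x. \<phi> x = riesz \<phi> \<bullet> x" unfolding riesz_def by (rule someI_ex)
  then show ?thesis by (metis (no_types))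
qed

lemma riesz_unique:
  fixes \<phi> :: "'x::{real_inner, banach} \<Rightarrow>\<^sub>L real"
  shows "(\<And>x. p \<bullet> x = \<phi> x) \<Longrightarrow> riesz \<phi> = p"
proof -
  assume *: "\<And>x. p \<bullet> x = \<phi> x"
  have "(riesz \<phi> - p) \<bullet> (riesz \<phi> - p) = 0"
    unfolding inner_diff_left[of _ _ "riesz \<phi> - p"] by (simp only: riesz_inner *)
  then show ?thesis by simp
qed

lemma norm_riesz: "norm (riesz \<phi>) = norm \<phi>"
proof (rule antisym)
  have "(norm (riesz \<phi>))\<^sup>2 \<le> norm \<phi> * norm (riesz \<phi>)"
    using norm_blinfun[of \<phi> "riesz \<phi>"] by (simp add: power2_norm_eq_inner riesz_inner abs_le_iff)
  then show "norm (riesz \<phi>) \<le> norm \<phi>"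
    by (cases "norm (riesz \<phi>) = 0") (auto simp: power2_eq_square)
  show "norm \<phi> \<le> norm (riesz \<phi>)"
  proof (rule norm_blinfun_bound)
    show "norm (\<phi> x) \<le> norm (riesz \<phi>) * norm x" for x
      using Cauchy_Schwarz_ineq2[of "riesz \<phi>" x] by (simp add: riesz_inner)
  qed simp
qed

lemma bounded_linear_riesz: "bounded_linear riesz"
proof (rule bounded_linear_intro[where K=1])
  show "riesz (\<phi> + \<psi>) = riesz \<phi> + riesz \<psi>" for \<phi> \<psi> :: "'a \<Rightarrow>\<^sub>L real"
    by (rule riesz_unique) (simp add: inner_add_left riesz_inner blinfun.add_left)
  show "riesz (r *\<^sub>R \<phi>) = r *\<^sub>R riesz \<phi>" for r and \<phi> :: "'a \<Rightarrow>\<^sub>L real"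
    by (rule riesz_unique) (simp add: riesz_inner blinfun.scaleR_left)
  show "norm (riesz \<phi>) \<le> norm \<phi> * 1" for \<phi> :: "'a \<Rightarrow>\<^sub>L real"
    by (simp add: norm_riesz)
qed

lemma riesz_inner_right: "blinfun_inner_right (riesz \<phi>) = \<phi>"
  by (rule blinfun_eqI) (simp add: riesz_inner)

lemma riesz_blinfun_inner_right: "riesz (blinfun_inner_right p) = p"
  by (rule riesz_unique) simp

lemma closed_subspace_eq_UNIV:
  fixes W :: "'x::{real_inner, banach} set"
  assumes W: "subspace W" "closed W" and orth: "\<And>x. (\<And>w. w \<in> W \<Longrightarrow>
      x \<bullet> w = 0) \<Longrightarrow> x = 0"
  shows "W = UNIV"
proof -
  have "x \<in> W" for x
  proof -
    obtain p where p: "p \<in> W" "\<forall>w\<in>W. (x - p) \<bullet> w = 0"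
      using orthogonal_projection_exists[OF W] by blast
    then have "x - p = 0" using orth by blast
    then show ?thesis using p by simp
  qed
  then show ?thesis by blast
qed

section \<open>Uniform boundedness\<close>

text \<open>Some vector xi of norm at most \<open>r\<close> nearly attains the operator norm, and
  the images of x + xi and x - xi differ by twice the image of xi, so one of them is at least as
  large. Any factor below 1 would serve here; \<open>2/3\<close> exceeds the loss of
  \<open>1/2\<close> that the tail of the geometric steps causes later.\<close>

lemma exists_large_value_near:
  fixes B :: "'a::real_normed_vector \<Rightarrow>\<^sub>L 'b::real_normed_vector"
  assumes r: "r > 0"
  shows "\<exists>y. norm (y - x) \<le> r \<and> 2/3 * r * norm B \<le> norm (B y)"
proof -
  have "\<exists>\<xi>. norm \<xi> \<le> r \<and> 2/3 * r * norm B \<le> norm (B \<xi>)"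
  proof (rule ccontr)
    assume neg: "\<not> ?thesis"
    have "norm B \<le> 2/3 * norm B"
    proof (rule norm_blinfun_bound)
      fix y :: 'a
      show "norm (B y) \<le> 2/3 * norm B * norm y"
      proof (cases "y = 0")
        case False
        have "norm ((r / norm y) *\<^sub>R y) \<le> r" using False r by simp
        then have "\<not> 2/3 * r * norm B \<le> norm (B ((r / norm y) *\<^sub>R y))" using neg by blast
        then have "norm (B ((r / norm y) *\<^sub>R y)) \<le> 2/3 * r * norm B" by linarith
        moreover have "norm (B ((r / norm y) *\<^sub>R y)) = (r / norm y) * norm (B y)"
          using False r by (simp add: blinfun.scaleR_right)
        ultimately show ?thesis using False r by (simp add: field_simps)
      qed simp
    qed simp
    then have "norm B = 0" using norm_ge_zero[of B] by linarith
    moreover have "norm (0::'a) \<le> r" using r by simp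
    ultimately show False using neg by (metis mult_zero_right norm_ge_zero)
  qed
  then obtain \<xi> where \<xi>: "norm \<xi> \<le> r" "2/3 * r * norm B \<le> norm (B \<xi>)" by blast
  have "2 *\<^sub>R B \<xi> = B (x + \<xi>) - B (x - \<xi>)"
    by (simp add: blinfun.add_right blinfun.diff_right scaleR_2)
  then have "2 * norm (B \<xi>) \<le> norm (B (x + \<xi>)) + norm (B (x - \<xi>))"
    using norm_triangle_ineq4[of "B (x + \<xi>)" "B (x - \<xi>)"] by (metis norm_scaleR abs_numeral)
  then have "norm (B \<xi>) \<le> norm (B (x + \<xi>)) \<or> norm (B \<xi>) \<le> norm (B (x - \<xi>))"
    by linarith
  then show ?thesis
  proof
    assume "norm (B \<xi>) \<le> norm (B (x + \<xi>))"
    then show ?thesis using \<xi> by (intro exI[of _ "x + \<xi>"]) auto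
  next
    assume "norm (B \<xi>) \<le> norm (B (x - \<xi>))"
    then show ?thesis using \<xi> by (intro exI[of _ "x - \<xi>"]) auto
  qed
qed

text \<open>A gliding hump: if the norms grow fast along a subsequence, a point with unbounded orbit is
  the limit of a sequence whose steps shrink like powers of \<open>1/3\<close>.\<close>
theorem uniform_boundedness:
  fixes A :: "nat \<Rightarrow> 'a::banach \<Rightarrow>\<^sub>L 'b::real_normed_vector"
  assumes bdd: "\<And>x. \<exists>K. \<forall>n. norm (A n x) \<le> K"
  shows "\<exists>K. \<forall>n. norm (A n) \<le> K"
proof (rule ccontr)
  assume neg: "\<not> ?thesis"
  have "\<exists>n. (4::real)^k \<le> norm (A n)" for k
  proof -
    obtain n where "\<not> norm (A n) \<le> 4^k" using neg by blast
    then show ?thesis by (intro exI[of _ n]) simp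
  qed
  then have "\<forall>k. \<exists>n. (4::real)^k \<le> norm (A n)" by blast
  then obtain n where n: "\<And>k. (4::real)^k \<le> norm (A (n k))" unfolding choice_iff by blast
  define B where "B k = A (n k)" for k
  obtain st where st: "\<And>k x. norm (st k x - x) \<le> (1/3)^k" "\<And>k x. 2/3 * (1/3)^k * norm (B k)
      \<le> norm (B k (st k x))"
  proof -
    have "\<forall>k x. \<exists>y. norm (y - x) \<le> (1/3)^k \<and> 2/3 * (1/3)^k * norm (B k) \<le> norm (B k y)"
      by (intro allI exists_large_value_near) simp
    then obtain st where "\<forall>k x. norm (st k x - x) \<le> (1/3)^k \<and> 2/3 * (1/3)^k * norm (B k)
        \<le> norm (B k (st k x))"
      unfolding choice_iff by blast
    with that show thesis by blast
  qed
  define x where "x = rec_nat 0 st"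
  have xS: "x (Suc k) = st k (x k)" for k by (simp add: x_def)
  have step: "norm (x (Suc k) - x k) \<le> (1/3)^k" for k unfolding xS by (rule st)
  have far: "norm (x (k + j) - x k) \<le> 3/2 * (1/3)^k - 3/2 * (1/3)^(k+j)" for k j
  proof (induction j)
    case (Suc j)
    have "norm (x (k + Suc j) - x k) \<le> norm (x (Suc (k + j)) - x (k + j)) + norm (x (k + j) - x k)"
      using norm_triangle_ineq[of "x (Suc (k + j)) - x (k + j)" "x (k + j) - x k"] by simp
    also have "\<dots> \<le> (1/3)^(k+j) + (3/2 * (1/3)^k - 3/2 * (1/3)^(k+j))"
      using step[of "k+j"] Suc by linarith
    also have "\<dots> = 3/2 * (1/3)^k - 3/2 * (1/3)^(k + Suc j)" by simp
    finally show ?case .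
  qed simp
  have far': "norm (x (k + j) - x k) \<le> 3/2 * (1/3)^k" for k j
    using far[of k j] zero_le_power[of "1/3::real" "k+j"] by linarith
  have "Cauchy x"
  proof (rule metric_CauchyI)
    fix e :: real assume e: "e > 0"
    obtain N where N: "(1/3::real)^N < e / 3" using real_arch_pow_inv[of "e/3" "1/3"] e by auto
    have "norm (x i - x j) < e" if "i \<ge> N" "j \<ge> N" for i j
    proof -
      have "norm (x i - x N) \<le> 3/2 * (1/3)^N" "norm (x j - x N) \<le> 3/2 * (1/3)^N"
        using far'[of N "i - N"] far'[of N "j - N"] that by auto
      moreover have "norm (x i - x j) \<le> norm (x i - x N) + norm (x j - x N)"
        using norm_triangle_ineq4[of "x i - x N" "x j - x N"] by simp
      ultimately show ?thesis using N by linarith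
    qed
    then show "\<exists>N. \<forall>m\<ge>N. \<forall>n\<ge>N. dist (x m) (x n) < e" by (auto simp: dist_norm)
  qed
  then obtain l where l: "x \<longlonglongrightarrow> l" by (auto simp: Cauchy_convergent_iff convergent_def)
  have dl: "norm (l - x k) \<le> 3/2 * (1/3)^k" for k
  proof (rule LIMSEQ_le_const2)
    show "(\<lambda>j. norm (x (j + k) - x k)) \<longlonglongrightarrow> norm (l - x k)"
      by (intro tendsto_intros LIMSEQ_ignore_initial_segment l)
    show "\<exists>N. \<forall>n\<ge>N. norm (x (n + k) - x k) \<le> 3/2 * (1/3)^k"
      using far'[of k] by (auto simp: add.commute)
  qed
  obtain K where K: "\<And>n. norm (A n l) \<le> K" using bdd by blast
  \<comment> \<open>The limit differs from step \<open>Suc k\<close> by at most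
    \<open>3/2 * (1/3)^Suc k\<close>, which costs \<open>1/2\<close> of the guaranteed
    \<open>2/3\<close>. The remaining \<open>1/6\<close>, multiplied by the growth
    \<open>4^k\<close> and the step size \<open>(1/3)^k\<close>, diverges.\<close>
  have "1/6 * (4/3)^k \<le> K" for k
  proof -
    have "norm (B k (x (Suc k))) \<le> norm (B k l) + norm (B k (l - x (Suc k)))"
      using norm_triangle_ineq4[of "B k l" "B k (l - x (Suc k))"] by (simp add: blinfun.diff_right)
    also have "norm (B k (l - x (Suc k))) \<le> norm (B k) * (3/2 * (1/3)^Suc k)"
      by (rule order_trans[OF norm_blinfun mult_left_mono[OF dl norm_ge_zero]])
    finally have "norm (B k (x (Suc k))) \<le> norm (B k l) + 1/2 * (1/3)^k * norm (B k)"
      by (simp add: mult.commute)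
    moreover have "2/3 * (1/3)^k * norm (B k) \<le> norm (B k (x (Suc k)))" unfolding xS by (rule st)
    moreover have "norm (B k l) \<le> K" unfolding B_def by (rule K)
    ultimately have "1/6 * ((1/3)^k * norm (B k)) \<le> K" by simp
    moreover have "(1/3)^k * 4^k \<le> (1/3)^k * norm (B k)"
      unfolding B_def by (rule mult_left_mono[OF n]) simp
    moreover have "(1/3)^k * 4^k = (4/3::real)^k" by (simp flip: power_mult_distrib)
    ultimately show ?thesis by linarith
  qed
  moreover obtain k where "6 * K < (4/3)^k" using real_arch_pow[of "4/3" "6*K"] by auto
  ultimately have "1/6 * (4/3)^k \<le> K" "6 * K < (4/3)^k" by blast+
  then show False by linarith
qed

section \<open>Bounds and continuity of semigroups\<close>

lemma C0_semigroup_0: "C0_semigroup S \<Longrightarrow> S 0 = id_blinfun"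
  and C0_semigroup_add: "C0_semigroup S \<Longrightarrow> s \<ge> 0 \<Longrightarrow>
      t \<ge> 0 \<Longrightarrow> S (s + t) x = S s (S t x)"
  and C0_semigroup_tendsto: "C0_semigroup S \<Longrightarrow> ((\<lambda>t. S t x) \<longlongrightarrow> x) (at_right 0)"
  by (simp_all add: C0_semigroup_def)

text \<open>Otherwise there are times \<open>t n\<close> tending to 0 with norms above
  \<open>Suc n\<close>. Strong continuity at 0 makes every orbit bounded along these times, which
  contradicts uniform boundedness.\<close>

lemma C0_semigroup_locally_bounded:
  fixes S :: "real \<Rightarrow> 'x::banach \<Rightarrow>\<^sub>L 'x"
  assumes S: "C0_semigroup S"
  shows "\<exists>\<delta>>0. \<exists>K. \<forall>t\<in>{0..\<delta>}. norm (S t) \<le> K"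
proof (rule ccontr)
  assume neg: "\<not> ?thesis"
  have "\<exists>t. 0 \<le> t \<and> t \<le> inverse (Suc n) \<and> norm (S t) > Suc n" for n
  proof -
    have "\<not> (\<forall>t\<in>{0..inverse (real (Suc n))}. norm (S t) \<le> real (Suc n))"
    proof
      assume *: "\<forall>t\<in>{0..inverse (real (Suc n))}. norm (S t) \<le> real (Suc n)"
      have "inverse (real (Suc n)) > 0" by simp
      with * neg show False by blast
    qed
    then show ?thesis by force
  qed
  then have "\<forall>n. \<exists>t. 0 \<le> t \<and> t \<le> inverse (Suc n) \<and> norm (S t) > Suc n"
    by blast
  then obtain t where t: "\<And>n. 0 \<le> t n" "\<And>n. t n \<le> inverse (Suc n)" "\<And>n. norm (S (t n)) > Suc n"
    unfolding choice_iff by blast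
  \<comment> \<open>Time 0 is excluded because \<open>S 0\<close> has norm at most 1; positivity is
    what allows the right-sided limit at 0 to be used along \<open>t\<close>.\<close>
  have t0: "t n > 0" for n
  proof -
    have "norm (S 0) \<le> 1"
      using C0_semigroup_0[OF S] by (simp add: norm_blinfun_bound)
    then have "t n \<noteq> 0" using t(3)[of n] by auto
    then show ?thesis using t(1)[of n] by simp
  qed
  have tl: "t \<longlonglongrightarrow> 0"
    by (rule tendsto_sandwich[OF _ _ tendsto_const LIMSEQ_inverse_real_of_nat]) (use t in auto)
  have "filterlim t (at_right 0) sequentially"
    using tl t0 by (auto simp: filterlim_at less_imp_neq[symmetric])
  then have "(\<lambda>n. S (t n) x) \<longlonglongrightarrow> x" for x
    by (rule filterlim_compose[OF C0_semigroup_tendsto[OF S]])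
  then have "\<exists>K. \<forall>n. norm (S (t n) x) \<le> K" for x
    using convergent_imp_Bseq[of "\<lambda>n. S (t n) x"] unfolding Bseq_def convergent_def by blast
  then obtain K where K: "\<And>n. norm (S (t n)) \<le> K"
    using uniform_boundedness[of "\<lambda>n. S (t n)"] by blast
  obtain n where "K < of_nat n" using reals_Archimedean2 by blast
  then show False using K[of n] t(3)[of n] by simp
qed

text \<open>The semigroup law gives the bound \<open>K ^ n\<close> on an interval of length n times
  the local one; choosing \<open>K\<close> at least 1 keeps these powers increasing.\<close>

lemma C0_semigroup_bounded:
  fixes S :: "real \<Rightarrow> 'x::banach \<Rightarrow>\<^sub>L 'x"
  assumes S: "C0_semigroup S"
  obtains K where "K \<ge> 1" "\<And>t. 0 \<le> t \<Longrightarrow> t \<le> T \<Longrightarrow> norm (S t) \<le> K"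
proof -
  obtain \<delta> K0 where d: "\<delta> > 0" and K0: "\<forall>t\<in>{0..\<delta>}. norm (S t) \<le> K0"
    using C0_semigroup_locally_bounded[OF S] by blast
  define K where "K = max 1 K0"
  have K: "K \<ge> 1" "\<And>t. 0 \<le> t \<Longrightarrow> t \<le> \<delta> \<Longrightarrow> norm (S t) \<le> K"
    using K0 by (force simp: K_def)+
  have *: "norm (S t) \<le> K ^ n" if "0 \<le> t" "t \<le> n * \<delta>" "n \<ge> 1" for t n
    using that(3,1,2)
  proof (induction n arbitrary: t rule: nat_induct_at_least)
    case base
    then show ?case using K(2) by simp
  next
    case (Suc n)
    show ?case
    proof (cases "t \<le> \<delta>")
      case True
      then have "norm (S t) \<le> K" using K(2) Suc.prems by simp
      also have "\<dots> \<le> K ^ Suc n" using K(1) self_le_power[of K "Suc n"] by simp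
      finally show ?thesis .
    next
      case False
      have "S (\<delta> + (t - \<delta>)) = S \<delta> o\<^sub>L S (t - \<delta>)"
        using C0_semigroup_add[OF S, of \<delta> "t - \<delta>"] False d by (intro blinfun_eqI) auto
      then have "norm (S t) \<le> norm (S \<delta>) * norm (S (t - \<delta>))"
        using norm_blinfun_compose[of "S \<delta>" "S (t - \<delta>)"] by simp
      also have "\<dots> \<le> K * K ^ n"
      proof (rule mult_mono)
        show "norm (S \<delta>) \<le> K" using d by (intro K(2)) auto
        show "norm (S (t - \<delta>)) \<le> K ^ n"
          using Suc.prems False by (intro Suc.IH) (auto simp: algebra_simps)
      qed (use K(1) in auto)
      finally show ?thesis by simp
    qed
  qed
  obtain n where "T < real n * \<delta>" using d reals_Archimedean3 by blast
  then have "norm (S t) \<le> K ^ Suc n" if "0 \<le> t" "t \<le> T" for t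
    using that d by (intro *) (auto simp: algebra_simps)
  moreover have "K ^ Suc n \<ge> 1" using K(1) by (rule one_le_power)
  ultimately show thesis using that by blast
qed

text \<open>For s below t the increment is \<open>S s\<close> applied to
  \<open>S (t - s) x - x\<close>. Both one-sided limits therefore reduce to right continuity at 0,
  with the operators in front uniformly bounded.\<close>

lemma C0_semigroup_continuous_on:
  fixes S :: "real \<Rightarrow> 'x::banach \<Rightarrow>\<^sub>L 'x"
  assumes S: "C0_semigroup S"
  shows "continuous_on {0..T} (\<lambda>t. S t x)"
proof -
  obtain K where K: "K \<ge> 1" "\<And>t. 0 \<le> t \<Longrightarrow> t \<le> T \<Longrightarrow> norm (S t) \<le> K"
    by (rule C0_semigroup_bounded[OF S, where T=T]) blast
  have diff: "norm (S t x - S s x) \<le> K * norm (S (t - s) x - x)"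
    if "0 \<le> s" "s \<le> t" "t \<le> T" for s t
  proof -
    have "S t x - S s x = S s (S (t - s) x - x)"
      using C0_semigroup_add[OF S, of s "t - s" x] that by (simp add: blinfun.diff_right)
    moreover have "norm (S s (S (t - s) x - x)) \<le> norm (S s) * norm (S (t - s) x - x)"
      by (rule norm_blinfun)
    moreover have "norm (S s) * norm (S (t - s) x - x) \<le> K * norm (S (t - s) x - x)"
      using that by (intro mult_right_mono K) auto
    ultimately show ?thesis by simp
  qed
  show ?thesis
    unfolding continuous_on_iff
  proof (intro ballI allI impI)
    fix s e :: real assume s: "s \<in> {0..T}" and e: "e > 0"
    have "eventually (\<lambda>h. norm (S h x - x) < e / K) (at_right 0)"
      using tendstoD[OF C0_semigroup_tendsto[OF S, of x], of "e / K"] e K(1) by (simp add: dist_norm)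
    then obtain d where d: "d > 0" "\<And>h. 0 < h \<Longrightarrow> h < d \<Longrightarrow> norm (S h x - x) < e / K"
      unfolding eventually_at_right_field by auto
    have lt: "norm (S t x - S s x) < e" if "0 \<le> s" "s \<le> t" "t \<le> T" "t - s < d" for s t
    proof (cases "s = t")
      case False
      then have "norm (S (t - s) x - x) < e / K" using that by (intro d) auto
      then have "K * norm (S (t - s) x - x) < e" using K(1) by (simp add: field_simps)
      then show ?thesis using diff[OF that(1-3)] by linarith
    qed (use e in simp)
    show "\<exists>d>0. \<forall>t\<in>{0..T}. dist t s < d \<longrightarrow> dist (S t x) (S s x) < e"
    proof (intro exI[of _ d] conjI ballI impI d)
      fix t assume t: "t \<in> {0..T}" "dist t s < d"
      show "dist (S t x) (S s x) < e"
      proof (cases "s \<le> t")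
        case True
        then show ?thesis using lt[of s t] s t by (simp add: dist_norm)
      next
        case False
        then show ?thesis using lt[of t s] s t by (simp add: dist_norm norm_minus_commute)
      qed
    qed
  qed
qed

section \<open>Lebesgue measure on intervals\<close>

lemma complete_measure_lebesgue_on:
  assumes "A \<in> sets lebesgue"
  shows "complete_measure (lebesgue_on A)"
proof
  fix B C assume B: "B \<subseteq> C" and C: "C \<in> null_sets (lebesgue_on A)"
  have C': "C \<subseteq> A" "C \<in> null_sets lebesgue"
    using C assms by (simp_all add: null_sets_restrict_space)
  have "B \<in> null_sets lebesgue"
    using B C'(2) by (rule completion.complete2)
  then show "B \<in> sets (lebesgue_on A)"
    using B C' assms by (auto simp: sets_restrict_space_iff)
qed

interpretation Icc: finite_complete_measure "lebesgue_on {a..b}" for a b :: real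
  by (intro finite_complete_measure.intro finite_measure_lebesgue_on complete_measure_lebesgue_on) auto

lemma lebesgue_on_subinterval:
  assumes "{c..d} \<subseteq> {a..b::real}"
  shows "lebesgue_on {c..d} = restrict_space (lebesgue_on {a..b}) {c..d}"
  using assms by (subst restrict_restrict_space) (auto simp: Int_absorb1)

lemma subinterval_sets: "{c..d} \<subseteq> {a..b::real} \<Longrightarrow> {c..d} \<in> sets (lebesgue_on {a..b})"
  by (simp add: sets_restrict_space_iff)

lemma subinterval_sets': "{c..d} \<subseteq> {a..b::real} \<Longrightarrow>
    {c..d} \<inter> space (lebesgue_on {a..b}) \<in> sets (lebesgue_on {a..b})"
  by (simp only: subinterval_sets sets.Int_space_eq2)

lemma strongly_measurable_restrict_space:
  assumes f: "strongly_measurable M f" and \<Omega>: "\<Omega> \<in> sets M"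
  shows "strongly_measurable (restrict_space M \<Omega>) f"
proof -
  obtain s where s: "\<And>i. simple_function M (s i)" "AE t in M. (\<lambda>i::nat. s i t) \<longlonglongrightarrow> f t"
    using f unfolding strongly_measurable_def by blast
  have sp: "space (restrict_space M \<Omega>) = \<Omega>"
    using sets.sets_into_space[OF \<Omega>] by (auto simp: space_restrict_space)
  have "simple_function (restrict_space M \<Omega>) (s i)" for i
    unfolding simple_function_def sp
  proof (intro conjI ballI)
    show "finite (s i ` \<Omega>)"
      using simple_functionD(1)[OF s(1)[of i]] finite_subset[OF image_mono[OF sets.sets_into_space[OF \<Omega>]]]
        by blast
    fix x
    have "s i -` {x} \<inter> \<Omega> = (s i -` {x} \<inter> space M) \<inter> \<Omega>"
      using sets.sets_into_space[OF \<Omega>] by auto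
    then show "s i -` {x} \<inter> \<Omega> \<in> sets (restrict_space M \<Omega>)"
      using simple_functionD(2)[OF s(1)[of i]] \<Omega> by (auto simp: sets_restrict_space_iff)
  qed
  moreover have "AE t in restrict_space M \<Omega>. (\<lambda>i::nat. s i t) \<longlonglongrightarrow> f t"
    using s(2) \<Omega> by (subst AE_restrict_space_iff) (auto elim: eventually_mono)
  ultimately show ?thesis unfolding strongly_measurable_def by blast
qed

lemma strongly_measurable_subinterval:
  "strongly_measurable (lebesgue_on {a..b}) f \<Longrightarrow> {c..d} \<subseteq> {a..b::real} \<Longrightarrow>
    strongly_measurable (lebesgue_on {c..d}) f"
  by (simp add: lebesgue_on_subinterval[of c d a b] strongly_measurable_restrict_space subinterval_sets)

lemma integrable_subinterval:
  fixes f :: "real \<Rightarrow> real"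
  assumes "integrable (lebesgue_on {a..b}) f" and sub: "{c..d} \<subseteq> {a..b::real}"
  shows "integrable (lebesgue_on {c..d}) f"
  unfolding lebesgue_on_subinterval[OF sub]
  by (subst integrable_restrict_space[OF subinterval_sets'[OF sub]])
    (rule integrable_mult_indicator[OF subinterval_sets[OF sub] assms(1)])

lemma integral_subinterval_le:
  fixes f :: "real \<Rightarrow> real"
  assumes f: "integrable (lebesgue_on {a..b}) f" and sub: "{c..d} \<subseteq> {a..b::real}"
    and nn: "\<And>t. t \<in> {a..b} \<Longrightarrow> 0 \<le> f t"
  shows "(\<integral>t. f t \<partial>lebesgue_on {c..d}) \<le> (\<integral>t. f t \<partial>lebesgue_on {a..b})"
proof -
  have "(\<integral>t. f t \<partial>lebesgue_on {c..d})
      = (\<integral>t. indicator {c..d} t *\<^sub>R f t \<partial>lebesgue_on {a..b})"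
    unfolding lebesgue_on_subinterval[OF sub]
    by (subst integral_restrict_space[OF subinterval_sets'[OF sub]]) simp
  also have "\<dots> \<le> (\<integral>t. f t \<partial>lebesgue_on {a..b})"
    using integrable_mult_indicator[OF subinterval_sets[OF sub] f] f nn
    by (intro integral_mono) (auto split: split_indicator)
  finally show ?thesis .
qed

section \<open>Continuous functions on an interval\<close>

text \<open>The approximants evaluate \<open>f\<close> at the grid point below t, with mesh
  \<open>1 / Suc n\<close>. The point is clamped to the interval because the floor may fall to the
  left of \<open>a\<close>; on a bounded interval the floor takes finitely many values.\<close>

lemma continuous_on_strongly_measurable:
  fixes f :: "real \<Rightarrow> 'b::metric_space"
  assumes f: "continuous_on {a..b} f"
  shows "strongly_measurable (lebesgue_on {a..b}) f"
proof (cases "a \<le> b")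
  case False
  then have "simple_function (lebesgue_on {a..b}) (\<lambda>_. f a)" by simp
  moreover have "AE t in lebesgue_on {a..b}. (\<lambda>i::nat. f a) \<longlonglongrightarrow> f t"
    using False by (intro AE_I2) simp
  ultimately show ?thesis
    unfolding strongly_measurable_def by (intro exI[of _ "\<lambda>_ _. f a"] conjI allI)
next
  case True
  define p where "p n t = max a (min b (of_int \<lfloor>real (Suc n) * t\<rfloor> / real (Suc n)))" for n and t :: real
  have pin: "p n t \<in> {a..b}" for n t using True by (auto simp: p_def)
  have sf: "simple_function (lebesgue_on {a..b}) (\<lambda>t. \<lfloor>real (Suc n) * t\<rfloor>)" for n
    unfolding simple_function_def
  proof (intro conjI ballI)
    have "(\<lambda>t. \<lfloor>real (Suc n) * t\<rfloor>) ` {a..b} \<subseteq> {\<lfloor>real (Suc n) *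
        a\<rfloor>..\<lfloor>real (Suc n) * b\<rfloor>}"
      by (auto intro!: floor_mono mult_left_mono)
    then show "finite ((\<lambda>t. \<lfloor>real (Suc n) * t\<rfloor>) ` space (lebesgue_on {a..b}))"
      by (auto intro: finite_subset)
    fix x :: int
    have "(\<lambda>t. \<lfloor>real (Suc n) * t\<rfloor>) -` {x} \<in> sets borel"
      by (rule measurable_sets_borel[where A="{x}" and M="count_space UNIV"]) measurable
    then have "(\<lambda>t. \<lfloor>real (Suc n) * t\<rfloor>) -` {x} \<in> sets lebesgue" by simp
    then show "(\<lambda>t. \<lfloor>real (Suc n) * t\<rfloor>) -` {x} \<inter> space (lebesgue_on {a..b})
        \<in> sets (lebesgue_on {a..b})"
      by (auto simp: sets_restrict_space_iff)
  qed
  have "simple_function (lebesgue_on {a..b}) (\<lambda>t. f (p n t))" for n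
    using simple_function_compose1[OF sf[of n], of "\<lambda>k. f (max a (min b (of_int k / real (Suc n))))"]
    unfolding p_def .
  moreover have "AE t in lebesgue_on {a..b}. (\<lambda>n. f (p n t)) \<longlonglongrightarrow> f t"
  proof (rule AE_I2)
    fix t assume "t \<in> space (lebesgue_on {a..b})"
    then have t: "t \<in> {a..b}" by simp
    have "(\<lambda>n. p n t) \<longlonglongrightarrow> max a (min b t)"
      unfolding p_def
    proof (intro tendsto_max tendsto_min tendsto_const)
      show "(\<lambda>n. of_int \<lfloor>real (Suc n) * t\<rfloor> / real (Suc n)) \<longlonglongrightarrow> t"
      proof (rule tendsto_sandwich[OF _ _ _ tendsto_const])
        have "(\<lambda>n. t - inverse (real (Suc n))) \<longlonglongrightarrow> t - 0"
          by (rule tendsto_diff[OF tendsto_const LIMSEQ_inverse_real_of_nat])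
        then show "(\<lambda>n. t - inverse (real (Suc n))) \<longlonglongrightarrow> t" by simp
        have "t - inverse (real (Suc n)) \<le> of_int \<lfloor>real (Suc n) * t\<rfloor> / real (Suc n)" for n
        proof -
          have "real (Suc n) * t - 1 \<le> of_int \<lfloor>real (Suc n) * t\<rfloor>" by linarith
          then have "(real (Suc n) * t - 1) / real (Suc n) \<le> of_int \<lfloor>real (Suc n) * t\<rfloor> / real (Suc n)"
            by (intro divide_right_mono) auto
          moreover have "(real (Suc n) * t - 1) / real (Suc n) = t - inverse (real (Suc n))"
            by (simp add: diff_divide_distrib inverse_eq_divide)
          ultimately show ?thesis by linarith
        qed
        then show "\<forall>\<^sub>F n in sequentially. t - inverse (real (Suc n))
            \<le> of_int \<lfloor>real (Suc n) * t\<rfloor> / real (Suc n)"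
          by (intro always_eventually allI)
        have "of_int \<lfloor>real (Suc n) * t\<rfloor> / real (Suc n) \<le> t" for n
        proof -
          have "of_int \<lfloor>real (Suc n) * t\<rfloor> \<le> real (Suc n) * t" by linarith
          then have "of_int \<lfloor>real (Suc n) * t\<rfloor> / real (Suc n) \<le> real (Suc n) * t / real (Suc n)"
            by (intro divide_right_mono) auto
          then show ?thesis by simp
        qed
        then show "\<forall>\<^sub>F n in sequentially. of_int \<lfloor>real (Suc n) * t\<rfloor> / real (Suc n) \<le> t"
          by (intro always_eventually allI)
      qed
    qed
    moreover have "max a (min b t) = t" using t by simp
    ultimately have "(\<lambda>n. p n t) \<longlonglongrightarrow> t" by simp
    then show "(\<lambda>n. f (p n t)) \<longlonglongrightarrow> f t"
      using f t pin by (intro continuous_on_tendsto_compose[OF f]) auto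
  qed
  ultimately show ?thesis
    unfolding strongly_measurable_def by (intro exI[of _ "\<lambda>n t. f (p n t)"]) blast
qed

lemma continuous_on_integrable_Icc:
  fixes f :: "real \<Rightarrow> real"
  assumes f: "continuous_on {a..b} f"
  shows "integrable (lebesgue_on {a..b}) f"
proof -
  obtain B where B: "\<And>t. t \<in> {a..b} \<Longrightarrow> norm (f t) \<le> B"
    using compact_imp_bounded[OF compact_continuous_image[OF f compact_Icc]]
    unfolding bounded_iff by blast
  show ?thesis
    using B by (intro Icc.integrable_const_bound[where B=B] AE_I2
      Icc.strongly_measurable_real continuous_on_strongly_measurable f) auto
qed

lemma integral_exp_le:
  fixes l t :: real
  assumes "l > 0" "t \<ge> 0"
  shows "(\<integral>s. exp (l * s) \<partial>lebesgue_on {0..t}) \<le> exp (l * t) / l"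
proof -
  have i: "integrable (lebesgue_on {0..t}) (\<lambda>s. exp (l * s))"
    by (intro continuous_on_integrable_Icc continuous_intros)
  have "((\<lambda>s. exp (l * s)) has_integral (exp (l * t) / l - exp (l * 0) / l)) {0..t}"
  proof (rule fundamental_theorem_of_calculus[OF assms(2)])
    fix s
    have "((\<lambda>s. exp (l * s) / l) has_real_derivative exp (l * s)) (at s within {0..t})"
      using assms(1) by (auto intro!: derivative_eq_intros)
    then show "((\<lambda>s. exp (l * s) / l) has_vector_derivative exp (l * s)) (at s within {0..t})"
      by (simp add: has_real_derivative_iff_has_vector_derivative)
  qed
  then have "(\<integral>s. exp (l * s) \<partial>lebesgue_on {0..t}) = exp (l * t) / l - exp (l * 0) / l"
    using lebesgue_integral_eq_integral[OF i] by (simp add: integral_unique)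
  then show ?thesis using assms by simp
qed

section \<open>Restriction and reflection of Bochner integrals\<close>

text \<open>Extension by zero maps simple functions on the subset to simple functions with the same
  errors and integrals, which gives one direction. For the other, an integral over the subset exists
  by integrability of the norm and is identified by uniqueness of the extended integral.\<close>

lemma bochner_has_integral_restrict:
  fixes f :: "'a \<Rightarrow> 'b::banach"
  assumes M: "finite_complete_measure M" and R: "finite_complete_measure (restrict_space M \<Omega>)" and
      \<Omega>: "\<Omega> \<in> sets M"
  shows "bochner_has_integral (restrict_space M \<Omega>) f x \<longleftrightarrow> bochner_has_integral M
      (\<lambda>s. indicator \<Omega> s *\<^sub>R f s) x"
proof -
  interpret M: finite_complete_measure M by fact
  interpret R: finite_complete_measure "restrict_space M \<Omega>" by fact
  have \<Omega>': "\<Omega> \<inter> space M \<in> sets M" using \<Omega> by simp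
  have sp: "space (restrict_space M \<Omega>) = \<Omega>"
    using sets.sets_into_space[OF \<Omega>] by (auto simp: space_restrict_space)
  have imp: "bochner_has_integral M (\<lambda>s. indicator \<Omega> s *\<^sub>R f s) y" if y:
      "bochner_has_integral (restrict_space M \<Omega>) f y" for y
  proof -
    obtain s where s: "strongly_measurable (restrict_space M \<Omega>) f"
        "\<And>i::nat. simple_function (restrict_space M \<Omega>) (s i)"
      "(\<lambda>i. \<integral>\<^sup>+ t. ennreal (norm (f t
          - s i t)) \<partial>restrict_space M \<Omega>) \<longlonglongrightarrow> 0"
      "(\<lambda>i. simple_bochner_integral (restrict_space M \<Omega>) (s i)) \<longlonglongrightarrow> y"
      using y by (rule R.bochner_has_integralE) blast
    obtain r where r: "\<And>i. simple_function (restrict_space M \<Omega>) (r i)"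
        "AE t in restrict_space M \<Omega>. (\<lambda>i::nat. r i t) \<longlonglongrightarrow> f t"
      using s(1) unfolding strongly_measurable_def by blast
    show ?thesis
    proof (rule M.bochner_has_integralI)
      show "simple_function M (\<lambda>t. indicator \<Omega> t *\<^sub>R s i t)" for i
        using s(2) simple_function_restrict_space[OF \<Omega>'] by blast
      have "AE t in M. t \<in> \<Omega> \<longrightarrow> (\<lambda>i. r i t) \<longlonglongrightarrow> f t"
        using r(2) by (simp add: AE_restrict_space_iff[OF \<Omega>'])
      then have "AE t in M. (\<lambda>i. indicator \<Omega> t *\<^sub>R r i t)
          \<longlonglongrightarrow> indicator \<Omega> t *\<^sub>R f t"
        by eventually_elim (auto split: split_indicator)
      moreover have "simple_function M (\<lambda>t. indicator \<Omega> t *\<^sub>R r i t)" for i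
        using r(1) simple_function_restrict_space[OF \<Omega>'] by blast
      ultimately show "strongly_measurable M (\<lambda>t. indicator \<Omega> t *\<^sub>R f t)"
        unfolding strongly_measurable_def
          by (intro exI[of _ "\<lambda>i t. indicator \<Omega> t *\<^sub>R r i t"]) blast
      have "(\<integral>\<^sup>+ t. ennreal (norm (indicator \<Omega> t *\<^sub>R f t
          - indicator \<Omega> t *\<^sub>R s i t)) \<partial>M)
        = (\<integral>\<^sup>+ t. ennreal (norm (f t - s i t)) \<partial>restrict_space M \<Omega>)" for i
        by (subst nn_integral_restrict_space[OF \<Omega>'])
          (intro nn_integral_cong, auto split: split_indicator)
      then show "(\<lambda>i. \<integral>\<^sup>+ t. ennreal (norm (indicator \<Omega> t *\<^sub>R f t
          - indicator \<Omega> t *\<^sub>R s i t)) \<partial>M) \<longlonglongrightarrow> 0"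
        using s(3) by simp
      have "simple_bochner_integral (restrict_space M \<Omega>) (s i)
          = simple_bochner_integral M (\<lambda>t. indicator \<Omega> t *\<^sub>R s i t)" for i
        by (rule simple_bochner_integral_restrict_space[OF \<Omega>' R.simple_bochner_integrable_simple[OF s(2)]])
      then show "(\<lambda>i. simple_bochner_integral M (\<lambda>t. indicator \<Omega> t *\<^sub>R s i t))
          \<longlonglongrightarrow> y"
        using s(4) by simp
    qed
  qed
  show ?thesis
  proof
    assume b: "bochner_has_integral M (\<lambda>s. indicator \<Omega> s *\<^sub>R f s) x"
    have eq: "AE t in restrict_space M \<Omega>. indicator \<Omega> t *\<^sub>R f t = f t"
      by (rule AE_I2) (simp add: sp)
    have "strongly_measurable (restrict_space M \<Omega>) (\<lambda>s. indicator \<Omega> s *\<^sub>R f s)"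
      by (rule strongly_measurable_restrict_space[OF M.bochner_has_integral_strongly_measurable[OF b] \<Omega>])
    then have "strongly_measurable (restrict_space M \<Omega>) f"
      using eq by (rule R.strongly_measurable_AE_cong)
    moreover have "integrable (restrict_space M \<Omega>) (\<lambda>t. norm (f t))"
      using M.bochner_has_integral_integrable_norm[OF b] \<Omega>' by (simp add: integrable_restrict_space)
    ultimately obtain y where y: "bochner_has_integral (restrict_space M \<Omega>) f y"
      using R.bochner_has_integral_exists by blast
    have "y = x" using M.bochner_has_integral_unique[OF imp[OF y] b] .
    then show "bochner_has_integral (restrict_space M \<Omega>) f x" using y by simp
  qed (rule imp)
qed

lemma bochner_has_integral_subinterval:
  fixes f :: "real \<Rightarrow> 'b::banach"
  assumes sub: "{c..d} \<subseteq> {a..b::real}"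
  shows "bochner_has_integral (lebesgue_on {c..d}) f x \<longleftrightarrow>
    bochner_has_integral (lebesgue_on {a..b}) (\<lambda>s. indicator {c..d} s *\<^sub>R f s) x"
  unfolding lebesgue_on_subinterval[OF sub]
  by (intro bochner_has_integral_restrict Icc.finite_complete_measure_axioms subinterval_sets sub)
    (simp add: lebesgue_on_subinterval[OF sub, symmetric] Icc.finite_complete_measure_axioms)

lemma simple_function_measurable_compose:
  assumes s: "simple_function M s" and \<phi>: "\<phi> \<in> measurable N M"
  shows "simple_function N (\<lambda>x. s (\<phi> x))"
  unfolding simple_function_def
proof (intro conjI ballI)
  show "finite ((\<lambda>x. s (\<phi> x)) ` space N)"
    using s measurable_space[OF \<phi>]
      by (auto simp: simple_function_def intro: finite_subset[of _ "s ` space M"])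
  fix y
  have "(\<lambda>x. s (\<phi> x)) -` {y} \<inter> space N = \<phi> -` (s -` {y} \<inter> space M) \<inter> space N"
    using measurable_space[OF \<phi>] by auto
  then show "(\<lambda>x. s (\<phi> x)) -` {y} \<inter> space N \<in> sets N"
    using measurable_sets[OF \<phi> simple_functionD(2)[OF s]] by simp
qed

lemma strongly_measurable_distr:
  assumes \<phi>: "\<phi> \<in> measurable N M" and d: "distr N M \<phi> = M" and f: "strongly_measurable M f"
  shows "strongly_measurable N (\<lambda>x. f (\<phi> x))"
proof -
  obtain s where s: "\<And>i. simple_function M (s i)" "AE t in M. (\<lambda>i::nat. s i t) \<longlonglongrightarrow> f t"
    using f unfolding strongly_measurable_def by blast
  have "AE t in distr N M \<phi>. (\<lambda>i::nat. s i t) \<longlonglongrightarrow> f t"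
    unfolding d by (rule s(2))
  from AE_distrD[OF \<phi> this] show ?thesis
    using simple_function_measurable_compose[OF s(1) \<phi>]
    unfolding strongly_measurable_def by (intro exI[of _ "\<lambda>i t. s i (\<phi> t)"]) blast
qed

text \<open>Simple functions are pulled back along the map. Surjectivity preserves their set of
  values, over which the simple integral is a finite sum, and the image measure preserves the
  measures of their level sets.\<close>

lemma bochner_has_integral_distr:
  fixes f :: "'a \<Rightarrow> 'b::real_normed_vector"
  assumes M: "finite_complete_measure M" and N: "finite_complete_measure N"
    and \<phi>: "\<phi> \<in> measurable N M" and d: "distr N M \<phi> = M" and surj: "\<phi> ` space N = space M"
    and f: "bochner_has_integral M f x"
  shows "bochner_has_integral N (\<lambda>t. f (\<phi> t)) x"
proof -
  interpret M: finite_complete_measure M by fact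
  interpret N: finite_complete_measure N by fact
  obtain s where s: "strongly_measurable M f" "\<And>i::nat. simple_function M (s i)"
    "(\<lambda>i. \<integral>\<^sup>+ t. ennreal (norm (f t - s i t)) \<partial>M) \<longlonglongrightarrow> 0"
    "(\<lambda>i. simple_bochner_integral M (s i)) \<longlonglongrightarrow> x"
    using f by (rule M.bochner_has_integralE) blast
  show ?thesis
  proof (rule N.bochner_has_integralI)
    show "strongly_measurable N (\<lambda>t. f (\<phi> t))"
      by (rule strongly_measurable_distr[OF \<phi> d s(1)])
    show "simple_function N (\<lambda>t. s i (\<phi> t))" for i
      by (rule simple_function_measurable_compose[OF s(2) \<phi>])
    have "(\<integral>\<^sup>+ t. ennreal (norm (f (\<phi> t) - s i (\<phi> t))) \<partial>N)
        = (\<integral>\<^sup>+ t. ennreal (norm (f t - s i t)) \<partial>M)" for i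
      using nn_integral_distr[OF \<phi>, of "\<lambda>t. ennreal (norm (f t - s i t))"]
        M.measurable_norm_diff_simple[OF s(1,2)] d by simp
    then show "(\<lambda>i. \<integral>\<^sup>+ t. ennreal (norm (f (\<phi> t)
        - s i (\<phi> t))) \<partial>N) \<longlonglongrightarrow> 0"
      using s(3) by simp
    have "simple_bochner_integral N (\<lambda>t. s i (\<phi> t)) = simple_bochner_integral M (s i)" for i
    proof -
      have "measure N {t \<in> space N. s i (\<phi> t) = y} = measure M {t \<in> space M. s i t = y}" for y
      proof -
        have "measure (distr N M \<phi>) (s i -` {y} \<inter> space M)
            = measure N (\<phi> -` (s i -` {y} \<inter> space M) \<inter> space N)"
          by (rule measure_distr[OF \<phi> simple_functionD(2)[OF s(2)]])
        moreover have "\<phi> -` (s i -` {y} \<inter> space M) \<inter> space N = {t \<in> space N. s i (\<phi> t) = y}"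
          using measurable_space[OF \<phi>] by auto
        moreover have "s i -` {y} \<inter> space M = {t \<in> space M. s i t = y}" by auto
        ultimately show ?thesis using d by simp
      qed
      moreover have "(\<lambda>t. s i (\<phi> t)) ` space N = s i ` space M"
        unfolding surj[symmetric] image_image ..
      ultimately show ?thesis by (simp add: Bochner_Integration.simple_bochner_integral_def)
    qed
    then show "(\<lambda>i. simple_bochner_integral N (\<lambda>t. s i (\<phi> t))) \<longlonglongrightarrow> x"
      using s(4) by simp
  qed
qed

text \<open>This reflection, with \<open>c = T\<close>, turns backward equations into forward ones:
  an integral over [t,T] becomes one over [0,T-t].\<close>

lemma reflect_Icc_measurable_distr:
  fixes a b c :: real
  shows "(\<lambda>t. c - t) \<in> measurable (lebesgue_on {c-b..c-a}) (lebesgue_on {a..b})"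
    and "distr (lebesgue_on {c-b..c-a}) (lebesgue_on {a..b}) (\<lambda>t. c - t) = lebesgue_on {a..b}"
proof -
  have leb: "lebesgue = distr lebesgue lebesgue (\<lambda>t. c - t :: real)"
    using lebesgue_real_affine[of "-1" c] by (simp add: density_1)
  have meas: "(\<lambda>t. c - t) \<in> measurable lebesgue (lebesgue :: real measure)"
    using lebesgue_affine_measurable[of "\<lambda>_::real. -1" c] by simp
  show m: "(\<lambda>t. c - t) \<in> measurable (lebesgue_on {c-b..c-a}) (lebesgue_on {a..b})"
    by (rule measurable_restrict_space3[OF meas]) auto
  show "distr (lebesgue_on {c-b..c-a}) (lebesgue_on {a..b}) (\<lambda>t. c - t) = lebesgue_on {a..b}"
  proof (rule measure_eqI)
    fix A assume "A \<in> sets (distr (lebesgue_on {c-b..c-a}) (lebesgue_on {a..b}) (\<lambda>t. c - t))"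
    then have A: "A \<in> sets (lebesgue_on {a..b})" by simp
    then have A': "A \<in> sets lebesgue" "A \<subseteq> {a..b}" by (auto simp: sets_restrict_space_iff)
    have "emeasure (distr (lebesgue_on {c-b..c-a}) (lebesgue_on {a..b}) (\<lambda>t. c - t)) A
      = emeasure (lebesgue_on {c-b..c-a}) ((\<lambda>t. c - t) -` A \<inter> {c-b..c-a})"
      using A by (subst emeasure_distr[OF m]) auto
    also have "(\<lambda>t. c - t) -` A \<inter> {c-b..c-a} = (\<lambda>t. c - t) -` A" using A'(2) by force
    also have "emeasure (lebesgue_on {c-b..c-a}) ((\<lambda>t. c - t) -` A) = emeasure lebesgue ((\<lambda>t. c - t) -` A)"
      using A'(2) by (intro emeasure_restrict_space) force+
    also have "\<dots> = emeasure (distr lebesgue lebesgue (\<lambda>t. c - t)) A"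
      by (subst emeasure_distr[OF meas A'(1)]) simp
    also have "\<dots> = emeasure lebesgue A" using leb by simp
    also have "\<dots> = emeasure (lebesgue_on {a..b}) A"
      using A' by (intro emeasure_restrict_space[symmetric]) auto
    finally show "emeasure (distr (lebesgue_on {c-b..c-a}) (lebesgue_on {a..b}) (\<lambda>t. c - t)) A
      = emeasure (lebesgue_on {a..b}) A" .
  qed simp
qed

lemma bochner_has_integral_reflect:
  fixes f :: "real \<Rightarrow> 'b::real_normed_vector"
  assumes "bochner_has_integral (lebesgue_on {a..b}) f x"
  shows "bochner_has_integral (lebesgue_on {c-b..c-a}) (\<lambda>t. f (c - t)) x"
proof (rule bochner_has_integral_distr[OF Icc.finite_complete_measure_axioms Icc.finite_complete_measure_axioms
    reflect_Icc_measurable_distr _ assms])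
  show "(\<lambda>t. c - t) ` space (lebesgue_on {c-b..c-a}) = space (lebesgue_on {a..b})"
    by (simp add: image_diff_atLeastAtMost)
qed

lemma strongly_measurable_reflect:
  fixes a b c :: real
  shows "strongly_measurable (lebesgue_on {a..b}) f \<Longrightarrow>
      strongly_measurable (lebesgue_on {c-b..c-a}) (\<lambda>t. f (c - t))"
  by (rule strongly_measurable_distr[OF reflect_Icc_measurable_distr])

lemma Cauchy_Schwarz_integral:
  fixes f g :: "'a \<Rightarrow> real"
  assumes [measurable]: "f \<in> borel_measurable M" "g \<in> borel_measurable M"
    and f: "integrable M (\<lambda>t. (f t)\<^sup>2)" and g: "integrable M (\<lambda>t. (g t)\<^sup>2)"
  shows "integrable M (\<lambda>t. f t * g t)"
    and "\<bar>\<integral>t. f t * g t \<partial>M\<bar>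
        \<le> sqrt (\<integral>t. (f t)\<^sup>2 \<partial>M) * sqrt (\<integral>t. (g t)\<^sup>2 \<partial>M)"
proof -
  show i: "integrable M (\<lambda>t. f t * g t)"
  proof (rule Bochner_Integration.integrable_bound[OF Bochner_Integration.integrable_add[OF f g]])
    show "AE t in M. norm (f t * g t) \<le> norm ((f t)\<^sup>2 + (g t)\<^sup>2)"
    proof (rule AE_I2)
      fix t
      have "2 * \<bar>f t * g t\<bar> \<le> (f t)\<^sup>2 + (g t)\<^sup>2"
        using sum_squares_bound[of "\<bar>f t\<bar>" "\<bar>g t\<bar>"] by (simp add: abs_mult)
      then have "\<bar>f t * g t\<bar> \<le> (f t)\<^sup>2 + (g t)\<^sup>2" by linarith
      then show "norm (f t * g t) \<le> norm ((f t)\<^sup>2 + (g t)\<^sup>2)" by simp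
    qed
  qed measurable
  define A B C where "A = (\<integral>t. (f t)\<^sup>2 \<partial>M)" and "B
      = (\<integral>t. (g t)\<^sup>2 \<partial>M)" and "C = (\<integral>t. f t * g t \<partial>M)"
  have B0: "B \<ge> 0" "A \<ge> 0" by (simp_all add: A_def B_def)
  have q: "0 \<le> A - 2 * r * C + r\<^sup>2 * B" for r
  proof -
    have "0 \<le> (\<integral>t. (f t - r * g t)\<^sup>2 \<partial>M)" by simp
    also have "(\<integral>t. (f t - r * g t)\<^sup>2 \<partial>M)
        = (\<integral>t. (f t)\<^sup>2 - 2 * r * (f t * g t) + r\<^sup>2 * (g t)\<^sup>2 \<partial>M)"
      by (intro Bochner_Integration.integral_cong) (auto simp: power2_diff power_mult_distrib algebra_simps)
    also have "\<dots> = A - 2 * r * C + r\<^sup>2 * B"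
      using f g i by (simp add: A_def B_def C_def)
    finally show ?thesis .
  qed
  have "C\<^sup>2 \<le> A * B"
  proof (cases "B = 0")
    case True
    \<comment> \<open>With \<open>B = 0\<close> the quadratic is affine in r; if C were nonzero, the
      chosen r would make it equal to -1.\<close>
    have "C = 0"
    proof (rule ccontr)
      assume "C \<noteq> 0"
      then have "2 * ((A + 1) / (2 * C)) * C = A + 1" by simp
      then show False using q[of "(A + 1) / (2 * C)"] True by simp
    qed
    then show ?thesis using True by simp
  next
    case False
    have "0 \<le> A - 2 * (C / B) * C + (C / B)\<^sup>2 * B" by (rule q)
    also have "\<dots> = A - C\<^sup>2 / B" using False by (simp add: power2_eq_square field_simps)
    finally show ?thesis using False B0 by (simp add: field_simps)
  qed
  then have "sqrt (C\<^sup>2) \<le> sqrt (A * B)" by (rule real_sqrt_le_mono)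
  then show "\<bar>\<integral>t. f t * g t \<partial>M\<bar>
      \<le> sqrt (\<integral>t. (f t)\<^sup>2 \<partial>M) * sqrt (\<integral>t. (g t)\<^sup>2 \<partial>M)"
    by (simp add: A_def B_def C_def real_sqrt_mult)
qed

section \<open>The dual semigroup and mild solutions\<close>

text \<open>Packages \<open>dual_op B\<close> as a bounded operator on the dual space, which is the
  type that \<open>C0_semigroup\<close> and \<open>mild_solution\<close> expect.\<close>

definition dual_blinfun :: "('a::real_normed_vector \<Rightarrow>\<^sub>L 'b::real_normed_vector) \<Rightarrow>
    ('b \<Rightarrow>\<^sub>L real) \<Rightarrow>\<^sub>L ('a \<Rightarrow>\<^sub>L real)" where
  "dual_blinfun B = Blinfun (dual_op B)"

lemma bounded_linear_dual_op: "bounded_linear (dual_op B)"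
  unfolding dual_op_def by (rule bounded_bilinear.bounded_linear_left[OF bounded_bilinear_blinfun_compose])

lemma dual_blinfun_apply [simp]: "dual_blinfun B \<phi> = dual_op B \<phi>"
  unfolding dual_blinfun_def by (simp add: bounded_linear_Blinfun_apply bounded_linear_dual_op)

lemma dual_op_apply [simp]: "dual_op B \<phi> x = \<phi> (B x)"
  by (simp add: dual_op_def)

lemma norm_dual_op: "norm (dual_op B \<phi>) \<le> norm B * norm \<phi>"
  unfolding dual_op_def using norm_blinfun_compose[of \<phi> B] by (simp add: mult.commute)

lemma dual_op_add: "dual_op B (\<phi> + \<psi>) = dual_op B \<phi> + dual_op B \<psi>"
  by (rule blinfun_eqI) (simp add: blinfun.add_left)

lemma dual_op_diff: "dual_op B (\<phi> - \<psi>) = dual_op B \<phi> - dual_op B \<psi>"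
  by (rule blinfun_eqI) (simp add: blinfun.diff_left)

lemma dual_op_scaleR: "dual_op B (c *\<^sub>R \<phi>) = c *\<^sub>R dual_op B \<phi>"
  by (rule blinfun_eqI) (simp add: blinfun.scaleR_left)

text \<open>The functionals \<open>x \<mapsto> \<integral>\<^bsub>[0,h]\<^esub> \<phi> (S(s) x) ds\<close> are Lipschitz orbits of the dual semigroup; in a
  Hilbert space their span is dense, hence the dual semigroup is strongly continuous.\<close>
lemma dual_semigroup_averages:
  fixes S :: "real \<Rightarrow> 'x::banach \<Rightarrow>\<^sub>L 'x" and \<phi> :: "'x \<Rightarrow>\<^sub>L real"
  assumes S: "C0_semigroup S" and h: "0 \<le> h"
  obtains g :: "'x \<Rightarrow>\<^sub>L real" where "\<And>x. g x = integral {0..h} (\<lambda>s. \<phi> (S s x))"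
    and "((\<lambda>t. dual_op (S t) g) \<longlongrightarrow> g) (at_right 0)"
proof -
  obtain K where K: "K \<ge> 1" "\<And>t. 0 \<le> t \<Longrightarrow> t \<le> h + 1 \<Longrightarrow> norm (S t) \<le> K"
    by (rule C0_semigroup_bounded[OF S, where T="h + 1"]) blast
  have cont: "continuous_on {0..c} (\<lambda>s. \<phi> (S s x))" for x c
    by (intro continuous_intros C0_semigroup_continuous_on[OF S])
  have cont': "continuous_on {a..c} (\<lambda>s. \<phi> (S s x))" if "0 \<le> a" for x a c
    using cont by (rule continuous_on_subset) (use that in auto)
  have io: "(\<lambda>s. \<phi> (S s x)) integrable_on {a..c}" if "0 \<le> a" for x a c
    using cont'[OF that] by (rule integrable_continuous_interval)
  have bd: "\<bar>integral {a..c} (\<lambda>s. \<phi> (S s x))\<bar> \<le> norm \<phi> * K * norm x * (c - a)"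
    if "0 \<le> a" "a \<le> c" "c \<le> h + 1" for x a c
  proof -
    have "norm (integral {a..c} (\<lambda>s. \<phi> (S s x))) \<le> norm \<phi> * K * norm x * (c - a)"
    proof (rule integral_bound[OF that(2) cont'[OF that(1)]])
      show "norm (\<phi> (S t x)) \<le> norm \<phi> * K * norm x" if "t \<in> {a..c}" for t
      proof -
        have "norm (\<phi> (S t x)) \<le> norm \<phi> * norm (S t x)" by (rule norm_blinfun)
        also have "\<dots> \<le> norm \<phi> * (norm (S t) * norm x)"
          by (intro mult_left_mono norm_blinfun) simp
        also have "\<dots> \<le> norm \<phi> * (K * norm x)"
          using that \<open>0 \<le> a\<close> \<open>c \<le> h + 1\<close>
            by (intro mult_left_mono mult_right_mono K) auto
        finally show ?thesis by (simp add: mult.assoc)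
      qed
    qed
    then show ?thesis by simp
  qed
  define G where "G x = integral {0..h} (\<lambda>s. \<phi> (S s x))" for x
  have bl: "bounded_linear G"
  proof (rule bounded_linear_intro[where K="norm \<phi> * K * h"])
    show "G (x + y) = G x + G y" for x y
      unfolding G_def blinfun.add_right
        by (rule Henstock_Kurzweil_Integration.integral_add[OF io io]) simp_all
    show "G (r *\<^sub>R x) = r *\<^sub>R G x" for r x
      unfolding G_def blinfun.scaleR_right by (rule Henstock_Kurzweil_Integration.integral_cmul)
    show "norm (G x) \<le> norm x * (norm \<phi> * K * h)" for x
      using bd[of 0 h x] h by (simp add: G_def mult_ac)
  qed
  define g where "g = Blinfun G"
  have g: "g x = G x" for x unfolding g_def by (simp add: bounded_linear_Blinfun_apply bl)
  \<comment> \<open>Evaluated at x, the difference is the integral over [h,h+t] minus the integral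
    over [0,t]; the interval common to both windows cancels. The bound \<open>K\<close> was taken up
    to \<open>h + 1\<close> to cover all t up to 1.\<close>
  have est: "norm (dual_op (S t) g - g) \<le> 2 * norm \<phi> * K * t" if t: "0 \<le> t" "t \<le> 1" for t
  proof (rule norm_blinfun_bound)
    fix x
    have "G (S t x) = integral {0..h} (\<lambda>s. \<phi> (S (s + t) x))"
      unfolding G_def
        using t by (intro Henstock_Kurzweil_Integration.integral_cong) (simp add: C0_semigroup_add[OF S])
    also have "\<dots> = integral {0 + t..h + t} (\<lambda>s. \<phi> (S s x))"
      using integral_shift[OF cont'[of "0 + t" "h + t" x]] t by (simp add: o_def)
    also have "\<dots> = integral {t..h + t} (\<lambda>s. \<phi> (S s x))" by simp
    finally have 1: "G (S t x) = integral {t..h + t} (\<lambda>s. \<phi> (S s x))" .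
    have "integral {0..t} (\<lambda>s. \<phi> (S s x)) + integral {t..h + t} (\<lambda>s. \<phi> (S s x))
        = integral {0..h + t} (\<lambda>s. \<phi> (S s x))"
      using t h by (intro Henstock_Kurzweil_Integration.integral_combine io) auto
    moreover have "integral {0..h} (\<lambda>s. \<phi> (S s x)) + integral {h..h
        + t} (\<lambda>s. \<phi> (S s x)) = integral {0..h + t} (\<lambda>s. \<phi> (S s x))"
      using t h by (intro Henstock_Kurzweil_Integration.integral_combine io) auto
    ultimately have "G (S t x) - G x = integral {h..h + t} (\<lambda>s. \<phi> (S s x))
        - integral {0..t} (\<lambda>s. \<phi> (S s x))"
      unfolding 1 by (simp add: G_def)
    moreover have "\<bar>integral {h..h + t} (\<lambda>s. \<phi> (S s x))\<bar> \<le> norm \<phi> * K * norm x * t"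
      using bd[of h "h + t" x] t h by simp
    moreover have "\<bar>integral {0..t} (\<lambda>s. \<phi> (S s x))\<bar> \<le> norm \<phi> * K * norm x * t"
      using bd[of 0 t x] t h by simp
    ultimately have "\<bar>G (S t x) - G x\<bar> \<le> 2 * (norm \<phi> * K * norm x * t)" by linarith
    then show "norm ((dual_op (S t) g - g) x) \<le> 2 * norm \<phi> * K * t * norm x"
      by (simp add: blinfun.diff_left g mult_ac)
  qed (use K(1) t in simp)
  have "((\<lambda>t. dual_op (S t) g - g) \<longlongrightarrow> 0) (at_right 0)"
  proof (rule Lim_null_comparison)
    show "\<forall>\<^sub>F t in at_right 0. norm (dual_op (S t) g - g) \<le> 2 * norm \<phi> * K * t"
      unfolding eventually_at_right_field by (intro exI[of _ 1]) (use est in auto)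
    have "((\<lambda>t. 2 * norm \<phi> * K * t) \<longlongrightarrow> 2 * norm \<phi> * K * 0) (at_right 0)"
      by (intro tendsto_intros)
    then show "((\<lambda>t. 2 * norm \<phi> * K * t) \<longlongrightarrow> 0) (at_right 0)" by simp
  qed
  then have "((\<lambda>t. dual_op (S t) g) \<longlongrightarrow> g) (at_right 0)" by (rule LIM_zero_cancel)
  then show thesis using that[of g] by (simp add: g G_def)
qed

text \<open>The vectors with strongly continuous dual orbit form a closed subspace \<open>W\<close>,
  by the uniform bound on [0,1]. If x is orthogonal to \<open>W\<close>, the average built from the
  functional of x itself vanishes at x. Near time 0, however, its integrand is at least half of
  \<open>x . x\<close>, so x is zero and \<open>W\<close> is the whole space.\<close>

theorem C0_semigroup_dual:
  fixes S :: "real \<Rightarrow> 'x::{real_inner, banach} \<Rightarrow>\<^sub>L 'x"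
  assumes S: "C0_semigroup S"
  shows "C0_semigroup (\<lambda>t. dual_blinfun (S t))"
  unfolding C0_semigroup_def
proof (intro conjI allI impI)
  show "dual_blinfun (S 0) = id_blinfun"
    by (intro blinfun_eqI) (simp add: C0_semigroup_0[OF S])
  show "dual_blinfun (S (s + t)) = dual_blinfun (S s) o\<^sub>L dual_blinfun (S t)"
    if "s \<ge> 0" "t \<ge> 0" for s t
    using C0_semigroup_add[OF S that(2,1)] by (intro blinfun_eqI) (simp add: add.commute)
  obtain K where K: "K \<ge> 1" "\<And>t. 0 \<le> t \<Longrightarrow> t \<le> 1 \<Longrightarrow> norm (S t) \<le> K"
    by (rule C0_semigroup_bounded[OF S, where T=1]) blast
  define W where "W = {p. ((\<lambda>t. dual_op (S t) (blinfun_inner_right p)) \<longlongrightarrow>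
      blinfun_inner_right p) (at_right 0)}"
  note lin = bounded_linear.linear[OF bounded_linear_blinfun_inner_right]
  have sub: "subspace W"
    unfolding W_def subspace_def mem_Collect_eq linear_0[OF lin] linear_add[OF lin] linear_scale[OF lin]
      dual_op_add dual_op_scaleR linear_0[OF bounded_linear.linear[OF bounded_linear_dual_op]]
    by (auto intro: tendsto_add tendsto_scaleR)
  have cl: "closed W"
  proof (rule closed_sequential_limits[THEN iffD2], intro allI impI, elim conjE)
    fix p l assume pW: "\<forall>n. p n \<in> W" and pl: "p \<longlonglongrightarrow> l"
    show "l \<in> W"
      unfolding W_def mem_Collect_eq
    proof (rule tendstoI)
      fix e :: real assume e: "e > 0"
      have "eventually (\<lambda>n. norm (p n - l) < e / (3 * K)) sequentially"
        using tendstoD[OF pl, of "e / (3 * K)"] e K(1) by (simp add: dist_norm)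
      then obtain n where n: "norm (p n - l) < e / (3 * K)" unfolding eventually_sequentially by blast
      define \<delta> where "\<delta> = norm (blinfun_inner_right (p n) - blinfun_inner_right l)"
      have "\<delta> = norm (p n - l)"
        unfolding \<delta>_def linear_diff[OF lin, symmetric] norm_riesz[symmetric] riesz_blinfun_inner_right ..
      then have \<delta>: "K * \<delta> < e / 3" using n K(1) by (simp add: field_simps)
      have \<delta>': "\<delta> \<le> K * \<delta>"
        using K(1) by (simp add: \<delta>_def mult_le_cancel_right1)
      have "((\<lambda>t. dual_op (S t) (blinfun_inner_right (p n))) \<longlongrightarrow> blinfun_inner_right
          (p n)) (at_right 0)"
        using pW by (auto simp: W_def)
      then have "eventually (\<lambda>t. dist (dual_op (S t) (blinfun_inner_right (p n))) (blinfun_inner_right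
          (p n)) < e / 3) (at_right 0)"
        by (rule tendstoD) (use e in simp)
      moreover have "eventually (\<lambda>t::real. 0 < t \<and> t < 1) (at_right 0)"
        unfolding eventually_at_right_field by (intro exI[of _ 1]) auto
      ultimately show "\<forall>\<^sub>F t in at_right 0. dist (dual_op (S t) (blinfun_inner_right l))
          (blinfun_inner_right l) < e"
      proof eventually_elim
        case (elim t)
        let ?a = "dual_op (S t) (blinfun_inner_right l)" and ?b = "dual_op (S t) (blinfun_inner_right (p n))"
          and ?c = "blinfun_inner_right (p n)" and ?d = "blinfun_inner_right l"
        have "norm (?b - ?a) \<le> norm (S t) * norm (?c - ?d)"
          unfolding dual_op_diff[symmetric] by (rule norm_dual_op)
        also have "\<dots> \<le> K * norm (?c - ?d)" using elim by (intro mult_right_mono K) auto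
        finally have "norm (?b - ?a) \<le> K * \<delta>" by (simp add: \<delta>_def)
        moreover have "norm (?b - ?c) < e / 3" using elim by (simp add: dist_norm)
        moreover have "norm (?c - ?d) < e / 3" using \<delta> \<delta>' by (simp add: \<delta>_def)
        moreover have "norm (?a - ?d) \<le> norm (?b - ?a) + norm (?b - ?c) + norm (?c - ?d)"
        proof -
          have "?a - ?d = - (?b - ?a) + (?b - ?c) + (?c - ?d)" by simp
          then show ?thesis by (metis norm_minus_cancel norm_triangle_ineq norm_triangle_mono order_refl)
        qed
        ultimately show ?case using \<delta> by (simp add: dist_norm)
      qed
    qed
  qed
  have "W = UNIV"
  proof (rule closed_subspace_eq_UNIV[OF sub cl])
    fix x assume orth: "\<And>w. w \<in> W \<Longrightarrow> x \<bullet> w = 0"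
    show "x = 0"
    proof (rule ccontr)
      assume x: "x \<noteq> 0"
      have "((\<lambda>t. x \<bullet> S t x) \<longlongrightarrow> x \<bullet> x) (at_right 0)"
        by (intro tendsto_intros C0_semigroup_tendsto[OF S])
      then have "eventually (\<lambda>t. x \<bullet> S t x > (x \<bullet> x) / 2) (at_right 0)"
        by (rule order_tendstoD) (use x in simp)
      then obtain d where d: "d > 0" "\<And>t. 0 < t \<Longrightarrow> t < d \<Longrightarrow>
          x \<bullet> S t x > (x \<bullet> x) / 2"
        unfolding eventually_at_right_field by auto
      obtain g :: "'x \<Rightarrow>\<^sub>L real" where g: "\<And>y. g y
          = integral {0..d/2} (\<lambda>s. blinfun_inner_right x (S s y))"
        and gl: "((\<lambda>t. dual_op (S t) g) \<longlongrightarrow> g) (at_right 0)"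
        by (rule dual_semigroup_averages[OF S, of "d/2" "blinfun_inner_right x"]) (use d in auto)
      have "riesz g \<in> W" using gl by (simp add: W_def riesz_inner_right)
      then have "x \<bullet> riesz g = 0" by (rule orth)
      then have "g x = 0" by (simp add: riesz_inner[symmetric] inner_commute)
      moreover have "integral {0..d/2} (\<lambda>s. (x \<bullet> x) / 2)
          \<le> integral {0..d/2} (\<lambda>s. x \<bullet> S s x)"
      proof (rule integral_le)
        show "(\<lambda>s. x \<bullet> S s x) integrable_on {0..d/2}"
          by (intro integrable_continuous_interval continuous_intros C0_semigroup_continuous_on[OF S])
        show "(x \<bullet> x) / 2 \<le> x \<bullet> S s x" if "s \<in> {0..d/2}" for s
        proof (cases "s = 0")
          case True
          then show ?thesis by (simp add: C0_semigroup_0[OF S])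
        next
          case False
          then show ?thesis using d(2)[of s] that d(1) by simp
        qed
      qed (rule integrable_const_ivl)
      moreover have "(x \<bullet> x) / 2 * (d / 2) > 0" using x d by simp
      ultimately show False using d(1) by (simp add: g mult.commute)
    qed
  qed
  then show "((\<lambda>t. dual_blinfun (S t) \<phi>) \<longlongrightarrow> \<phi>) (at_right 0)" for \<phi>
  proof -
    have "riesz \<phi> \<in> W" using \<open>W = UNIV\<close> by simp
    then show ?thesis by (simp add: W_def riesz_inner_right)
  qed
qed

section \<open>Gronwall estimate and convolution with a semigroup\<close>

text \<open>At the maximum of e(s) exp(-2cs) the integral term is at most half the value of e there,
  hence can be absorbed on the left. The factor 2 in front and in the exponent is the price of
  avoiding any differentiation.\<close>

lemma Gronwall_crude:
  fixes e :: "real \<Rightarrow> real"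
  assumes cont: "continuous_on {0..T} e" and nn: "\<And>t. t \<in> {0..T} \<Longrightarrow> 0 \<le> e t" and c: "c > 0"
    and le: "\<And>t. t \<in> {0..T} \<Longrightarrow>
        e t \<le> a + c * (\<integral>s. e s \<partial>lebesgue_on {0..t})" and a: "a \<ge> 0"
    and t: "t \<in> {0..T}"
  shows "e t \<le> 2 * a * exp (2 * c * T)"
proof -
  define w where "w s = exp (- (2 * c) * s) * e s" for s
  have "continuous_on {0..T} w" unfolding w_def by (intro continuous_intros cont)
  moreover have "{0..T} \<noteq> {}" using t by auto
  ultimately obtain r where r: "r \<in> {0..T}" "\<And>s. s \<in> {0..T} \<Longrightarrow> w s \<le> w r"
    using continuous_attains_sup[OF compact_Icc] by blast
  have wr: "w r \<ge> 0" using nn[OF r(1)] by (simp add: w_def)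
  have es: "e s \<le> w r * exp (2 * c * s)" if "s \<in> {0..T}" for s
  proof -
    have "e s = w s * exp (2 * c * s)" by (simp add: w_def exp_minus field_simps)
    then show ?thesis using r(2)[OF that] by (simp add: mult_right_mono)
  qed
  have "(\<integral>s. e s \<partial>lebesgue_on {0..r})
      \<le> (\<integral>s. w r * exp (2 * c * s) \<partial>lebesgue_on {0..r})"
  proof (rule integral_mono)
    show "integrable (lebesgue_on {0..r}) e"
      using continuous_on_subset[OF cont] r(1) by (intro continuous_on_integrable_Icc) auto
    show "integrable (lebesgue_on {0..r}) (\<lambda>s. w r * exp (2 * c * s))"
      by (intro continuous_on_integrable_Icc continuous_intros)
  qed (use es r(1) in auto)
  also have "\<dots> = w r * (\<integral>s. exp (2 * c * s) \<partial>lebesgue_on {0..r})" by simp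
  also have "\<dots> \<le> w r * (exp (2 * c * r) / (2 * c))"
    using r(1) c by (intro mult_left_mono integral_exp_le wr) auto
  finally have "c * (\<integral>s. e s \<partial>lebesgue_on {0..r}) \<le> c * (w r * (exp (2 * c * r) / (2 * c)))"
    using c by (intro mult_left_mono) auto
  also have "\<dots> = w r * exp (2 * c * r) / 2" using c by simp
  finally have "e r \<le> a + w r * exp (2 * c * r) / 2" using le[OF r(1)] by linarith
  moreover have "e r = w r * exp (2 * c * r)" by (simp add: w_def exp_minus field_simps)
  ultimately have "w r * exp (2 * c * r) \<le> 2 * a" by linarith
  moreover have "w r * 1 \<le> w r * exp (2 * c * r)" using wr r(1) c by (intro mult_left_mono) auto
  ultimately have "w r \<le> 2 * a" by simp
  have "e t \<le> w r * exp (2 * c * t)" by (rule es[OF t])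
  also have "\<dots> \<le> 2 * a * exp (2 * c * T)"
    using \<open>w r \<le> 2 * a\<close> t c a by (intro mult_mono) auto
  finally show ?thesis .
qed

lemma strongly_measurable_semigroup_apply:
  fixes S :: "real \<Rightarrow> 'b::banach \<Rightarrow>\<^sub>L 'b"
  assumes S: "C0_semigroup S" and f: "strongly_measurable (lebesgue_on {0..t}) f"
  shows "strongly_measurable (lebesgue_on {0..t}) (\<lambda>s. S (t - s) (f s))"
proof (rule Icc.strongly_measurable_Caratheodory[OF _ _ f])
  fix c
  have "continuous_on {0..t} (\<lambda>s. S (t - s) c)"
    by (rule continuous_on_compose2[OF C0_semigroup_continuous_on[OF S, of t c]]) (auto intro!: continuous_intros)
  then show "strongly_measurable (lebesgue_on {0..t}) (\<lambda>s. S (t - s) c)"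
    by (rule continuous_on_strongly_measurable)
next
  fix s
  show "continuous_on UNIV (blinfun_apply (S (t - s)))"
    by (intro continuous_intros)
qed

lemma semigroup_apply_le:
  fixes S :: "real \<Rightarrow> 'b::banach \<Rightarrow>\<^sub>L 'b"
  assumes K: "\<And>t. 0 \<le> t \<Longrightarrow> t \<le> T \<Longrightarrow>
      norm (S t) \<le> K" and "0 \<le> t" "t \<le> T"
  shows "norm (S t x) \<le> K * norm x"
  using order_trans[OF norm_blinfun mult_right_mono[OF K[OF assms(2,3)] norm_ge_zero]] .

lemma convolution_exists:
  fixes S :: "real \<Rightarrow> 'b::banach \<Rightarrow>\<^sub>L 'b"
  assumes S: "C0_semigroup S" and f: "strongly_measurable (lebesgue_on {0..T}) f"
    and int: "integrable (lebesgue_on {0..T}) (\<lambda>s. norm (f s))" and t: "t \<in> {0..T}"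
  shows "\<exists>x. bochner_has_integral (lebesgue_on {0..t}) (\<lambda>s. S (t - s) (f s)) x"
proof -
  obtain K where K: "K \<ge> 1" "\<And>t. 0 \<le> t \<Longrightarrow> t \<le> T \<Longrightarrow> norm (S t) \<le> K"
    by (rule C0_semigroup_bounded[OF S, where T=T]) blast
  have sub: "{0..t} \<subseteq> {0..T}" using t by auto
  have m: "strongly_measurable (lebesgue_on {0..t}) (\<lambda>s. S (t - s) (f s))"
    by (rule strongly_measurable_semigroup_apply[OF S strongly_measurable_subinterval[OF f sub]])
  have "integrable (lebesgue_on {0..t}) (\<lambda>s. norm (S (t - s) (f s)))"
  proof (rule Bochner_Integration.integrable_bound)
    show "integrable (lebesgue_on {0..t}) (\<lambda>s. K * norm (f s))"
      using integrable_subinterval[OF int sub] by simp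
    show "(\<lambda>s. norm (S (t - s) (f s))) \<in> borel_measurable (lebesgue_on {0..t})"
      by (rule Icc.strongly_measurable_norm[OF m])
    show "AE s in lebesgue_on {0..t}. norm (norm (S (t - s) (f s))) \<le> norm (K * norm (f s))"
    proof (rule AE_I2)
      fix s assume "s \<in> space (lebesgue_on {0..t})"
      then have "norm (S (t - s) (f s)) \<le> K * norm (f s)"
        using t by (intro semigroup_apply_le[where T=T] K(2)) auto
      then show "norm (norm (S (t - s) (f s))) \<le> norm (K * norm (f s))" by simp
    qed
  qed
  with m show ?thesis by (rule Icc.bochner_has_integral_exists)
qed

lemma AE_neq_lebesgue_on: "AE s in lebesgue_on {a..b}. s \<noteq> (c::real)"
proof -
  have "{c} \<in> null_sets lebesgue" by (intro null_sets_completionI finite_imp_null_set_lborel) simp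
  then have "AE s in lebesgue. s \<notin> {c}" by (rule AE_not_in)
  then show ?thesis by (subst AE_restrict_space_iff) (auto elim: eventually_mono)
qed

text \<open>All convolutions are written as integrals over the fixed interval [0,T], with an
  indicator in the kernel. The kernels converge except at \<open>s = a\<close>, where the indicator
  may jump, and dominated convergence applies with twice \<open>K\<close> times the norm of
  f.\<close>

lemma convolution_continuous_on:
  fixes S :: "real \<Rightarrow> 'b::banach \<Rightarrow>\<^sub>L 'b"
  assumes S: "C0_semigroup S" and f: "strongly_measurable (lebesgue_on {0..T}) f"
    and int: "integrable (lebesgue_on {0..T}) (\<lambda>s. norm (f s))"
    and x: "\<And>t. t \<in> {0..T} \<Longrightarrow>
        bochner_has_integral (lebesgue_on {0..t}) (\<lambda>s. S (t - s) (f s)) (x t)"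
  shows "continuous_on {0..T} x"
proof (rule continuous_on_sequentiallyI)
  fix u a assume u: "\<forall>n. u n \<in> {0..T}" and a: "a \<in> {0..T}" and ua: "u \<longlonglongrightarrow> a"
  obtain K where K: "K \<ge> 1" "\<And>t. 0 \<le> t \<Longrightarrow> t \<le> T \<Longrightarrow> norm (S t) \<le> K"
    by (rule C0_semigroup_bounded[OF S, where T=T]) blast
  define k where "k t s = indicator {0..t} s *\<^sub>R S (t - s) (f s)" for t s
  have kx: "bochner_has_integral (lebesgue_on {0..T}) (k t) (x t)" if "t \<in> {0..T}" for t
  proof -
    have "{0..t} \<subseteq> {0..T}" using that by auto
    from bochner_has_integral_subinterval[OF this, THEN iffD1, OF x[OF that]] show ?thesis
      unfolding k_def .
  qed
  have kle: "norm (k t s) \<le> K * norm (f s)" if "t \<in> {0..T}" "s \<in> {0..T}" for s t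
  proof (cases "s \<le> t")
    case True
    then have "norm (S (t - s) (f s)) \<le> K * norm (f s)"
      using that by (intro semigroup_apply_le[where T=T] K(2)) auto
    then show ?thesis using True that by (simp add: k_def)
  next
    case False
    then show ?thesis using K(1) by (simp add: k_def)
  qed
  have d: "bochner_has_integral (lebesgue_on {0..T}) (\<lambda>s. k (u n) s - k a s) (x (u n) - x a)" for n
    using u a by (intro Icc.bochner_has_integral_diff kx) auto
  have "(\<lambda>n. \<integral>s. norm (k (u n) s - k a s) \<partial>lebesgue_on {0..T})
      \<longlonglongrightarrow> (\<integral>s. 0 \<partial>lebesgue_on {0..T})"
  proof (rule integral_dominated_convergence[where w="\<lambda>s. 2 * (K * norm (f s))"])
    show "AE s in lebesgue_on {0..T}. (\<lambda>n. norm (k (u n) s - k a s)) \<longlonglongrightarrow> 0"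
      using AE_neq_lebesgue_on[of a 0 T] AE_space
    proof eventually_elim
      case (elim s)
      then have s: "s \<in> {0..T}" by simp
      show ?case
      proof (cases "s < a")
        case True
        have ev: "eventually (\<lambda>n. s < u n) sequentially" by (rule order_tendstoD(1)[OF ua True])
        have "(\<lambda>n. S (u n - s) (f s)) \<longlonglongrightarrow> S (a - s) (f s)"
        proof (rule continuous_on_tendsto_compose[OF C0_semigroup_continuous_on[OF S, of T "f s"]])
          show "(\<lambda>n. u n - s) \<longlonglongrightarrow> a - s" by (intro tendsto_intros ua)
          show "a - s \<in> {0..T}" using True a s by auto
          show "\<forall>\<^sub>F n in sequentially. u n - s \<in> {0..T}"
            using ev
              by eventually_elim (use u s in \<open>auto simp: algebra_simps intro: add_increasing2\<close>)
        qed
        moreover have "eventually (\<lambda>n. S (u n - s) (f s) = k (u n) s) sequentially"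
          using ev by eventually_elim (use s in \<open>simp add: k_def\<close>)
        ultimately have "(\<lambda>n. k (u n) s) \<longlonglongrightarrow> S (a - s) (f s)"
          by (rule Lim_transform_eventually)
        then have "(\<lambda>n. norm (k (u n) s - k a s)) \<longlonglongrightarrow> norm (S (a - s) (f s) - k a s)"
          by (intro tendsto_intros)
        then show ?thesis using True s by (simp add: k_def)
      next
        case False
        then have "a < s" using elim by simp
        then have "eventually (\<lambda>n. u n < s) sequentially" by (rule order_tendstoD(2)[OF ua])
        then have "eventually (\<lambda>n. norm (k (u n) s - k a s) = 0) sequentially"
          by eventually_elim (use \<open>a < s\<close> in \<open>simp add: k_def\<close>)
        then show ?thesis by (rule tendsto_eventually)
      qed
    qed
    show "AE s in lebesgue_on {0..T}. norm (norm (k (u n) s - k a s)) \<le> 2 * (K * norm (f s))" for n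
    proof (rule AE_I2)
      fix s assume "s \<in> space (lebesgue_on {0..T})"
      then have "norm (k (u n) s) \<le> K * norm (f s)" "norm (k a s) \<le> K * norm (f s)"
        using u a by (auto intro!: kle)
      then show "norm (norm (k (u n) s - k a s)) \<le> 2 * (K * norm (f s))"
        using norm_triangle_ineq4[of "k (u n) s" "k a s"] by simp
    qed
    show "(\<lambda>s. norm (k (u n) s - k a s)) \<in> borel_measurable (lebesgue_on {0..T})" for n
      by (intro Icc.strongly_measurable_norm Icc.bochner_has_integral_strongly_measurable[OF d])
  qed (use int in auto)
  then have "(\<lambda>n. \<integral>s. norm (k (u n) s - k a s) \<partial>lebesgue_on {0..T}) \<longlonglongrightarrow> 0"
    by simp
  then have "(\<lambda>n. x (u n) - x a) \<longlonglongrightarrow> 0"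
    by (rule Lim_null_comparison[rotated]) (intro always_eventually allI Icc.bochner_has_integral_norm_le[OF d])
  then show "(\<lambda>n. x (u n)) \<longlonglongrightarrow> x a" by (rule LIM_zero_cancel)
qed

lemma convolution_diff_le:
  fixes S :: "real \<Rightarrow> 'b::banach \<Rightarrow>\<^sub>L 'b"
  assumes K: "\<And>t. 0 \<le> t \<Longrightarrow> t \<le> T \<Longrightarrow> norm (S t) \<le> K" and t: "t \<in> {0..T}"
    and x: "bochner_has_integral (lebesgue_on {0..t}) (\<lambda>s. S (t - s) (f s)) x"
    and y: "bochner_has_integral (lebesgue_on {0..t}) (\<lambda>s. S (t - s) (g s)) y"
    and r: "integrable (lebesgue_on {0..t}) r" "\<And>s. s \<in> {0..t} \<Longrightarrow> norm (f s - g s) \<le> r s"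
  shows "norm (x - y) \<le> K * (\<integral>s. r s \<partial>lebesgue_on {0..t})"
proof -
  note d = Icc.bochner_has_integral_diff[OF x y]
  have "norm (S 0) \<le> K" using t by (intro K) auto
  then have K0: "K \<ge> 0" using norm_ge_zero order_trans by blast
  have "norm (x - y) \<le> (\<integral>s. norm (S (t - s) (f s) - S (t - s) (g s)) \<partial>lebesgue_on {0..t})"
    by (rule Icc.bochner_has_integral_norm_le[OF d])
  also have "\<dots> \<le> (\<integral>s. K * r s \<partial>lebesgue_on {0..t})"
  proof (rule integral_mono[OF Icc.bochner_has_integral_integrable_norm[OF d]])
    fix s assume "s \<in> space (lebesgue_on {0..t})"
    then have s: "s \<in> {0..t}" by simp
    have "norm (S (t - s) (f s - g s)) \<le> K * norm (f s - g s)"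
      using s t by (intro semigroup_apply_le[where T=T] K) auto
    also have "\<dots> \<le> K * r s" using r(2)[OF s] K0 by (intro mult_left_mono)
    finally show "norm (S (t - s) (f s) - S (t - s) (g s)) \<le> K * r s"
      by (simp add: blinfun.diff_right)
  qed (use r in simp)
  finally show ?thesis by simp
qed

section \<open>Stability and existence of mild solutions\<close>

text \<open>The defect \<open>r\<close> enters through its \<open>L1\<close> norm alone, which later
  admits products of two \<open>L2\<close> functions. The comparison is required only along the two
  given solutions, so one of them may solve an equation whose right-hand side is a prescribed
  function of time.\<close>

lemma mild_solution_stability:
  fixes S :: "real \<Rightarrow> 'b::banach \<Rightarrow>\<^sub>L 'b"
  assumes K: "K > 0" "\<And>t. 0 \<le> t \<Longrightarrow> t \<le> T \<Longrightarrow> norm (S t) \<le> K" and L: "L > 0"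
    and x: "mild_solution T S f x0 x" and y: "mild_solution T S g x0 y"
    and r: "integrable (lebesgue_on {0..T}) r" "\<And>t. t \<in> {0..T} \<Longrightarrow> r t \<ge> 0"
    and le: "\<And>t. t \<in> {0..T} \<Longrightarrow> norm (f t (x t) - g t (y t)) \<le> L * norm (x t - y t) + r t"
    and t: "t \<in> {0..T}"
  shows "norm (x t - y t) \<le> 2 * (K * (\<integral>s. r s \<partial>lebesgue_on {0..T})) * exp (2 * (K * L) * T)"
proof (rule Gronwall_crude[OF _ _ _ _ _ t, where e="\<lambda>t. norm (x t - y t)"])
  have cx: "continuous_on {0..T} x" and cy: "continuous_on {0..T} y"
    using x y by (simp_all add: mild_solution_def)
  show c: "continuous_on {0..T} (\<lambda>t. norm (x t - y t))" by (intro continuous_intros cx cy)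
  show "K * L > 0" using K L by simp
  have r0: "(\<integral>s. r s \<partial>lebesgue_on {0..T}) \<ge> 0"
    using r(2) by (intro integral_nonneg_AE AE_I2) auto
  then show "0 \<le> K * (\<integral>s. r s \<partial>lebesgue_on {0..T})" using K by simp
  fix t assume t: "t \<in> {0..T}"
  then have sub: "{0..t} \<subseteq> {0..T}" by auto
  have ie: "integrable (lebesgue_on {0..t}) (\<lambda>t. norm (x t - y t))"
    using continuous_on_subset[OF c sub] by (rule continuous_on_integrable_Icc)
  have "norm ((x t - S t x0) - (y t - S t x0)) \<le> K * (\<integral>s. L * norm (x s - y s)
      + r s \<partial>lebesgue_on {0..t})"
  proof (rule convolution_diff_le[OF K(2) t])
    show "bochner_has_integral (lebesgue_on {0..t}) (\<lambda>s. S (t - s) (f s (x s))) (x t - S t x0)"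
      using x t by (simp add: mild_solution_def)
    show "bochner_has_integral (lebesgue_on {0..t}) (\<lambda>s. S (t - s) (g s (y s))) (y t - S t x0)"
      using y t by (simp add: mild_solution_def)
    show "integrable (lebesgue_on {0..t}) (\<lambda>s. L * norm (x s - y s) + r s)"
      using ie integrable_subinterval[OF r(1) sub] by simp
    show "norm (f s (x s) - g s (y s)) \<le> L * norm (x s - y s) + r s" if "s \<in> {0..t}" for s
      using that sub by (intro le) auto
  qed
  also have "(\<integral>s. L * norm (x s - y s) + r s \<partial>lebesgue_on {0..t})
    = L * (\<integral>s. norm (x s - y s) \<partial>lebesgue_on {0..t}) + (\<integral>s. r s \<partial>lebesgue_on {0..t})"
    using ie integrable_subinterval[OF r(1) sub] by simp
  also have "\<dots> \<le> L * (\<integral>s. norm (x s - y s) \<partial>lebesgue_on {0..t})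
      + (\<integral>s. r s \<partial>lebesgue_on {0..T})"
    using integral_subinterval_le[OF r(1) sub r(2)] by simp
  finally show "norm (x t - y t) \<le> K * (\<integral>s. r s \<partial>lebesgue_on {0..T})
      + K * L * (\<integral>s. norm (x s - y s) \<partial>lebesgue_on {0..t})"
    using K(1) by (simp add: algebra_simps)
qed simp

lemma Lipschitz_imp_continuous_on:
  fixes f :: "'a::real_normed_vector \<Rightarrow> 'b::real_normed_vector"
  assumes "\<And>a b. norm (f a - f b) \<le> L * norm (a - b)"
  shows "continuous_on UNIV f"
proof (rule continuous_on_sequentiallyI)
  fix u :: "nat \<Rightarrow> 'a" and a assume u: "u \<longlonglongrightarrow> a"
  have "(\<lambda>n. L * norm (u n - a)) \<longlonglongrightarrow> L * norm (a - a)"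
    by (intro tendsto_intros u)
  then have "(\<lambda>n. L * norm (u n - a)) \<longlonglongrightarrow> 0" by simp
  then have "(\<lambda>n. f (u n) - f a) \<longlonglongrightarrow> 0"
    by (rule Lim_null_comparison[rotated]) (intro always_eventually allI assms)
  then show "(\<lambda>n. f (u n)) \<longlonglongrightarrow> f a" by (rule LIM_zero_cancel)
qed

text \<open>Picard iteration as a contraction for the norm \<open>sup\<^sub>t exp(-2KLt) |x(t)|\<close>.\<close>
theorem mild_solution_exists:
  fixes S :: "real \<Rightarrow> 'b::banach \<Rightarrow>\<^sub>L 'b"
  assumes S: "C0_semigroup S" and T: "T \<ge> 0" and L: "L > 0"
    and meas: "\<And>c. strongly_measurable (lebesgue_on {0..T}) (\<lambda>t. f t c)"
    and int: "integrable (lebesgue_on {0..T}) (\<lambda>t. norm (f t 0))"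
    and lip: "\<And>t a b. t \<in> {0..T} \<Longrightarrow> norm (f t a - f t b) \<le> L * norm (a - b)"
  shows "\<exists>x. mild_solution T S f x0 x"
proof -
  obtain K where K: "K \<ge> 1" "\<And>t. 0 \<le> t \<Longrightarrow> t \<le> T \<Longrightarrow> norm (S t) \<le> K"
    by (rule C0_semigroup_bounded[OF S, where T=T]) blast
  have meas': "strongly_measurable (lebesgue_on {0..T}) (\<lambda>s. f s (x s))"
    if "continuous_on {0..T} x" for x
  proof (rule Icc.strongly_measurable_Caratheodory[OF meas])
    show "continuous_on UNIV (f t)" if "t \<in> space (lebesgue_on {0..T})" for t
      using that by (intro Lipschitz_imp_continuous_on[of "f t" L] lip) auto
  qed (rule continuous_on_strongly_measurable[OF that])
  have int': "integrable (lebesgue_on {0..T}) (\<lambda>s. norm (f s (x s)))" if x: "continuous_on {0..T} x" for x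
  proof (rule Bochner_Integration.integrable_bound)
    show "integrable (lebesgue_on {0..T}) (\<lambda>s. L * norm (x s) + norm (f s 0))"
      by (intro Bochner_Integration.integrable_add int continuous_on_integrable_Icc continuous_intros x)
    show "(\<lambda>s. norm (f s (x s))) \<in> borel_measurable (lebesgue_on {0..T})"
      by (intro Icc.strongly_measurable_norm meas' x)
    show "AE s in lebesgue_on {0..T}. norm (norm (f s (x s))) \<le> norm (L * norm (x s) + norm (f s 0))"
    proof (rule AE_I2)
      fix s assume "s \<in> space (lebesgue_on {0..T})"
      then have "norm (f s (x s) - f s 0) \<le> L * norm (x s)" using lip[of s "x s" 0] by simp
      then have "norm (f s (x s)) \<le> L * norm (x s) + norm (f s 0)"
        using norm_triangle_ineq[of "f s (x s) - f s 0" "f s 0"] by simp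
      then show "norm (norm (f s (x s))) \<le> norm (L * norm (x s) + norm (f s 0))" by simp
    qed
  qed
  define conv where "conv x t = (SOME z. bochner_has_integral (lebesgue_on {0..t}) (\<lambda>s. S (t
      - s) (f s (x s))) z)" for x t
  have conv: "bochner_has_integral (lebesgue_on {0..t}) (\<lambda>s. S (t - s) (f s (x s))) (conv x t)"
    if "continuous_on {0..T} x" "t \<in> {0..T}" for x t
    unfolding conv_def
      by (rule someI_ex[OF convolution_exists[OF S meas'[OF that(1)] int'[OF that(1)] that(2)]])
  have conv_cont: "continuous_on {0..T} (conv x)" if "continuous_on {0..T} x" for x
    by (rule convolution_continuous_on[OF S meas'[OF that] int'[OF that] conv[OF that]])
  \<comment> \<open>With this rate the integral of the weight contributes a factor 1/lam, and K L /
    lam is the contraction constant 1/2.\<close>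
  define lam where "lam = 2 * (K * L)"
  have lam: "lam > 0" using K L by (simp add: lam_def)
  \<comment> \<open>The fixed point theorem is applied in the complete space of bounded continuous
    functions on the whole line. Clamping the time extends functions on [0,T] to the line, and
    \<open>X\<close> below removes the exponential weight.\<close>
  define cl where "cl t = max 0 (min T t)" for t :: real
  have clin: "cl t \<in> {0..T}" for t using T by (auto simp: cl_def)
  have cleq: "cl t = t" if "t \<in> {0..T}" for t using that by (auto simp: cl_def)
  define X where "X w s = exp (lam * s) *\<^sub>R apply_bcontfun w s" for w :: "real \<Rightarrow>\<^sub>C 'b" and s
  have Xc: "continuous_on {0..T} (X w)" for w
    unfolding X_def by (intro continuous_intros continuous_on_apply_bcontfun)
  define P where "P w t = exp (- lam * cl t) *\<^sub>R (S (cl t) x0 + conv (X w) (cl t))" for w t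
  have Pb: "P w \<in> bcontfun" for w
  proof -
    define h where "h t = exp (- lam * t) *\<^sub>R (S t x0 + conv (X w) t)" for t
    have hc: "continuous_on {0..T} h"
      unfolding h_def by (intro continuous_intros conv_cont Xc C0_semigroup_continuous_on[OF S])
    have ch: "continuous_on UNIV (\<lambda>t. h (cl t))"
    proof (rule continuous_on_compose2[OF hc])
      show "continuous_on UNIV cl" unfolding cl_def by (intro continuous_intros)
    qed (use clin in auto)
    obtain B where B: "\<And>t. t \<in> {0..T} \<Longrightarrow> norm (h t) \<le> B"
      using compact_imp_bounded[OF compact_continuous_image[OF hc compact_Icc]]
      unfolding bounded_iff by blast
    have "(\<lambda>t. h (cl t)) \<in> bcontfun"
      by (rule bcontfun_normI[OF ch B[OF clin]])
    then show ?thesis by (simp add: h_def P_def[abs_def])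
  qed
  define \<Psi> where "\<Psi> w = Bcontfun (P w)" for w
  have \<Psi>: "apply_bcontfun (\<Psi> w) t = P w t" for w t
    unfolding \<Psi>_def using Pb by (simp add: Bcontfun_inverse)
  have contr: "dist (\<Psi> v) (\<Psi> w) \<le> 1/2 * dist v w" for v w
  proof (rule dist_bound)
    fix t
    define \<tau> where "\<tau> = cl t"
    have \<tau>: "\<tau> \<in> {0..T}" using clin by (simp add: \<tau>_def)
    have "norm (conv (X v) \<tau> - conv (X w) \<tau>)
        \<le> K * (\<integral>s. L * (dist v w * exp (lam * s)) \<partial>lebesgue_on {0..\<tau>})"
    proof (rule convolution_diff_le[OF K(2) \<tau> conv[OF Xc \<tau>] conv[OF Xc \<tau>]])
      show "integrable (lebesgue_on {0..\<tau>}) (\<lambda>s. L * (dist v w * exp (lam * s)))"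
        by (intro continuous_on_integrable_Icc continuous_intros)
      fix s assume s: "s \<in> {0..\<tau>}"
      have "norm (X v s - X w s) = exp (lam * s) * norm (apply_bcontfun v s - apply_bcontfun w s)"
        by (simp add: X_def scaleR_diff_right[symmetric])
      also have "\<dots> \<le> exp (lam * s) * dist v w"
        using dist_bounded[of v s w] by (intro mult_left_mono) (auto simp: dist_norm)
      finally have "L * norm (X v s - X w s) \<le> L * (dist v w * exp (lam * s))"
        using L by (simp add: mult.commute)
      moreover have "norm (f s (X v s) - f s (X w s)) \<le> L * norm (X v s - X w s)"
        using s \<tau> by (intro lip) auto
      ultimately show "norm (f s (X v s) - f s (X w s)) \<le> L * (dist v w * exp (lam * s))" by linarith
    qed
    also have "\<dots> = K * L * dist v w * (\<integral>s. exp (lam * s) \<partial>lebesgue_on {0..\<tau>})"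
      by simp
    also have "\<dots> \<le> K * L * dist v w * (exp (lam * \<tau>) / lam)"
      using \<tau> lam K L by (intro mult_left_mono integral_exp_le) auto
    also have "\<dots> = 1/2 * dist v w * exp (lam * \<tau>)" using lam K L by (simp add: lam_def)
    finally have le: "norm (conv (X v) \<tau> - conv (X w) \<tau>) \<le> 1/2 * dist v w * exp (lam * \<tau>)" .
    have "dist (P v t) (P w t) = exp (- lam * \<tau>) * norm (conv (X v) \<tau> - conv (X w) \<tau>)"
      unfolding P_def dist_norm \<tau>_def[symmetric] scaleR_diff_right[symmetric] by simp
    also have "\<dots> \<le> exp (- lam * \<tau>) * (1/2 * dist v w * exp (lam * \<tau>))"
      by (intro mult_left_mono le) simp
    also have "\<dots> = 1/2 * dist v w" by (simp add: exp_minus)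
    finally show "dist (apply_bcontfun (\<Psi> v) t) (apply_bcontfun (\<Psi> w) t) \<le> 1/2 * dist v w"
      unfolding \<Psi> .
  qed
  have "\<exists>!w. \<Psi> w = w"
    by (rule banach_fix_type[where c="1/2"]) (use contr in auto)
  then obtain w where w: "\<Psi> w = w" by blast
  have fp: "X w t = S t x0 + conv (X w) t" if t: "t \<in> {0..T}" for t
  proof -
    have "X w t = exp (lam * t) *\<^sub>R P w t" unfolding X_def using \<Psi>[of w t] w by simp
    also have "\<dots> = S t x0 + conv (X w) t"
      unfolding P_def cleq[OF t] by (simp flip: exp_add)
    finally show ?thesis .
  qed
  have "mild_solution T S f x0 (X w)"
    unfolding mild_solution_def
  proof (intro conjI ballI Xc)
    fix t assume t: "t \<in> {0..T}"
    show "bochner_has_integral (lebesgue_on {0..t}) (\<lambda>s. S (t - s) (f s (X w s))) (X w t - S t x0)"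
      using conv[OF Xc t] fp[OF t] by simp
  qed
  then show ?thesis by blast
qed

section \<open>The adjoint equation and duality\<close>

text \<open>Reversing time by s -> T - s turns the backward equation into a forward equation for the
  dual semigroup, so that existence for the adjoint equation follows from the forward
  theory.\<close>

lemma adjoint_mild_solution_iff:
  fixes \<psi> :: "real \<Rightarrow> ('x::real_normed_vector \<Rightarrow>\<^sub>L real)"
  shows "adjoint_mild_solution T S f \<psi>T \<psi> \<longleftrightarrow>
    mild_solution T (\<lambda>t. dual_blinfun (S t)) (\<lambda>t. f (T - t)) \<psi>T (\<lambda>t. \<psi> (T - t))"
proof
  assume \<psi>: "adjoint_mild_solution T S f \<psi>T \<psi>"
  then have c: "continuous_on {0..T} \<psi>" by (simp add: adjoint_mild_solution_def)
  show "mild_solution T (\<lambda>t. dual_blinfun (S t)) (\<lambda>t. f (T - t)) \<psi>T (\<lambda>t. \<psi> (T - t))"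
    unfolding mild_solution_def dual_blinfun_apply
  proof (intro conjI ballI)
    show "continuous_on {0..T} (\<lambda>t. \<psi> (T - t))"
      by (rule continuous_on_compose2[OF c]) (auto intro!: continuous_intros)
    fix t assume t: "t \<in> {0..T}"
    then have "T - t \<in> {0..T}" by auto
    then have "bochner_has_integral (lebesgue_on {T - t..T}) (\<lambda>s. dual_op (S (s - (T - t))) (f s (\<psi> s)))
        (\<psi> (T - t) - dual_op (S (T - (T - t))) \<psi>T)"
      using \<psi> unfolding adjoint_mild_solution_def by blast
    from bochner_has_integral_reflect[OF this, of T]
    show "bochner_has_integral (lebesgue_on {0..t}) (\<lambda>s. dual_op (S (t - s)) (f (T - s) (\<psi> (T - s))))
        (\<psi> (T - t) - dual_op (S t) \<psi>T)"
      by (simp add: algebra_simps)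
  qed
next
  assume \<psi>: "mild_solution T (\<lambda>t. dual_blinfun (S t)) (\<lambda>t. f (T
      - t)) \<psi>T (\<lambda>t. \<psi> (T - t))"
  then have c: "continuous_on {0..T} (\<lambda>t. \<psi> (T - t))" by (simp add: mild_solution_def)
  show "adjoint_mild_solution T S f \<psi>T \<psi>"
    unfolding adjoint_mild_solution_def
  proof (intro conjI ballI)
    have "continuous_on {0..T} (\<lambda>t. \<psi> (T - (T - t)))"
      by (rule continuous_on_compose2[OF c]) (auto intro!: continuous_intros)
    then show "continuous_on {0..T} \<psi>" by simp
    fix t assume t: "t \<in> {0..T}"
    then have "T - t \<in> {0..T}" by auto
    then have "bochner_has_integral (lebesgue_on {0..T - t}) (\<lambda>s. dual_op (S (T - t - s)) (f (T
        - s) (\<psi> (T - s))))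
        (\<psi> (T - (T - t)) - dual_op (S (T - t)) \<psi>T)"
      using \<psi> unfolding mild_solution_def dual_blinfun_apply by blast
    from bochner_has_integral_reflect[OF this, of T]
    show "bochner_has_integral (lebesgue_on {t..T}) (\<lambda>s. dual_op (S (s - t)) (f s (\<psi> s)))
        (\<psi> t - dual_op (S (T - t)) \<psi>T)"
      by (simp add: algebra_simps)
  qed
qed

lemma integrable_reflect:
  fixes f :: "real \<Rightarrow> real"
  assumes "integrable (lebesgue_on {a..b}) f"
  shows "integrable (lebesgue_on {c-b..c-a}) (\<lambda>t. f (c - t))"
  using integrable_distr[OF reflect_Icc_measurable_distr(1), of c b a f]
  unfolding reflect_Icc_measurable_distr(2) using assms by blast

theorem adjoint_mild_solution_exists:
  fixes S :: "real \<Rightarrow> 'x::{real_inner, banach} \<Rightarrow>\<^sub>L 'x"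
  assumes S: "C0_semigroup S" and T: "T \<ge> 0" and L: "L > 0"
    and meas: "\<And>c. strongly_measurable (lebesgue_on {0..T}) (\<lambda>t. f t c)"
    and int: "integrable (lebesgue_on {0..T}) (\<lambda>t. norm (f t 0))"
    and lip: "\<And>t a b. t \<in> {0..T} \<Longrightarrow> norm (f t a - f t b) \<le> L * norm (a - b)"
  shows "\<exists>\<psi>. adjoint_mild_solution T S f \<psi>T \<psi>"
proof -
  have "\<exists>x. mild_solution T (\<lambda>t. dual_blinfun (S t)) (\<lambda>t. f (T - t)) \<psi>T x"
  proof (rule mild_solution_exists[OF C0_semigroup_dual[OF S] T L])
    show "strongly_measurable (lebesgue_on {0..T}) (\<lambda>t. f (T - t) c)" for c
      using strongly_measurable_reflect[OF meas, of T c] by simp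
    show "integrable (lebesgue_on {0..T}) (\<lambda>t. norm (f (T - t) 0))"
      using integrable_reflect[OF int, of T] by simp
  qed (use lip in auto)
  then obtain x where x: "mild_solution T (\<lambda>t. dual_blinfun (S t)) (\<lambda>t. f (T - t)) \<psi>T x"
    by blast
  have "adjoint_mild_solution T S f \<psi>T (\<lambda>t. x (T - t))"
    unfolding adjoint_mild_solution_iff using x by simp
  then show ?thesis by blast
qed

section \<open>Pairing of forward and backward solutions\<close>

text \<open>Multiplying by the indicator of the good set makes the approximants converge at every
  point. The product of two complete measures need not be complete, so measurability of a kernel on
  the square is derived from limits that exist everywhere.\<close>

lemma (in finite_complete_measure) strongly_measurable_everywhere_limit:
  fixes f :: "'a \<Rightarrow> 'b::real_normed_vector"
  assumes f: "strongly_measurable M f"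
  obtains s g where "\<And>i::nat. simple_function M (s i)" "\<And>t. t \<in> space M \<Longrightarrow>
      (\<lambda>i. s i t) \<longlonglongrightarrow> g t"
    "AE t in M. f t = g t"
proof -
  obtain s where s: "\<And>i. simple_function M (s i)" "AE t in M. (\<lambda>i::nat. s i t) \<longlonglongrightarrow> f t"
    using f unfolding strongly_measurable_def by blast
  obtain N where N: "N \<in> null_sets M" "\<And>t. t \<in> space M - N \<Longrightarrow>
      (\<lambda>i. s i t) \<longlonglongrightarrow> f t"
    by (rule AE_E3[OF s(2)]) blast
  let ?A = "space M - N"
  have A: "?A \<in> sets M" using N(1) by auto
  have 1: "simple_function M (\<lambda>t. indicator ?A t *\<^sub>R s i t)" for i
    by (intro simple_function_compose2[where h="(*\<^sub>R)"] simple_function_indicator A s(1))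
  have 2: "(\<lambda>i. indicator ?A t *\<^sub>R s i t) \<longlonglongrightarrow> indicator ?A t *\<^sub>R f t"
    if "t \<in> space M" for t
    using N(2)[of t] by (auto split: split_indicator)
  have 3: "AE t in M. f t = indicator ?A t *\<^sub>R f t"
    using AE_not_in[OF N(1)] AE_space by eventually_elim simp
  show thesis by (rule that[OF 1 2 3])
qed

text \<open>For a fixed functional and a fixed vector the kernel is continuous on the triangle,
  hence measurable. Simple p and q give finite sums of such kernels, and pointwise limits give the
  general case. Integrability comes from the bound \<open>K\<close> times the product of the
  norms.\<close>

lemma duality_kernel_integrable:
  fixes S :: "real \<Rightarrow> 'x::banach \<Rightarrow>\<^sub>L 'x" and p :: "real \<Rightarrow> 'x
      \<Rightarrow>\<^sub>L real" and q :: "real \<Rightarrow> 'x"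
  assumes S: "C0_semigroup S"
    and p: "\<And>i::nat. simple_function (lebesgue_on {0..T}) (p' i)" "\<And>t. t
        \<in> {0..T} \<Longrightarrow> (\<lambda>i. p' i t) \<longlonglongrightarrow> p t"
    and q: "\<And>i::nat. simple_function (lebesgue_on {0..T}) (q' i)" "\<And>t. t
        \<in> {0..T} \<Longrightarrow> (\<lambda>i. q' i t) \<longlonglongrightarrow> q t"
    and pint: "integrable (lebesgue_on {0..T}) (\<lambda>t. norm (p t))"
    and qint: "integrable (lebesgue_on {0..T}) (\<lambda>t. norm (q t))"
  shows "integrable (lebesgue_on {0..T} \<Otimes>\<^sub>M lebesgue_on {0..T})
    (\<lambda>(s, t). if t \<le> s then p s (S (s - t) (q t)) else 0)"
proof -
  let ?M = "lebesgue_on {0..T}"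
  interpret P: pair_sigma_finite ?M ?M ..
  obtain K where K: "K \<ge> 1" "\<And>t. 0 \<le> t \<Longrightarrow> t \<le> T \<Longrightarrow> norm (S t) \<le> K"
    by (rule C0_semigroup_bounded[OF S, where T=T]) blast
  have sp: "space (?M \<Otimes>\<^sub>M ?M) = {0..T} \<times> {0..T}" by (simp add: space_pair_measure)
  have fstM: "fst \<in> measurable (?M \<Otimes>\<^sub>M ?M) ?M" and sndM: "snd
      \<in> measurable (?M \<Otimes>\<^sub>M ?M) ?M"
    by simp_all
  have idM: "(\<lambda>x. x) \<in> borel_measurable ?M"
    by (intro measurable_restrict_space1 measurable_completion) simp
  have fst_borel: "(\<lambda>z. fst z) \<in> borel_measurable (?M \<Otimes>\<^sub>M ?M)"
    and snd_borel: "(\<lambda>z. snd z) \<in> borel_measurable (?M \<Otimes>\<^sub>M ?M)"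
    using measurable_compose[OF fstM idM] measurable_compose[OF sndM idM] by simp_all
  \<comment> \<open>Clamping makes the evaluated semigroup continuous on the whole line, including
    negative time differences, and changes nothing on the triangle.\<close>
  define cl where "cl t = max 0 (min T t)" for t :: real
  have base: "(\<lambda>z. if snd z \<le> fst z then \<phi> (S (cl (fst z - snd z)) c) else 0)
      \<in> borel_measurable (?M \<Otimes>\<^sub>M ?M)"
    if T: "T \<ge> 0" for \<phi> :: "'x \<Rightarrow>\<^sub>L real" and c
  proof -
    have cont: "continuous_on UNIV (\<lambda>r. \<phi> (S (cl r) c))"
    proof (rule bounded_linear.continuous_on[OF blinfun.bounded_linear_right])
      show "continuous_on UNIV (\<lambda>r. S (cl r) c)"
      proof (rule continuous_on_compose2[OF C0_semigroup_continuous_on[OF S, of T c]])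
        show "continuous_on UNIV cl" unfolding cl_def by (intro continuous_intros)
      qed (use T in \<open>auto simp: cl_def\<close>)
    qed
    have "(\<lambda>z. \<phi> (S (cl (fst z - snd z)) c)) \<in> borel_measurable (?M \<Otimes>\<^sub>M ?M)"
      by (rule measurable_compose[OF borel_measurable_diff[OF fst_borel snd_borel] borel_measurable_continuous_onI[OF cont]])
    moreover have "{z \<in> space (?M \<Otimes>\<^sub>M ?M). snd z \<le> fst z} \<in> sets (?M \<Otimes>\<^sub>M ?M)"
      by (rule borel_measurable_le[OF snd_borel fst_borel])
    ultimately show ?thesis by (intro measurable_If) auto
  qed
  define k where "k \<phi> c z = (if snd z \<le> fst z then blinfun_apply \<phi> (S (cl (fst z - snd z)) c) else 0)"
    for \<phi> :: "'x \<Rightarrow>\<^sub>L real" and c z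
  have kmeas: "(\<lambda>z. k (p' i (fst z)) (q' i (snd z)) z)
      \<in> borel_measurable (?M \<Otimes>\<^sub>M ?M)" if T: "T \<ge> 0" for i
  proof -
    let ?A = "\<lambda>\<phi>. p' i -` {\<phi>} \<inter> space ?M" and ?B = "\<lambda>c. q' i -` {c} \<inter> space ?M"
    have A: "(\<lambda>z. indicator (?A \<phi>) (fst z) :: real) \<in> borel_measurable (?M \<Otimes>\<^sub>M ?M)" for \<phi>
      by (rule measurable_compose[OF fstM borel_measurable_indicator[OF simple_functionD(2)[OF p(1)]]])
    have B: "(\<lambda>z. indicator (?B c) (snd z) :: real) \<in> borel_measurable (?M \<Otimes>\<^sub>M ?M)" for c
      by (rule measurable_compose[OF sndM borel_measurable_indicator[OF simple_functionD(2)[OF q(1)]]])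
    have "(\<lambda>z. \<Sum>\<phi>\<in>p' i ` space ?M. \<Sum>c\<in>q' i ` space ?M. indicator (?A \<phi>)
        (fst z) * (indicator (?B c) (snd z) * k \<phi> c z))
      \<in> borel_measurable (?M \<Otimes>\<^sub>M ?M)"
      unfolding k_def by (intro borel_measurable_sum borel_measurable_times A B base[OF T])
    moreover have "(\<Sum>\<phi>\<in>p' i ` space ?M. \<Sum>c\<in>q' i ` space ?M. indicator (?A \<phi>) (fst
        z) * (indicator (?B c) (snd z) * k \<phi> c z))
      = k (p' i (fst z)) (q' i (snd z)) z" if z: "z \<in> space (?M \<Otimes>\<^sub>M ?M)" for z
    proof -
      have z': "fst z \<in> space ?M" "snd z \<in> space ?M" using z by (auto simp: space_pair_measure)
      have fin: "finite (p' i ` space ?M)" "finite (q' i ` space ?M)"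
        using simple_functionD(1)[OF p(1)] simple_functionD(1)[OF q(1)] by blast+
      have "(\<Sum>\<phi>\<in>p' i ` space ?M. \<Sum>c\<in>q' i ` space ?M. indicator (?A \<phi>) (fst z) *
          (indicator (?B c) (snd z) * k \<phi> c z))
        = (\<Sum>\<phi>\<in>p' i ` space ?M. if \<phi> = p' i (fst z) then (\<Sum>c\<in>q' i ` space ?M. if c
            = q' i (snd z) then k \<phi> c z else 0) else 0)"
        by (intro sum.cong refl) (use z' in \<open>auto intro!: sum.cong split: split_indicator\<close>)
      also have "\<dots> = k (p' i (fst z)) (q' i (snd z)) z"
        using fin z' by (simp add: sum.delta)
      finally show ?thesis .
    qed
    ultimately show ?thesis by (rule measurable_cong[THEN iffD1, rotated])
  qed
  have keq: "k (p (fst z)) (q (snd z)) z = (case z of (s, t) \<Rightarrow> if t \<le> s then p s (S (s - t) (q t)) else 0)"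
    if "z \<in> space (?M \<Otimes>\<^sub>M ?M)" for z
    using that by (auto simp: sp k_def cl_def split: prod.split)
  have km: "(\<lambda>(s, t). if t \<le> s then p s (S (s - t) (q t)) else 0)
      \<in> borel_measurable (?M \<Otimes>\<^sub>M ?M)"
  proof (cases "T \<ge> 0")
    case True
    have "(\<lambda>z. k (p (fst z)) (q (snd z)) z) \<in> borel_measurable (?M \<Otimes>\<^sub>M ?M)"
    proof (rule borel_measurable_LIMSEQ_metric[OF kmeas[OF True]])
      fix z assume z: "z \<in> space (?M \<Otimes>\<^sub>M ?M)"
      then have "(\<lambda>i. p' i (fst z)) \<longlonglongrightarrow> p (fst z)"
          "(\<lambda>i. q' i (snd z)) \<longlonglongrightarrow> q (snd z)"
        by (auto simp: sp intro!: p(2) q(2))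
      then show "(\<lambda>i. k (p' i (fst z)) (q' i (snd z)) z) \<longlonglongrightarrow> k (p (fst z)) (q (snd z)) z"
        unfolding k_def by (auto intro!: tendsto_intros)
    qed
    then show ?thesis using keq by (simp cong: measurable_cong)
  next
    case False
    then have "space (?M \<Otimes>\<^sub>M ?M) = {}" unfolding sp using False by simp
    then show ?thesis
      by (intro measurableI) (simp_all only: Int_empty_right sets.empty_sets empty_iff space_borel UNIV_I)
  qed
  have dom: "integrable (?M \<Otimes>\<^sub>M ?M) (\<lambda>z. K * (norm (p (fst z)) * norm (q (snd z))))"
  proof (intro integrable_mult_right P.Fubini_integrable)
    have m: "(\<lambda>t. norm (p t)) \<in> borel_measurable ?M" "(\<lambda>t. norm (q t)) \<in> borel_measurable ?M"
      using pint qint by auto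
    show "(\<lambda>z. norm (p (fst z)) * norm (q (snd z))) \<in> borel_measurable (?M \<Otimes>\<^sub>M ?M)"
      using measurable_compose[OF fstM m(1)] measurable_compose[OF sndM m(2)] by (rule borel_measurable_times)
    show "integrable ?M (\<lambda>s. \<integral>t. norm (norm (p (fst (s, t))) * norm (q (snd (s, t)))) \<partial>?M)"
      using pint by simp
    show "AE s in ?M. integrable ?M (\<lambda>t. norm (p (fst (s, t))) * norm (q (snd (s, t))))"
      using qint by simp
  qed
  show ?thesis
  proof (rule Bochner_Integration.integrable_bound[OF dom km], rule AE_I2)
    fix z assume z: "z \<in> space (?M \<Otimes>\<^sub>M ?M)"
    obtain s t where st: "z = (s, t)" "s \<in> {0..T}" "t \<in> {0..T}" using z by (auto simp: sp)
    have "norm (if t \<le> s then p s (S (s - t) (q t)) else 0) \<le> K * (norm (p s) * norm (q t))"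
    proof (cases "t \<le> s")
      case True
      have "norm (p s (S (s - t) (q t))) \<le> norm (p s) * norm (S (s - t) (q t))" by (rule norm_blinfun)
      also have "\<dots> \<le> norm (p s) * (K * norm (q t))"
        using st True by (intro mult_left_mono semigroup_apply_le[where T=T] K(2)) auto
      finally show ?thesis using True by (simp add: mult_ac)
    qed (use K(1) in simp)
    then show "norm (case z of (s, t) \<Rightarrow> if t \<le> s then p s (S (s - t) (q t)) else 0)
      \<le> norm (K * (norm (p (fst z)) * norm (q (snd z))))"
      using K(1) st by simp
  qed
qed

text \<open>Fubini's theorem on the triangle \<open>t \<le> s\<close>.\<close>
theorem mild_duality:
  fixes S :: "real \<Rightarrow> 'x::banach \<Rightarrow>\<^sub>L 'x" and p :: "real \<Rightarrow> 'x
      \<Rightarrow>\<^sub>L real" and q :: "real \<Rightarrow> 'x"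
  assumes S: "C0_semigroup S" and T: "T \<ge> 0"
    and p: "strongly_measurable (lebesgue_on {0..T}) p" and q: "strongly_measurable (lebesgue_on {0..T}) q"
    and pint: "integrable (lebesgue_on {0..T}) (\<lambda>t. norm (p t))"
    and qint: "integrable (lebesgue_on {0..T}) (\<lambda>t. norm (q t))"
    and \<psi>: "\<And>t. t \<in> {0..T} \<Longrightarrow>
        bochner_has_integral (lebesgue_on {t..T}) (\<lambda>s. dual_op (S (s - t)) (p s)) (\<psi> t
        - dual_op (S (T - t)) \<psi>T)"
    and \<xi>: "\<And>t. t \<in> {0..T} \<Longrightarrow>
        bochner_has_integral (lebesgue_on {0..t}) (\<lambda>s. S (t - s) (q s)) (\<xi> t)"
  shows "(\<integral>t. \<psi> t (q t) \<partial>lebesgue_on {0..T})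
      = \<psi>T (\<xi> T) + (\<integral>s. p s (\<xi> s) \<partial>lebesgue_on {0..T})"
proof -
  let ?M = "lebesgue_on {0..T}"
  interpret P: pair_sigma_finite ?M ?M ..
  obtain p' p2 where p': "\<And>i::nat. simple_function ?M (p' i)" "\<And>t. t \<in> space ?M \<Longrightarrow>
      (\<lambda>i. p' i t) \<longlonglongrightarrow> p2 t" "AE t in ?M. p t = p2 t"
    by (rule Icc.strongly_measurable_everywhere_limit[OF p]) blast
  obtain q' q2 where q': "\<And>i::nat. simple_function ?M (q' i)" "\<And>t. t \<in> space ?M \<Longrightarrow>
      (\<lambda>i. q' i t) \<longlonglongrightarrow> q2 t" "AE t in ?M. q t = q2 t"
    by (rule Icc.strongly_measurable_everywhere_limit[OF q]) blast
  have p2m: "strongly_measurable ?M p2" by (rule Icc.strongly_measurable_AE_cong[OF p p'(3)])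
  have q2m: "strongly_measurable ?M q2" by (rule Icc.strongly_measurable_AE_cong[OF q q'(3)])
  have p2int: "integrable ?M (\<lambda>t. norm (p2 t))"
    by (rule integrable_cong_AE_imp[OF pint Icc.strongly_measurable_norm[OF p2m]]) (use p'(3) in eventually_elim, simp)
  have q2int: "integrable ?M (\<lambda>t. norm (q2 t))"
    by (rule integrable_cong_AE_imp[OF qint Icc.strongly_measurable_norm[OF q2m]]) (use q'(3) in eventually_elim, simp)
  define k where "k s t = (if t \<le> s then p2 s (S (s - t) (q2 t)) else 0)" for s t
  have kint: "integrable (?M \<Otimes>\<^sub>M ?M) (\<lambda>(s, t). k s t)"
    unfolding k_def by (rule duality_kernel_integrable[OF S p'(1,2) q'(1,2) p2int q2int]) simp_all
  have sub_AE: "AE s in lebesgue_on {a..b}. Q s" if "AE s in ?M. Q s" "{a..b} \<subseteq> {0..T}" for Q a b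
  proof -
    have "AE s in ?M. s \<in> {a..b} \<longrightarrow> Q s" using that(1) by eventually_elim simp
    then show ?thesis
      unfolding lebesgue_on_subinterval[OF that(2)]
        by (subst AE_restrict_space_iff[OF subinterval_sets'[OF that(2)]])
  qed
  \<comment> \<open>Integrated over t, the kernel gives p paired with xi; integrated over s
    (\<open>col\<close> below), it gives psi paired with q minus the contribution of the terminal
    value. Fubini equates the two double integrals.\<close>
  have row: "p2 s (\<xi> s) = (\<integral>t. k s t \<partial>?M)" if s: "s \<in> {0..T}" for s
  proof -
    have sub: "{0..s} \<subseteq> {0..T}" using s by auto
    have "AE t in lebesgue_on {0..s}. S (s - t) (q t) = S (s - t) (q2 t)"
      using sub_AE[OF q'(3) sub] by eventually_elim simp
    from Icc.bochner_has_integral_AE_cong[OF \<xi>[OF s] this]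
    have "bochner_has_integral (lebesgue_on {0..s}) (\<lambda>t. p2 s (S (s - t) (q2 t))) (p2 s (\<xi> s))"
      by (rule Icc.bochner_has_integral_bounded_linear) (rule blinfun.bounded_linear_right)
    then have "bochner_has_integral ?M (\<lambda>t. indicator {0..s} t *\<^sub>R p2 s (S (s - t) (q2 t))) (p2 s (\<xi> s))"
      by (rule bochner_has_integral_subinterval[OF sub, THEN iffD1])
    then have "p2 s (\<xi> s) = (\<integral>t. indicator {0..s} t *\<^sub>R p2 s (S (s - t) (q2 t)) \<partial>?M)"
      by (rule Icc.bochner_has_integral_real(2)[symmetric])
    also have "\<dots> = (\<integral>t. k s t \<partial>?M)"
      by (intro Bochner_Integration.integral_cong) (auto simp: k_def split: split_indicator)
    finally show ?thesis .
  qed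
  have col: "\<psi> t (q2 t) = \<psi>T (S (T - t) (q2 t)) + (\<integral>s. k s t \<partial>?M)" if t: "t \<in> {0..T}" for t
  proof -
    have sub: "{t..T} \<subseteq> {0..T}" using t by auto
    have "AE s in lebesgue_on {t..T}. dual_op (S (s - t)) (p s) = dual_op (S (s - t)) (p2 s)"
      using sub_AE[OF p'(3) sub] by eventually_elim simp
    from Icc.bochner_has_integral_AE_cong[OF \<psi>[OF t] this]
    have "bochner_has_integral (lebesgue_on {t..T}) (\<lambda>s. dual_op (S (s
        - t)) (p2 s) (q2 t)) ((\<psi> t - dual_op (S (T - t)) \<psi>T) (q2 t))"
      by (rule Icc.bochner_has_integral_bounded_linear) (rule blinfun.bounded_linear_left)
    then have "bochner_has_integral ?M (\<lambda>s. indicator {t..T} s *\<^sub>R dual_op (S (s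
        - t)) (p2 s) (q2 t)) ((\<psi> t - dual_op (S (T - t)) \<psi>T) (q2 t))"
      by (rule bochner_has_integral_subinterval[OF sub, THEN iffD1])
    then have "(\<psi> t - dual_op (S (T - t)) \<psi>T) (q2 t)
        = (\<integral>s. indicator {t..T} s *\<^sub>R dual_op (S (s - t)) (p2 s) (q2 t) \<partial>?M)"
      by (rule Icc.bochner_has_integral_real(2)[symmetric])
    also have "\<dots> = (\<integral>s. k s t \<partial>?M)"
      by (intro Bochner_Integration.integral_cong) (auto simp: k_def split: split_indicator)
    finally show ?thesis by (simp add: blinfun.diff_left)
  qed
  have TT: "T \<in> {0..T}" using T by simp
  have "AE t in ?M. S (T - t) (q t) = S (T - t) (q2 t)"
    using q'(3) by eventually_elim simp
  from Icc.bochner_has_integral_AE_cong[OF \<xi>[OF TT] this]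
  have bT: "bochner_has_integral ?M (\<lambda>t. \<psi>T (S (T - t) (q2 t))) (\<psi>T (\<xi> T))"
    by (rule Icc.bochner_has_integral_bounded_linear) (rule blinfun.bounded_linear_right)
  have c1: "integrable ?M (\<lambda>t. \<psi>T (S (T - t) (q2 t)))"
      "integrable ?M (\<lambda>t. \<integral>s. k s t \<partial>?M)"
    using Icc.bochner_has_integral_real(1)[OF bT] P.integrable_snd[OF kint] by blast+
  have eq1: "AE t in ?M. \<psi>T (S (T - t) (q2 t)) + (\<integral>s. k s t \<partial>?M) = \<psi> t (q t)"
    using q'(3) AE_space by eventually_elim (use col in simp)
  have m1: "(\<lambda>t. \<psi>T (S (T - t) (q2 t)) + (\<integral>s. k s t \<partial>?M)) \<in> borel_measurable ?M"
    using c1 by (intro borel_measurable_add borel_measurable_integrable)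
  have eq2: "AE s in ?M. (\<integral>t. k s t \<partial>?M) = p s (\<xi> s)"
    using p'(3) AE_space by eventually_elim (use row in simp)
  have m2: "(\<lambda>s. \<integral>t. k s t \<partial>?M) \<in> borel_measurable ?M"
    using P.integrable_fst[OF kint] by (rule borel_measurable_integrable)
  have "(\<integral>t. \<psi> t (q t) \<partial>?M)
      = (\<integral>t. \<psi>T (S (T - t) (q2 t)) + (\<integral>s. k s t \<partial>?M) \<partial>?M)"
    by (rule integral_cong_AE[OF m1 Icc.measurable_AE_cong[OF m1 eq1] eq1, symmetric])
  also have "\<dots> = (\<integral>t. \<psi>T (S (T - t) (q2 t)) \<partial>?M)
      + (\<integral>t. (\<integral>s. k s t \<partial>?M) \<partial>?M)"
    by (rule Bochner_Integration.integral_add[OF c1])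
  also have "(\<integral>t. \<psi>T (S (T - t) (q2 t)) \<partial>?M) = \<psi>T (\<xi> T)"
    by (rule Icc.bochner_has_integral_real(2)[OF bT])
  also have "(\<integral>t. (\<integral>s. k s t \<partial>?M) \<partial>?M)
      = (\<integral>s. (\<integral>t. k s t \<partial>?M) \<partial>?M)"
    by (rule P.Fubini_integral[OF kint])
  also have "\<dots> = (\<integral>s. p s (\<xi> s) \<partial>?M)"
    by (rule integral_cong_AE[OF m2 Icc.measurable_AE_cong[OF m2 eq2] eq2])
  finally show ?thesis .
qed

section \<open>Coercive perturbations, finite codimensionality and smooth families\<close>

text \<open>The map \<open>r \<mapsto> r - \<tau> \<Psi>(r)\<close> is a contraction for \<open>\<tau> = c/K\<^sup>2\<close>: a coercive bounded operator \<open>G\<close> satisfies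
  \<open>\<parallel>r - \<tau> G r\<parallel> \<le> (1 - \<tau> c/2) \<parallel>r\<parallel>\<close>.\<close>
lemma coercive_perturbation_zero:
  fixes G \<Psi> :: "'x::{real_inner, banach} \<Rightarrow> 'x"
  assumes L: "subspace L" "closed L" and GL: "\<And>r. r \<in> L \<Longrightarrow> G r \<in> L"
    and Gd: "\<And>r s. r \<in> L \<Longrightarrow> s \<in> L \<Longrightarrow> G r - G s = G (r - s)"
    and Gb: "\<And>r. r \<in> L \<Longrightarrow> norm (G r) \<le> K * norm r"
    and c: "c > 0" and Gc: "\<And>r. r \<in> L \<Longrightarrow> c * (norm r)\<^sup>2 \<le> r \<bullet> G r"
    and \<Psi>L: "\<And>r. r \<in> L \<Longrightarrow> norm r \<le> \<rho> \<Longrightarrow> \<Psi> r \<in> L"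
    and \<Psi>d: "\<And>r s. r \<in> L \<Longrightarrow> s \<in> L \<Longrightarrow>
        norm r \<le> \<rho> \<Longrightarrow> norm s \<le> \<rho> \<Longrightarrow>
      norm (\<Psi> r - \<Psi> s - (G r - G s)) \<le> c / 4 * norm (r - s)"
    and \<rho>: "\<rho> \<ge> 0" and \<Psi>0: "norm (\<Psi> 0) \<le> c * \<rho> / 4"
  shows "\<exists>r\<in>L. \<Psi> r = 0 \<and> norm r \<le> \<rho> \<and> norm r \<le> 4 / c * norm (\<Psi> 0)"
proof -
  \<comment> \<open>Raising the bound to at least c makes \<open>u\<close>, which equals the square
    of c / K', at most 1, so that all contraction factors are nonnegative.\<close>
  define K' where "K' = max K c"
  have K': "K' \<ge> c" "K' > 0" and Gb': "\<And>r. r \<in> L \<Longrightarrow> norm (G r) \<le> K' * norm r"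
    using c order_trans[OF Gb mult_right_mono[of K K']] by (auto simp: K'_def)
  define \<tau> where "\<tau> = c / K'\<^sup>2"
  have \<tau>: "\<tau> > 0" using c K' by (simp add: \<tau>_def)
  define u where "u = \<tau> * c"
  have uK: "\<tau>\<^sup>2 * K'\<^sup>2 = u" using K' by (simp add: u_def \<tau>_def power2_eq_square)
  have u0: "u > 0" using \<tau> c by (simp add: u_def)
  have "c\<^sup>2 \<le> K'\<^sup>2" using K' c by (intro power_mono) auto
  then have u1: "u \<le> 1" using K' by (simp add: u_def \<tau>_def power2_eq_square)
  have lin: "norm (r - \<tau> *\<^sub>R G r) \<le> (1 - u / 2) * norm r" if r: "r \<in> L" for r
  proof -
    have "(norm (r - \<tau> *\<^sub>R G r))\<^sup>2
        = (norm r)\<^sup>2 - 2 * \<tau> * (r \<bullet> G r) + \<tau>\<^sup>2 * (norm (G r))\<^sup>2"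
      unfolding power2_norm_eq_inner
      by (simp add: inner_diff_left inner_diff_right inner_commute[of "G r" r] power2_eq_square right_diff_distrib)
    also have "\<tau>\<^sup>2 * (norm (G r))\<^sup>2 \<le> \<tau>\<^sup>2 * (K' * norm r)\<^sup>2"
      by (intro mult_left_mono power_mono Gb' r) auto
    also have "\<tau>\<^sup>2 * (K' * norm r)\<^sup>2 = u * (norm r)\<^sup>2"
      using uK by (simp add: power_mult_distrib mult.assoc[symmetric])
    finally have "(norm (r - \<tau> *\<^sub>R G r))\<^sup>2
        \<le> (norm r)\<^sup>2 - 2 * (\<tau> * (r \<bullet> G r)) + u * (norm r)\<^sup>2"
      by simp
    moreover have "u * (norm r)\<^sup>2 \<le> \<tau> * (r \<bullet> G r)"
      using mult_left_mono[OF Gc[OF r], of \<tau>] \<tau> by (simp add: u_def mult.assoc)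
    ultimately have "(norm (r - \<tau> *\<^sub>R G r))\<^sup>2 \<le> (norm r)\<^sup>2 - u * (norm r)\<^sup>2"
      by linarith
    also have "\<dots> \<le> ((1 - u / 2) * norm r)\<^sup>2"
    proof -
      have "((1 - u / 2) * norm r)\<^sup>2 = (norm r)\<^sup>2 - u * (norm r)\<^sup>2 + (u / 2 * norm r)\<^sup>2"
        by (simp add: power2_eq_square algebra_simps)
      then show ?thesis by simp
    qed
    finally show ?thesis by (rule power2_le_imp_le) (use u1 in simp)
  qed
  define C where "C = L \<inter> cball 0 \<rho>"
  define \<Phi> where "\<Phi> r = r - \<tau> *\<^sub>R \<Psi> r" for r
  \<comment> \<open>The linear part contracts by \<open>1 - u / 2\<close>, and a perturbation with
    Lipschitz constant c / 4 costs at most \<open>u / 4\<close>. The bound on the value at 0 is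
    exactly what then maps the ball of radius rho into itself.\<close>
  have contr: "norm (\<Phi> r - \<Phi> s) \<le> (1 - u / 4) * norm (r - s)" if "r \<in> C" "s \<in> C" for r s
  proof -
    have rs: "r \<in> L" "s \<in> L" "norm r \<le> \<rho>" "norm s \<le> \<rho>"
      using that by (auto simp: C_def)
    then have rsL: "r - s \<in> L" using L by (intro subspace_diff)
    have "\<Phi> r - \<Phi> s = ((r - s) - \<tau> *\<^sub>R G (r - s)) - \<tau> *\<^sub>R (\<Psi> r
        - \<Psi> s - (G r - G s))"
      using Gd[OF rs(1,2)] by (simp add: \<Phi>_def scaleR_diff_right)
    then have "norm (\<Phi> r - \<Phi> s) \<le> norm ((r - s) - \<tau> *\<^sub>R G (r - s))
        + norm (\<tau> *\<^sub>R (\<Psi> r - \<Psi> s - (G r - G s)))"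
      by (simp only: norm_triangle_ineq4)
    also have "norm (\<tau> *\<^sub>R (\<Psi> r - \<Psi> s - (G r - G s))) \<le> \<tau> * (c / 4 * norm (r - s))"
    proof -
      have "norm (\<tau> *\<^sub>R (\<Psi> r - \<Psi> s - (G r - G s))) = \<tau> * norm (\<Psi> r - \<Psi> s - (G r - G s))"
        using \<tau> by simp
      then show ?thesis using mult_left_mono[OF \<Psi>d[OF rs], of \<tau>] \<tau> by simp
    qed
    also have "\<tau> * (c / 4 * norm (r - s)) = u / 4 * norm (r - s)" by (simp add: u_def)
    finally show ?thesis using lin[OF rsL] by (simp add: algebra_simps)
  qed
  have C0: "0 \<in> C" using L \<rho> by (simp add: C_def subspace_0)
  have \<Phi>0: "norm (\<Phi> 0) = \<tau> * norm (\<Psi> 0)" using \<tau> by (simp add: \<Phi>_def)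
  have \<Phi>b: "norm (\<Phi> r) \<le> (1 - u / 4) * norm r + \<tau> * norm (\<Psi> 0)" if "r \<in> C" for r
    using contr[OF that C0] norm_triangle_ineq[of "\<Phi> r - \<Phi> 0" "\<Phi> 0"] \<Phi>0 by simp
  have \<Phi>C: "\<Phi> r \<in> C" if r: "r \<in> C" for r
  proof -
    have "\<tau> * norm (\<Psi> 0) \<le> \<tau> * (c * \<rho> / 4)"
      using \<tau> \<Psi>0 by (intro mult_left_mono) auto
    also have "\<dots> = u / 4 * \<rho>" by (simp add: u_def)
    finally have "norm (\<Phi> r) \<le> (1 - u / 4) * norm r + u / 4 * \<rho>" using \<Phi>b[OF r] by linarith
    also have "(1 - u / 4) * norm r \<le> (1 - u / 4) * \<rho>"
      using r u1 by (intro mult_left_mono) (auto simp: C_def)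
    finally have "norm (\<Phi> r) \<le> \<rho>" by (simp add: algebra_simps)
    moreover have "\<Phi> r \<in> L"
      unfolding \<Phi>_def using r L \<Psi>L by (intro subspace_diff subspace_scale) (auto simp: C_def)
    ultimately show ?thesis by (simp add: C_def)
  qed
  have "complete C" unfolding C_def using L by (simp add: complete_eq_closed closed_Int)
  then have "\<exists>!x\<in>C. \<Phi> x = x"
    by (rule Banach_fix[where c="1 - u / 4"]) (use C0 \<Phi>C contr u0 u1 in \<open>auto simp: dist_norm\<close>)
  then obtain r where r: "r \<in> C" "\<Phi> r = r" by blast
  have "\<Psi> r = 0" using r(2) \<tau> by (simp add: \<Phi>_def)
  moreover have "norm r \<le> 4 / c * norm (\<Psi> 0)"
  proof -
    have "norm r \<le> (1 - u / 4) * norm r + \<tau> * norm (\<Psi> 0)" using \<Phi>b[OF r(1)] r(2) by simp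
    then have "\<tau> * (c / 4 * norm r) \<le> \<tau> * norm (\<Psi> 0)" by (simp add: u_def algebra_simps)
    then have "c / 4 * norm r \<le> norm (\<Psi> 0)" using \<tau> by simp
    then show ?thesis using c by (simp add: field_simps)
  qed
  ultimately show ?thesis using r(1) by (auto simp: C_def)
qed

section \<open>Finite codimensionality of symmetric convex sets\<close>

text \<open>Since 0 belongs to \<open>D\<close>, the base point \<open>x0\<close> lies in
  \<open>L\<close> and drops out of the description. If \<open>p\<close> is a relative interior
  point of the translate, then for small l the points p + x0 + l and -(p + x0 - l) belong to the
  closure of \<open>D\<close>, by symmetry, and their midpoint is l. This moves the interior point
  to the origin.\<close>

lemma finite_codimensional_symmetric:
  fixes D :: "'x::real_normed_vector set"
  assumes D: "finite_codimensional D" and conv: "convex D" and sym: "\<And>d. d \<in> D \<Longrightarrow>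
      - d \<in> D" and zero: "0 \<in> D"
  obtains L e B where "subspace L" "closed L" "D \<subseteq> L" "e > 0" "\<And>l. l \<in> L \<Longrightarrow>
      norm l < e \<Longrightarrow> l \<in> closure D"
    "finite B" "\<And>w. \<exists>a\<in>L. \<exists>b\<in>span B. w = a + b"
proof -
  have hD: "convex hull D = D" using conv by (rule convex_hull_eq[THEN iffD2])
  obtain x0 where x0: "x0 \<in> closure D"
    and fc: "finite_codim_subspace (closure (span ((\<lambda>x. x - x0) ` D)))"
    and int: "(top_of_set (closure (span ((\<lambda>x. x - x0) ` D)))) interior_of
        (closure (convex hull ((\<lambda>x. x - x0) ` D))) \<noteq> {}"
    using D unfolding finite_codimensional_def Let_def hD by blast
  define L where "L = closure (span ((\<lambda>x. x - x0) ` D))"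
  have L: "subspace L" "closed L" using fc unfolding L_def finite_codim_subspace_def by auto
  have inE: "d - x0 \<in> L" if "d \<in> D" for d
    unfolding L_def using that by (intro subsetD[OF closure_subset] span_base) auto
  have "- x0 \<in> L" using inE[OF zero] by simp
  then have x0L: "x0 \<in> L" using subspace_neg[OF L(1)] by fastforce
  have DL: "D \<subseteq> L"
  proof
    fix d assume "d \<in> D"
    then have "(d - x0) + x0 \<in> L" using L(1) inE x0L by (intro subspace_add)
    then show "d \<in> L" by simp
  qed
  have hE: "closure (convex hull ((\<lambda>x. x - x0) ` D)) = (\<lambda>x. x - x0) ` closure D"
  proof -
    have "convex ((\<lambda>x. x - x0) ` D)" using convex_translation_subtract[OF conv, of x0] .
    then have "convex hull ((\<lambda>x. x - x0) ` D) = (\<lambda>x. x - x0) ` D"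
      by (rule convex_hull_eq[THEN iffD2])
    moreover have "closure ((\<lambda>x. x - x0) ` D) = (\<lambda>x. x - x0) ` closure D"
      using closure_translation[of "- x0" D] by simp
    ultimately show ?thesis by simp
  qed
  obtain p U where U: "openin (top_of_set L) U" "p \<in> U" "U \<subseteq> (\<lambda>x. x - x0) ` closure D"
    using int unfolding hE L_def[symmetric] interior_of_def by blast
  then obtain V where V: "open V" "U = L \<inter> V" by (auto simp: openin_open)
  then obtain e where e: "e > 0" "ball p e \<subseteq> V" using U(2) unfolding open_contains_ball by blast
  have pL: "p \<in> L" using U(2) V by auto
  have near: "p + x0 + l \<in> closure D" if "l \<in> L" "norm l < e" for l
  proof -
    have "p + l \<in> U" using that pL L(1) e by (auto simp: V(2) subspace_add dist_norm)
    then show ?thesis using U(3) by (auto simp: algebra_simps)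
  qed
  have csym: "- d \<in> closure D" if "d \<in> closure D" for d
  proof -
    have "uminus ` closure D \<subseteq> closure D"
      using sym closure_subset[of D] by (intro image_closure_subset continuous_intros) auto
    then show ?thesis using that by blast
  qed
  have ball: "l \<in> closure D" if l: "l \<in> L" "norm l < e" for l
  proof -
    have "p + x0 + l \<in> closure D" by (rule near[OF l])
    moreover have "- (p + x0 + (- l)) \<in> closure D"
      using l L(1) by (intro csym near) (auto simp: subspace_neg)
    ultimately have "(1/2) *\<^sub>R (p + x0 + l) + (1/2) *\<^sub>R (- (p + x0 + (- l))) \<in> closure D"
      using convex_closure[OF conv] by (intro convexD) auto
    moreover have "(1/2) *\<^sub>R (p + x0 + l) + (1/2) *\<^sub>R (- (p + x0 + (- l))) = l"
    proof -
      have "(1/2) *\<^sub>R (p + x0 + l) + (1/2) *\<^sub>R (- (p + x0 + (- l))) = (1/2) *\<^sub>R (l + l)"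
        unfolding scaleR_add_right[symmetric] by simp
      then show ?thesis by (simp add: scaleR_2[symmetric])
    qed
    ultimately show ?thesis by simp
  qed
  obtain B where B: "finite B" "{a + b |a b. a \<in> closure L \<and> b \<in> span B} = UNIV"
    using fc unfolding finite_codim_subspace_def L_def[symmetric] by blast
  have "\<exists>a\<in>L. \<exists>b\<in>span B. w = a + b" for w
  proof -
    have "w \<in> {a + b |a b. a \<in> closure L \<and> b \<in> span B}" unfolding B(2) by simp
    then show ?thesis using closure_closed[OF L(2)] by auto
  qed
  then show thesis using that[OF L DL e(1) ball B(1)] by blast
qed

text \<open>The components of the vectors of \<open>B\<close> orthogonal to \<open>L\<close> span
  the orthogonal complement of \<open>L\<close>, so finitely many scalar tests decide membership in
  \<open>L\<close>.\<close>

lemma finite_codim_annihilators: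
  fixes L :: "'x::{real_inner, banach} set"
  assumes L: "subspace L" "closed L" and B: "finite B" "\<And>w. \<exists>a\<in>L. \<exists>b\<in>span B. w = a + b"
  obtains Z where "finite Z" "\<And>z l. z \<in> Z \<Longrightarrow> l \<in> L \<Longrightarrow>
      z \<bullet> l = 0" "\<And>w. (\<And>z. z \<in> Z \<Longrightarrow> z \<bullet> w = 0) \<Longrightarrow> w \<in> L"
proof -
  have "\<forall>x. \<exists>p. p \<in> L \<and> (\<forall>w\<in>L. (x - p) \<bullet> w = 0)"
    using orthogonal_projection_exists[OF L] by blast
  then obtain P where P: "\<And>x. P x \<in> L" "\<And>x w. w \<in> L \<Longrightarrow> (x - P x) \<bullet> w = 0"
    unfolding choice_iff by blast
  define Z where "Z = (\<lambda>b. b - P b) ` B"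
  have Zspan: "\<exists>n\<in>span Z. b - n \<in> L" if "b \<in> span B" for b
    using that
  proof (induction rule: span_induct_alt)
    case base
    then show ?case using subspace_0[OF L(1)] span_zero by force
  next
    case (step c x y)
    then obtain n where n: "n \<in> span Z" "y - n \<in> L" by blast
    have "c *\<^sub>R (x - P x) + n \<in> span Z"
      using n step(1) by (intro span_add span_scale) (auto simp: Z_def span_base)
    moreover have "c *\<^sub>R P x + (y - n) \<in> L" using L(1) P(1) n by (intro subspace_add subspace_scale)
    then have "(c *\<^sub>R x + y) - (c *\<^sub>R (x - P x) + n) \<in> L" by (simp add: algebra_simps)
    ultimately show ?case by blast
  qed
  have "w \<in> L" if w: "\<And>z. z \<in> Z \<Longrightarrow> z \<bullet> w = 0" for w
  proof -
    obtain a b where ab: "a \<in> L" "b \<in> span B" "w = a + b" using B(2) by blast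
    obtain n where n: "n \<in> span Z" "b - n \<in> L" using Zspan[OF ab(2)] by blast
    have wn: "w - n \<in> L" using subspace_add[OF L(1) ab(1) n(2)] ab(3) by (simp add: algebra_simps)
    have orth: "n \<bullet> v = 0" if v: "\<And>z. z \<in> Z \<Longrightarrow> z \<bullet> v = 0" for v
      using n(1)
    proof (induction rule: span_induct_alt)
      case (step c x y)
      then show ?case using v by (simp add: inner_add_left)
    qed simp
    have "n \<bullet> w = 0" using w by (rule orth)
    moreover have "n \<bullet> (w - n) = 0"
      by (rule orth) (use P(2)[OF wn] in \<open>auto simp: Z_def\<close>)
    ultimately have "n \<bullet> n = 0" by (simp add: inner_diff_right)
    then show ?thesis using wn by simp
  qed
  moreover have "finite Z" using B(1) by (simp add: Z_def)
  moreover have "z \<bullet> l = 0" if "z \<in> Z" "l \<in> L" for z l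
    using that P(2) by (auto simp: Z_def)
  ultimately show thesis by (rule that[rotated 2])
qed

section \<open>From Lipschitz derivatives to quadratic remainders\<close>

text \<open>The segment from b to a is cut into n equal pieces no longer than delta; the increments
  add up with the same constant. This removes the restriction to nearby states from the Lipschitz
  hypotheses on the derivatives.\<close>

lemma Lipschitz_local_to_global:
  fixes f :: "'a::real_normed_vector \<Rightarrow> 'b::real_normed_vector"
  assumes \<delta>: "\<delta> > 0" and loc: "\<And>a b. norm (a - b) \<le> \<delta> \<Longrightarrow>
      norm (f a - f b) \<le> C * norm (a - b)"
  shows "norm (f a - f b) \<le> C * norm (a - b)"
proof -
  obtain n where n: "norm (a - b) < real n * \<delta>" using reals_Archimedean3[OF \<delta>] by blast
  have n0: "n > 0"
  proof (rule ccontr)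
    assume "\<not> n > 0"
    then show False using n norm_ge_zero[of "a - b"] by simp
  qed
  define c where "c k = b + (real k / real n) *\<^sub>R (a - b)" for k
  have st: "c (Suc k) - c k = (1 / real n) *\<^sub>R (a - b)" for k
    unfolding c_def add_diff_cancel_left scaleR_diff_left[symmetric]
      by (simp add: diff_divide_distrib[symmetric])
  have small: "norm (c (Suc k) - c k) \<le> \<delta>" for k
    unfolding st norm_scaleR using n n0 by (simp add: field_simps less_imp_le)
  have "norm (f (c k) - f b) \<le> real k * (C * (norm (a - b) / real n))" for k
  proof (induction k)
    case 0
    then show ?case by (simp add: c_def)
  next
    case (Suc k)
    have "norm (f (c (Suc k)) - f (c k)) \<le> C * (norm (a - b) / real n)"
      using loc[OF small[of k]] n0 by (simp add: st)
    moreover have "norm (f (c (Suc k)) - f b) \<le> norm (f (c (Suc k)) - f (c k)) + norm (f (c k) - f b)"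
      using norm_triangle_ineq[of "f (c (Suc k)) - f (c k)" "f (c k) - f b"] by simp
    moreover have "real (Suc k) * (C * (norm (a - b) / real n))
      = C * (norm (a - b) / real n) + real k * (C * (norm (a - b) / real n))"
      by (simp only: of_nat_Suc distrib_right mult_1)
    ultimately show ?case using Suc by linarith
  qed
  from this[of n] show ?thesis using n0 by (simp add: c_def)
qed

text \<open>The mean value inequality is applied to f minus the linear map \<open>A\<close>. With
  \<open>A\<close> a derivative at a third point it measures strict differentiability, with
  \<open>A = 0\<close> plain Lipschitz continuity.\<close>

lemma linearization_error:
  fixes f :: "'a::real_normed_vector \<Rightarrow> 'b::real_normed_vector"
  assumes der: "\<And>x. (f has_derivative blinfun_apply (f' x)) (at x)"
    and le: "\<And>x. x \<in> closed_segment a b \<Longrightarrow> norm (f' x - A) \<le> B"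
  shows "norm (f a - f b - A (a - b)) \<le> B * norm (a - b)"
proof -
  have "norm ((f a - A a) - (f b - A b)) \<le> B * norm (a - b)"
  proof (rule differentiable_bound[where S="closed_segment a b" and f'="\<lambda>x. blinfun_apply (f' x - A)"])
    show "((\<lambda>x. f x - A x) has_derivative blinfun_apply (f' x - A)) (at x within closed_segment a b)" for x
      unfolding blinfun.diff_left
      by (intro has_derivative_diff has_derivative_at_withinI[OF der] bounded_linear_imp_has_derivative
          blinfun.bounded_linear_right)
    show "onorm (blinfun_apply (f' x - A)) \<le> B" if "x \<in> closed_segment a b" for x
      using le[OF that] by (simp add: norm_blinfun.rep_eq)
  qed auto
  then show ?thesis by (simp add: blinfun.diff_right algebra_simps)
qed

lemma norm_in_segment_le:
  fixes a b :: "'a::real_normed_vector"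
  assumes "x \<in> closed_segment a b"
  shows "norm (x - c) \<le> norm (a - c) + norm (b - c)"
proof -
  have "norm (x - c) \<le> max (norm (a - c)) (norm (b - c))"
  proof -
    have "closed_segment a b \<subseteq> cball c (max (norm (a - c)) (norm (b - c)))"
      by (intro closed_segment_subset convex_cball) (auto simp: dist_norm norm_minus_commute)
    then show ?thesis using assms by (auto simp: dist_norm norm_minus_commute)
  qed
  also have "\<dots> \<le> norm (a - c) + norm (b - c)" by simp
  finally show ?thesis .
qed

text \<open>Stated for values in an arbitrary normed space, so that the remainder and measurability
  results serve both the dynamics \<open>F\<close> and the real-valued cost density
  \<open>g0\<close>.\<close>

locale C11_family =
  fixes T M :: real and f :: "real \<Rightarrow> 'x::real_normed_vector \<Rightarrow> 'v::real_normed_vector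
      \<Rightarrow> 'c::real_normed_vector"
    and fy :: "real \<Rightarrow> 'x \<Rightarrow> 'v \<Rightarrow> ('x \<Rightarrow>\<^sub>L 'c)" and fu ::
        "real \<Rightarrow> 'x \<Rightarrow> 'v \<Rightarrow> ('v \<Rightarrow>\<^sub>L 'c)"
  assumes M_pos: "M > 0"
    and f_meas: "\<And>y u. strongly_measurable (lebesgue_on {0..T}) (\<lambda>t. f t y u)"
    and fy_deriv: "\<And>t y u. t \<in> {0..T} \<Longrightarrow>
        ((\<lambda>y'. f t y' u) has_derivative blinfun_apply (fy t y u)) (at y)"
    and fu_deriv: "\<And>t y u. t \<in> {0..T} \<Longrightarrow>
        ((\<lambda>u'. f t y u') has_derivative blinfun_apply (fu t y u)) (at u)"
    and fy_lip: "\<And>t y u y' u'. t \<in> {0..T} \<Longrightarrow>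
        norm (fy t y u - fy t y' u') \<le> M * (norm (y - y') + norm (u - u'))"
    and fu_lip: "\<And>t y u y' u'. t \<in> {0..T} \<Longrightarrow>
        norm (fu t y u - fu t y' u') \<le> M * (norm (y - y') + norm (u - u'))"
    and partials_meas: "partials_strongly_measurable T fy fu"
begin

text \<open>The difference is split at the intermediate point (y2,u1) and both legs are linearized
  at the common base point (y0,u0). The base point may differ from both arguments; this makes the
  error small relative to the increment, as strict differentiability requires.\<close>

lemma remainder:
  assumes t: "t \<in> {0..T}"
  shows "norm (f t y1 u1 - f t y2 u2 - fy t y0 u0 (y1 - y2) - fu t y0 u0 (u1 - u2))
    \<le> M * (norm (y1 - y0) + norm (y2 - y0) + norm (u1 - u0) + norm (u2 - u0)) * (norm (y1 - y2) + norm (u1 - u2))"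
    (is "_ \<le> M * ?R * _")
proof -
  have "norm (f t y1 u1 - f t y2 u1 - fy t y0 u0 (y1 - y2)) \<le> M * ?R * norm (y1 - y2)"
  proof (rule linearization_error[OF fy_deriv[OF t]])
    fix x assume "x \<in> closed_segment y1 y2"
    then have "norm (x - y0) \<le> norm (y1 - y0) + norm (y2 - y0)" by (rule norm_in_segment_le)
    then have "norm (x - y0) + norm (u1 - u0) \<le> ?R" using norm_ge_zero[of "u2 - u0"] by linarith
    then have "M * (norm (x - y0) + norm (u1 - u0)) \<le> M * ?R" using M_pos by simp
    then show "norm (fy t x u1 - fy t y0 u0) \<le> M * ?R" using fy_lip[OF t, of x u1 y0 u0] by linarith
  qed
  moreover have "norm (f t y2 u1 - f t y2 u2 - fu t y0 u0 (u1 - u2)) \<le> M * ?R * norm (u1 - u2)"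
  proof (rule linearization_error[OF fu_deriv[OF t]])
    fix x assume "x \<in> closed_segment u1 u2"
    then have "norm (x - u0) \<le> norm (u1 - u0) + norm (u2 - u0)" by (rule norm_in_segment_le)
    then have "norm (y2 - y0) + norm (x - u0) \<le> ?R" using norm_ge_zero[of "y1 - y0"] by linarith
    then have "M * (norm (y2 - y0) + norm (x - u0)) \<le> M * ?R" using M_pos by simp
    then show "norm (fu t y2 x - fu t y0 u0) \<le> M * ?R" using fu_lip[OF t, of y2 x y0 u0] by linarith
  qed
  moreover have "f t y1 u1 - f t y2 u2 - fy t y0 u0 (y1 - y2) - fu t y0 u0 (u1 - u2)
    = (f t y1 u1 - f t y2 u1 - fy t y0 u0 (y1 - y2)) + (f t y2 u1 - f t y2 u2 - fu t y0 u0 (u1 - u2))"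
    by simp
  ultimately show ?thesis
    by (simp only: distrib_left) (rule norm_triangle_mono)
qed

lemma f_continuous:
  assumes t: "t \<in> {0..T}"
  shows "continuous_on UNIV (\<lambda>p. f t (fst p) (snd p))"
proof (rule continuous_on_sequentiallyI)
  fix p :: "nat \<Rightarrow> 'x \<times> 'v" and q assume p: "p \<longlonglongrightarrow> q"
  define e where "e n = norm (fst (p n) - fst q) + norm (snd (p n) - snd q)" for n
  have "e \<longlonglongrightarrow> norm (fst q - fst q) + norm (snd q - snd q)"
    unfolding e_def by (intro tendsto_intros p)
  then have e: "e \<longlonglongrightarrow> 0" by simp
  have bnd: "norm (f t (fst (p n)) (snd (p n)) - f t (fst q) (snd q))
      \<le> M * e n * e n + (norm (fy t (fst q) (snd q)) + norm (fu t (fst q) (snd q))) * e n" for n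
  proof -
    let ?a = "f t (fst (p n)) (snd (p n)) - f t (fst q) (snd q)"
      and ?b = "fy t (fst q) (snd q) (fst (p n) - fst q)" and ?c = "fu t (fst q) (snd q) (snd (p n) - snd q)"
    have "norm (?a - ?b - ?c) \<le> M * e n * e n"
      using remainder[OF t, of "fst (p n)" "snd (p n)" "fst q" "snd q" "fst q" "snd q"] by (simp add: e_def)
    moreover have "norm ?a \<le> norm (?a - ?b - ?c) + norm ?b + norm ?c"
      using norm_triangle_ineq[of "?a - ?b - ?c" "?b + ?c"] norm_triangle_ineq[of ?b ?c] by simp
    moreover have "norm ?b \<le> norm (fy t (fst q) (snd q)) * e n"
      by (rule order_trans[OF norm_blinfun mult_left_mono]) (auto simp: e_def)
    moreover have "norm ?c \<le> norm (fu t (fst q) (snd q)) * e n"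
      by (rule order_trans[OF norm_blinfun mult_left_mono]) (auto simp: e_def)
    ultimately show ?thesis unfolding distrib_right by linarith
  qed
  have "(\<lambda>n. M * e n * e n + (norm (fy t (fst q) (snd q)) + norm (fu t (fst q) (snd q))) * e n)
    \<longlonglongrightarrow> M * 0 * 0 + (norm (fy t (fst q) (snd q)) + norm (fu t (fst q) (snd q))) * 0"
    by (intro tendsto_intros e)
  then have lim0: "(\<lambda>n. M * e n * e n + (norm (fy t (fst q) (snd q))
      + norm (fu t (fst q) (snd q))) * e n) \<longlonglongrightarrow> 0"
    by simp
  have "(\<lambda>n. f t (fst (p n)) (snd (p n)) - f t (fst q) (snd q)) \<longlonglongrightarrow> 0"
    by (rule Lim_null_comparison[OF always_eventually[OF allI[OF bnd]] lim0])
  then show "(\<lambda>n. f t (fst (p n)) (snd (p n))) \<longlonglongrightarrow> f t (fst q) (snd q)"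
    by (rule LIM_zero_cancel)
qed

lemma partial_continuous:
  assumes t: "t \<in> {0..T}"
  shows "continuous_on UNIV (\<lambda>p. fy t (fst p) (snd p))" and "continuous_on UNIV (\<lambda>p. fu t (fst p) (snd p))"
proof -
  have b: "M * (norm (fst p - fst q) + norm (snd p - snd q)) \<le> (2 * M) * norm (p - q)" for p q :: "'x \<times> 'v"
  proof -
    have "norm (fst p - fst q) + norm (snd p - snd q) \<le> 2 * norm (p - q)"
    proof -
      have "p - q = (fst p - fst q, snd p - snd q)" by (simp add: prod_eq_iff)
      then show ?thesis
        using norm_fst_le[of "fst p - fst q" "snd p - snd q"] norm_snd_le[of "snd p - snd q" "fst p - fst q"]
        by simp
    qed
    then show ?thesis using M_pos by simp
  qed
  show "continuous_on UNIV (\<lambda>p. fy t (fst p) (snd p))"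
    by (rule Lipschitz_imp_continuous_on[where L="2 * M"], rule order_trans[OF fy_lip[OF t] b])
  show "continuous_on UNIV (\<lambda>p. fu t (fst p) (snd p))"
    by (rule Lipschitz_imp_continuous_on[where L="2 * M"], rule order_trans[OF fu_lip[OF t] b])
qed

lemma f_strongly_measurable:
  assumes "strongly_measurable (lebesgue_on {0..T}) y" "strongly_measurable (lebesgue_on {0..T}) u"
  shows "strongly_measurable (lebesgue_on {0..T}) (\<lambda>t. f t (y t) (u t))"
  using Icc.strongly_measurable_Caratheodory[where f="\<lambda>t p. f t (fst p) (snd p)",
    OF f_meas f_continuous Icc.strongly_measurable_Pair[OF assms]] by simp

text \<open>Directional derivatives are limits of difference quotients and inherit strong
  measurability from f. One quotient in the direction (x,w) treats both partial derivatives; setting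
  w or x to 0 separates them.\<close>

lemma partial_apply_strongly_measurable:
  "strongly_measurable (lebesgue_on {0..T}) (\<lambda>t. fy t y u x)" (is ?A)
  "strongly_measurable (lebesgue_on {0..T}) (\<lambda>t. fu t y u w)" (is ?B)
proof -
  have lim: "(\<lambda>n. real (Suc n) *\<^sub>R (f t (y + inverse (real (Suc n)) *\<^sub>R x) (u
      + inverse (real (Suc n)) *\<^sub>R w) - f t y u))
    \<longlonglongrightarrow> fy t y u x + fu t y u w" if t: "t \<in> {0..T}" for t x w
  proof -
    define h where "h n = inverse (real (Suc n))" for n
    have h: "h n > 0" "real (Suc n) = inverse (h n)" for n by (simp_all add: h_def)
    have h0: "h \<longlonglongrightarrow> 0" unfolding h_def by (rule LIMSEQ_inverse_real_of_nat)
    define C where "C = M * (norm x + norm w) * (norm x + norm w)"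
    have bnd: "norm (inverse (h n) *\<^sub>R (f t (y + h n *\<^sub>R x) (u + h n *\<^sub>R w) - f t y u)
        - (fy t y u x + fu t y u w)) \<le> C * h n" for n
    proof -
      let ?d = "f t (y + h n *\<^sub>R x) (u + h n *\<^sub>R w) - f t y u - h n *\<^sub>R fy t y u x
          - h n *\<^sub>R fu t y u w"
      have "norm ?d \<le> M * (norm (h n *\<^sub>R x) + norm (h n *\<^sub>R w)) * (norm (h n *\<^sub>R x)
          + norm (h n *\<^sub>R w))"
        using remainder[OF t, of "y + h n *\<^sub>R x" "u + h n *\<^sub>R w" y u y u]
          by (simp add: blinfun.scaleR_right)
      also have "\<dots> = C * (h n)\<^sup>2"
        using h(1)[of n] by (simp add: C_def power2_eq_square algebra_simps)
      finally have "inverse (h n) * norm ?d \<le> inverse (h n) * (C * (h n)\<^sup>2)"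
        using h(1)[of n] by (intro mult_left_mono) auto
      also have "\<dots> = C * h n" using h(1)[of n] by (simp add: power2_eq_square)
      finally have "norm (inverse (h n) *\<^sub>R ?d) \<le> C * h n" using h(1)[of n] by simp
      moreover have "inverse (h n) *\<^sub>R ?d = inverse (h n) *\<^sub>R (f t (y + h n *\<^sub>R x) (u
          + h n *\<^sub>R w) - f t y u) - (fy t y u x + fu t y u w)"
        using h(1)[of n] by (simp add: scaleR_diff_right)
      ultimately show ?thesis by simp
    qed
    have lim0: "(\<lambda>n. C * h n) \<longlonglongrightarrow> 0"
      using tendsto_mult[OF tendsto_const h0, of C] by simp
    have "(\<lambda>n. inverse (h n) *\<^sub>R (f t (y + h n *\<^sub>R x) (u + h n *\<^sub>R w) - f t y u)
        - (fy t y u x + fu t y u w)) \<longlonglongrightarrow> 0"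
      by (rule Lim_null_comparison[OF always_eventually[OF allI[OF bnd]] lim0])
    then show ?thesis unfolding h(2) inverse_inverse_eq by (rule LIM_zero_cancel)
  qed
  have *: "strongly_measurable (lebesgue_on {0..T}) (\<lambda>t. fy t y u x + fu t y u w)" for x w
  proof (rule Icc.strongly_measurable_AE_limit[where f="\<lambda>n t. real (Suc n) *\<^sub>R (f t (y
      + inverse (real (Suc n)) *\<^sub>R x) (u + inverse (real (Suc n)) *\<^sub>R w) - f t y u)"])
    show "strongly_measurable (lebesgue_on {0..T})
      (\<lambda>t. real (Suc n) *\<^sub>R (f t (y + inverse (real (Suc n)) *\<^sub>R x) (u
          + inverse (real (Suc n)) *\<^sub>R w) - f t y u))" for n
      by (intro Icc.strongly_measurable_scaleR Icc.strongly_measurable_const Icc.strongly_measurable_diff f_meas)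
    show "AE t in lebesgue_on {0..T}. (\<lambda>n. real (Suc n) *\<^sub>R (f t (y
        + inverse (real (Suc n)) *\<^sub>R x) (u + inverse (real (Suc n)) *\<^sub>R w) - f t y u))
      \<longlonglongrightarrow> fy t y u x + fu t y u w"
      by (intro AE_I2 lim) simp
  qed
  show ?A using *[of x 0] by simp
  show ?B using *[of 0 w] by simp
qed

lemma fy_apply_strongly_measurable:
  assumes "strongly_measurable (lebesgue_on {0..T}) y" "strongly_measurable (lebesgue_on {0..T}) u"
    "strongly_measurable (lebesgue_on {0..T}) x"
  shows "strongly_measurable (lebesgue_on {0..T}) (\<lambda>t. fy t (y t) (u t) (x t))"
proof -
  have c: "continuous_on UNIV (\<lambda>p. fy t (fst (fst p)) (snd (fst p)) (snd p))"
    if "t \<in> {0..T}" for t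
    using continuous_on_compose2[OF partial_continuous(1)[OF that] continuous_on_fst[OF continuous_on_id], of UNIV]
    by (intro continuous_intros) auto
  show ?thesis
    using Icc.strongly_measurable_Caratheodory[where f="\<lambda>t p. fy t (fst (fst p)) (snd (fst p)) (snd p)",
      OF partial_apply_strongly_measurable(1) c Icc.strongly_measurable_Pair[OF Icc.strongly_measurable_Pair[OF
          assms(1,2)] assms(3)]]
    by simp
qed

lemma fu_apply_strongly_measurable:
  assumes "strongly_measurable (lebesgue_on {0..T}) y" "strongly_measurable (lebesgue_on {0..T}) u"
    "strongly_measurable (lebesgue_on {0..T}) w"
  shows "strongly_measurable (lebesgue_on {0..T}) (\<lambda>t. fu t (y t) (u t) (w t))"
proof -
  have c: "continuous_on UNIV (\<lambda>p. fu t (fst (fst p)) (snd (fst p)) (snd p))"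
    if "t \<in> {0..T}" for t
    using continuous_on_compose2[OF partial_continuous(2)[OF that] continuous_on_fst[OF continuous_on_id], of UNIV]
    by (intro continuous_intros) auto
  show ?thesis
    using Icc.strongly_measurable_Caratheodory[where f="\<lambda>t p. fu t (fst (fst p)) (snd (fst p)) (snd p)",
      OF partial_apply_strongly_measurable(2) c Icc.strongly_measurable_Pair[OF Icc.strongly_measurable_Pair[OF
          assms(1,2)] assms(3)]]
    by simp
qed

lemma dual_fy_strongly_measurable:
  assumes "strongly_measurable (lebesgue_on {0..T}) y" "strongly_measurable (lebesgue_on {0..T}) u"
    "strongly_measurable (lebesgue_on {0..T}) \<phi>"
  shows "strongly_measurable (lebesgue_on {0..T}) (\<lambda>t. dual_op (fy t (y t) (u t)) (\<phi> t))"
proof -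
  have c: "continuous_on UNIV (\<lambda>p. dual_op (fy t (fst (fst p)) (snd (fst p))) (snd p))"
    if "t \<in> {0..T}" for t
    unfolding dual_op_def
    by (intro bounded_bilinear.continuous_on[OF bounded_bilinear_blinfun_compose] continuous_on_snd continuous_on_id
      continuous_on_compose2[OF partial_continuous(1)[OF that] continuous_on_fst[OF continuous_on_id]]) auto
  have m: "strongly_measurable (lebesgue_on {0..T}) (\<lambda>t. dual_op (fy t (fst (fst p)) (snd (fst p))) (snd p))" for p
    using partials_meas by (simp add: partials_strongly_measurable_def)
  show ?thesis
    using Icc.strongly_measurable_Caratheodory[OF m c Icc.strongly_measurable_Pair[OF
        Icc.strongly_measurable_Pair[OF assms(1,2)] assms(3)]]
    by simp
qed

lemma dual_fu_strongly_measurable: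
  assumes "strongly_measurable (lebesgue_on {0..T}) y" "strongly_measurable (lebesgue_on {0..T}) u"
    "strongly_measurable (lebesgue_on {0..T}) \<phi>"
  shows "strongly_measurable (lebesgue_on {0..T}) (\<lambda>t. dual_op (fu t (y t) (u t)) (\<phi> t))"
proof -
  have c: "continuous_on UNIV (\<lambda>p. dual_op (fu t (fst (fst p)) (snd (fst p))) (snd p))"
    if "t \<in> {0..T}" for t
    unfolding dual_op_def
    by (intro bounded_bilinear.continuous_on[OF bounded_bilinear_blinfun_compose] continuous_on_snd continuous_on_id
      continuous_on_compose2[OF partial_continuous(2)[OF that] continuous_on_fst[OF continuous_on_id]]) auto
  have m: "strongly_measurable (lebesgue_on {0..T}) (\<lambda>t. dual_op (fu t (fst (fst p)) (snd (fst p))) (snd p))" for p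
    using partials_meas by (simp add: partials_strongly_measurable_def)
  show ?thesis
    using Icc.strongly_measurable_Caratheodory[OF m c Icc.strongly_measurable_Pair[OF
        Icc.strongly_measurable_Pair[OF assms(1,2)] assms(3)]]
    by simp
qed

end

section \<open>The control problem\<close>

lemma L2_spaceD:
  assumes "u \<in> L2_space T"
  shows "strongly_measurable (lebesgue_on {0..T}) u" "integrable (lebesgue_on {0..T}) (\<lambda>t. (norm (u t))\<^sup>2)"
    "(\<lambda>t. norm (u t)) \<in> borel_measurable (lebesgue_on {0..T})"
  using assms by (auto simp: L2_space_def intro: Icc.strongly_measurable_norm)

lemma L2_norm_nonneg: "L2_norm T u \<ge> 0"
  by (simp add: L2_norm_def)

lemma L2_norm_power2: "(L2_norm T u)\<^sup>2 = (\<integral>t. (norm (u t))\<^sup>2 \<partial>lebesgue_on {0..T})"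
  by (simp add: L2_norm_def)

lemma L2_space_dominated:
  fixes f :: "real \<Rightarrow> 'a::real_normed_vector"
  assumes f: "strongly_measurable (lebesgue_on {0..T}) f" and g: "g \<in> L2_space T"
    and le: "\<And>t. t \<in> {0..T} \<Longrightarrow> norm (f t) \<le> C * norm (g t)"
  shows "f \<in> L2_space T"
proof -
  have "integrable (lebesgue_on {0..T}) (\<lambda>t. (norm (f t))\<^sup>2)"
  proof (rule Bochner_Integration.integrable_bound)
    show "integrable (lebesgue_on {0..T}) (\<lambda>t. C\<^sup>2 * (norm (g t))\<^sup>2)"
      using L2_spaceD(2)[OF g] by simp
    show "(\<lambda>t. (norm (f t))\<^sup>2) \<in> borel_measurable (lebesgue_on {0..T})"
      by (intro borel_measurable_power Icc.strongly_measurable_norm f)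
    show "AE t in lebesgue_on {0..T}. norm ((norm (f t))\<^sup>2) \<le> norm (C\<^sup>2 * (norm (g t))\<^sup>2)"
    proof (rule AE_I2)
      fix t assume "t \<in> space (lebesgue_on {0..T})"
      then have "(norm (f t))\<^sup>2 \<le> (C * norm (g t))\<^sup>2" using le by (intro power_mono) auto
      then show "norm ((norm (f t))\<^sup>2) \<le> norm (C\<^sup>2 * (norm (g t))\<^sup>2)"
        by (simp add: power_mult_distrib)
    qed
  qed
  then show ?thesis using f by (simp add: L2_space_def)
qed

lemma L2_norm_fun: "u \<in> L2_space T \<Longrightarrow>
    (\<lambda>t. norm (u t)) \<in> L2_space T" "L2_norm T (\<lambda>t. norm (u t)) = L2_norm T u"
  using Icc.strongly_measurable_compose[OF _ continuous_on_norm[OF continuous_on_id], of 0 T u]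
  by (simp_all add: L2_space_def L2_norm_def)

lemma L2_space_scaleR:
  assumes u: "u \<in> L2_space T"
  shows "(\<lambda>t. a *\<^sub>R u t) \<in> L2_space T" "L2_norm T (\<lambda>t. a *\<^sub>R u t)
      = \<bar>a\<bar> * L2_norm T u"
proof -
  show "(\<lambda>t. a *\<^sub>R u t) \<in> L2_space T"
    by (rule L2_space_dominated[OF _ u, where C="\<bar>a\<bar>"])
      (auto intro!: Icc.strongly_measurable_scaleR L2_spaceD(1)[OF u])
  show "L2_norm T (\<lambda>t. a *\<^sub>R u t) = \<bar>a\<bar> * L2_norm T u"
    by (simp add: L2_norm_def power_mult_distrib real_sqrt_mult)
qed

lemma L2_mult:
  fixes a b :: "real \<Rightarrow> real"
  assumes a: "a \<in> L2_space T" and b: "b \<in> L2_space T"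
  shows "integrable (lebesgue_on {0..T}) (\<lambda>t. a t * b t)"
    "\<bar>\<integral>t. a t * b t \<partial>lebesgue_on {0..T}\<bar> \<le> L2_norm T a * L2_norm T b"
  using Cauchy_Schwarz_integral[OF Icc.strongly_measurable_real[OF L2_spaceD(1)[OF a]]
      Icc.strongly_measurable_real[OF L2_spaceD(1)[OF b]]] L2_spaceD(2)[OF a] L2_spaceD(2)[OF b]
  by (simp_all add: L2_norm_def)

lemma L2_space_add:
  assumes u: "u \<in> L2_space T" and v: "v \<in> L2_space T"
  shows "(\<lambda>t. u t + v t) \<in> L2_space T" "L2_norm T (\<lambda>t. u t + v t) \<le> L2_norm T u + L2_norm T v"
proof -
  let ?M = "lebesgue_on {0..T}"
  have uv: "integrable ?M (\<lambda>t. norm (u t) * norm (v t))"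
    "(\<integral>t. norm (u t) * norm (v t) \<partial>?M) \<le> L2_norm T u * L2_norm T v"
    using L2_mult[OF L2_norm_fun(1)[OF u] L2_norm_fun(1)[OF v]] by (auto simp: L2_norm_fun(2))
  let ?b = "\<lambda>t. (norm (u t))\<^sup>2 + 2 * (norm (u t) * norm (v t)) + (norm (v t))\<^sup>2"
  have bi: "integrable ?M ?b" using uv(1) L2_spaceD(2)[OF u] L2_spaceD(2)[OF v] by simp
  have le: "(norm (u t + v t))\<^sup>2 \<le> ?b t" for t
  proof -
    have "(norm (u t + v t))\<^sup>2 \<le> (norm (u t) + norm (v t))\<^sup>2"
      by (intro power_mono norm_triangle_ineq) simp
    then show ?thesis by (simp add: power2_sum)
  qed
  have m: "strongly_measurable ?M (\<lambda>t. u t + v t)"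
    by (intro Icc.strongly_measurable_add L2_spaceD(1)[OF u] L2_spaceD(1)[OF v])
  have i: "integrable ?M (\<lambda>t. (norm (u t + v t))\<^sup>2)"
  proof (rule Bochner_Integration.integrable_bound[OF bi])
    show "(\<lambda>t. (norm (u t + v t))\<^sup>2) \<in> borel_measurable ?M"
      by (intro borel_measurable_power Icc.strongly_measurable_norm m)
    show "AE t in ?M. norm ((norm (u t + v t))\<^sup>2) \<le> norm (?b t)"
      using le by (intro AE_I2) (auto intro: order_trans[OF _ abs_ge_self])
  qed
  show "(\<lambda>t. u t + v t) \<in> L2_space T" using m i by (simp add: L2_space_def)
  have "(L2_norm T (\<lambda>t. u t + v t))\<^sup>2 \<le> (\<integral>t. ?b t \<partial>?M)"
    unfolding L2_norm_power2 using le by (intro integral_mono i bi)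
  also have "\<dots> = (L2_norm T u)\<^sup>2 + 2 * (\<integral>t. norm (u t) * norm (v t) \<partial>?M)
      + (L2_norm T v)\<^sup>2"
    using uv(1) L2_spaceD(2)[OF u] L2_spaceD(2)[OF v] by (simp add: L2_norm_power2)
  also have "\<dots> \<le> (L2_norm T u + L2_norm T v)\<^sup>2"
    using uv(2) by (simp add: power2_sum)
  finally show "L2_norm T (\<lambda>t. u t + v t) \<le> L2_norm T u + L2_norm T v"
    by (rule power2_le_imp_le) (simp add: L2_norm_nonneg)
qed

lemma L2_space_diff:
  assumes u: "u \<in> L2_space T" and v: "v \<in> L2_space T"
  shows "(\<lambda>t. u t - v t) \<in> L2_space T"
  using L2_space_add(1)[OF u L2_space_scaleR(1)[OF v, of "-1"]] by simp

lemma L2_space_continuous: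
  fixes y :: "real \<Rightarrow> 'a::real_normed_vector"
  assumes y: "continuous_on {0..T} y"
  shows "y \<in> L2_space T"
  unfolding L2_space_def using y
  by (auto intro!: continuous_on_strongly_measurable continuous_on_integrable_Icc continuous_intros)

lemma L2_norm_const: "T \<ge> 0 \<Longrightarrow> L2_norm T (\<lambda>_. c) = sqrt T * norm c"
  by (simp add: L2_norm_def real_sqrt_mult measure_restrict_space)

lemma L2_space_integrable:
  assumes u: "u \<in> L2_space T" and T: "T \<ge> 0"
  shows "integrable (lebesgue_on {0..T}) (\<lambda>t. norm (u t))"
    "(\<integral>t. norm (u t) \<partial>lebesgue_on {0..T}) \<le> sqrt T * L2_norm T u"
proof -
  have one: "(\<lambda>_. 1::real) \<in> L2_space T" by (rule L2_space_continuous) simp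
  show "integrable (lebesgue_on {0..T}) (\<lambda>t. norm (u t))"
    using L2_mult(1)[OF one L2_norm_fun(1)[OF u]] by simp
  show "(\<integral>t. norm (u t) \<partial>lebesgue_on {0..T}) \<le> sqrt T * L2_norm T u"
    using L2_mult(2)[OF one L2_norm_fun(1)[OF u]] by (simp add: L2_norm_fun(2) L2_norm_const[OF T])
qed

definition L2_inner :: "real \<Rightarrow> (real \<Rightarrow> 'v::real_inner) \<Rightarrow> (real
    \<Rightarrow> 'v) \<Rightarrow> real" where
  "L2_inner T u v = (\<integral>t. u t \<bullet> v t \<partial>lebesgue_on {0..T})"

lemma L2_inner_integrable:
  assumes u: "u \<in> L2_space T" and v: "v \<in> L2_space T"
  shows "integrable (lebesgue_on {0..T}) (\<lambda>t. u t \<bullet> v t)"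
    "\<bar>L2_inner T u v\<bar> \<le> L2_norm T u * L2_norm T v"
proof -
  let ?M = "lebesgue_on {0..T}"
  have uv: "integrable ?M (\<lambda>t. norm (u t) * norm (v t))"
    "\<bar>\<integral>t. norm (u t) * norm (v t) \<partial>?M\<bar> \<le> L2_norm T u * L2_norm T v"
    using L2_mult[OF L2_norm_fun(1)[OF u] L2_norm_fun(1)[OF v]] by (auto simp: L2_norm_fun(2))
  show i: "integrable ?M (\<lambda>t. u t \<bullet> v t)"
    by (rule Bochner_Integration.integrable_bound[OF uv(1)
        Icc.strongly_measurable_real[OF Icc.strongly_measurable_inner[OF L2_spaceD(1)[OF u] L2_spaceD(1)[OF v]]]])
      (auto intro!: AE_I2 simp: Cauchy_Schwarz_ineq2)
  have "\<bar>L2_inner T u v\<bar> \<le> (\<integral>t. \<bar>u t \<bullet> v t\<bar> \<partial>?M)"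
    unfolding L2_inner_def by (rule integral_abs_bound)
  also have "\<dots> \<le> (\<integral>t. norm (u t) * norm (v t) \<partial>?M)"
    using i
      by (intro integral_mono uv(1) Bochner_Integration.integrable_abs) (auto simp: Cauchy_Schwarz_ineq2)
  also have "\<dots> \<le> L2_norm T u * L2_norm T v" using uv(2) by linarith
  finally show "\<bar>L2_inner T u v\<bar> \<le> L2_norm T u * L2_norm T v" .
qed

lemma L2_inner_self: "L2_inner T u u = (L2_norm T u)\<^sup>2"
  by (simp add: L2_inner_def L2_norm_power2 power2_norm_eq_inner)

lemma L2_inner_diff_left:
  assumes "u \<in> L2_space T" "v \<in> L2_space T" "w \<in> L2_space T"
  shows "L2_inner T (\<lambda>t. u t - v t) w = L2_inner T u w - L2_inner T v w"
  unfolding L2_inner_def inner_diff_left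
  by (rule Bochner_Integration.integral_diff) (use assms L2_inner_integrable in blast)+

lemma L2_norm_eq_0_AE:
  assumes u: "u \<in> L2_space T" and "L2_norm T u = 0"
  shows "AE t in lebesgue_on {0..T}. u t = 0"
proof -
  have "(\<integral>t. (norm (u t))\<^sup>2 \<partial>lebesgue_on {0..T}) = 0"
    using assms(2) by (simp add: L2_norm_def)
  then have "AE t in lebesgue_on {0..T}. (norm (u t))\<^sup>2 = 0"
    using integral_nonneg_eq_0_iff_AE[OF L2_spaceD(2)[OF u]] by simp
  then show ?thesis by eventually_elim simp
qed

section \<open>Superposition of mild solutions\<close>

lemma mild_solution_cong:
  assumes "\<And>t. t \<in> {0..T} \<Longrightarrow> f t (x t) = g t (x t)"
  shows "mild_solution T S f x0 x \<longleftrightarrow> mild_solution T S g x0 x"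
proof -
  have "bochner_has_integral (lebesgue_on {0..t}) (\<lambda>s. S (t - s) (f s (x s))) z
      \<longleftrightarrow> bochner_has_integral (lebesgue_on {0..t}) (\<lambda>s. S (t
          - s) (g s (x s))) z" if "t \<in> {0..T}" for t z
    using that assms
    by (intro iffI) (erule Icc.bochner_has_integral_AE_cong, auto intro!: AE_I2)+
  then show ?thesis unfolding mild_solution_def by simp
qed

text \<open>Each right-hand side is frozen along its own solution and becomes a function of time, so
  superposition applies even to solutions of nonlinear equations.\<close>

lemma mild_solution_combination:
  assumes x: "mild_solution T S f x0 x" and y: "mild_solution T S g y0 y"
  shows "mild_solution T S (\<lambda>t _. a *\<^sub>R f t (x t) + b *\<^sub>R g t (y t)) (a *\<^sub>R x0
      + b *\<^sub>R y0) (\<lambda>t. a *\<^sub>R x t + b *\<^sub>R y t)"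
  unfolding mild_solution_def
proof (intro conjI ballI)
  show "continuous_on {0..T} (\<lambda>t. a *\<^sub>R x t + b *\<^sub>R y t)"
    using x y by (intro continuous_intros) (simp_all add: mild_solution_def)
  fix t assume t: "t \<in> {0..T}"
  have "bochner_has_integral (lebesgue_on {0..t}) (\<lambda>s. a *\<^sub>R S (t - s) (f s (x s))
      + b *\<^sub>R S (t - s) (g s (y s)))
      (a *\<^sub>R (x t - S t x0) + b *\<^sub>R (y t - S t y0))"
    using x y t
      by (intro Icc.bochner_has_integral_add Icc.bochner_has_integral_scaleR) (simp_all add: mild_solution_def)
  then show "bochner_has_integral (lebesgue_on {0..t}) (\<lambda>s. S (t - s) (a *\<^sub>R f s (x s)
      + b *\<^sub>R g s (y s)))
      (a *\<^sub>R x t + b *\<^sub>R y t - S t (a *\<^sub>R x0 + b *\<^sub>R y0))"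
    by (simp add: blinfun.add_right blinfun.scaleR_right algebra_simps)
qed

section \<open>The controlled state and its linearization\<close>

text \<open>A single constant \<open>M\<close> serves every growth and Lipschitz bound. The growth
  of \<open>g0u\<close> is part of the interface and is derived from the growth of \<open>g0\<close>
  when the locale is interpreted. Optimality and finite codimensionality enter only in the
  multiplier rule.\<close>

locale control_problem =
  F: C11_family T M F Fy Fu + G: C11_family T M g0 g0y g0u
  for T M :: real and F :: "real \<Rightarrow> 'x::{real_inner, banach} \<Rightarrow> 'v::{real_inner, banach}
      \<Rightarrow> 'x"
    and Fy Fu and g0 :: "real \<Rightarrow> 'x \<Rightarrow> 'v \<Rightarrow> real" and g0y g0u +
  fixes S :: "real \<Rightarrow> ('x \<Rightarrow>\<^sub>L 'x)" and K :: real and y0 :: 'x and ubar :: "real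
      \<Rightarrow> 'v" and ybar :: "real \<Rightarrow> 'x"
  assumes T_pos: "T > 0" and S: "C0_semigroup S"
    and K: "K > 0" "\<And>t. 0 \<le> t \<Longrightarrow> t \<le> T \<Longrightarrow> norm (S t) \<le> K"
    and F_growth: "\<And>t u. t \<in> {0..T} \<Longrightarrow> norm (F t 0 u) \<le> M * norm u"
    and Fy_bound: "\<And>t y u. t \<in> {0..T} \<Longrightarrow> norm (Fy t y u) \<le> M"
    and Fu_bound: "\<And>t y u. t \<in> {0..T} \<Longrightarrow> norm (Fu t y u) \<le> M"
    and g0_growth: "\<And>t y u. t \<in> {0..T} \<Longrightarrow>
        \<bar>g0 t y u\<bar> \<le> M * (1 + (norm y)\<^sup>2 + (norm u)\<^sup>2)"
    and g0y_growth: "\<And>t y u. t \<in> {0..T} \<Longrightarrow> norm (g0y t y u) \<le> M * (1 + norm y + norm u)"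
    and g0u_growth: "\<And>t y u. t \<in> {0..T} \<Longrightarrow> norm (g0u t y u) \<le> M * (1 + norm y + norm u)"
    and ubar: "ubar \<in> L2_space T" and ybar: "mild_solution T S (\<lambda>t y. F t y (ubar t)) y0 ybar"
begin

abbreviation "N \<equiv> L2_norm T"

lemma M0: "M \<ge> 0" using F.M_pos by simp

lemma T0: "T \<ge> 0" using T_pos by simp

lemma mild_continuous: "mild_solution T S f x0 x \<Longrightarrow> continuous_on {0..T} x"
  by (simp add: mild_solution_def)

lemma F_Lipschitz:
  assumes t: "t \<in> {0..T}"
  shows "norm (F t y u - F t y' u') \<le> M * norm (y - y') + M * norm (u - u')"
proof -
  have "norm (F t y u - F t y' u - (0::'x \<Rightarrow>\<^sub>L 'x) (y - y')) \<le> M * norm (y - y')"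
    by (rule linearization_error[OF F.fy_deriv[OF t]]) (simp add: Fy_bound[OF t])
  moreover have "norm (F t y' u - F t y' u' - (0::'v \<Rightarrow>\<^sub>L 'x) (u - u')) \<le> M * norm (u - u')"
    by (rule linearization_error[OF F.fu_deriv[OF t]]) (simp add: Fu_bound[OF t])
  moreover have "F t y u - F t y' u' = (F t y u - F t y' u - (0::'x \<Rightarrow>\<^sub>L 'x) (y - y'))
      + (F t y' u - F t y' u' - (0::'v \<Rightarrow>\<^sub>L 'x) (u - u'))"
    by simp
  ultimately show ?thesis by (simp only:) (rule norm_triangle_mono)
qed

definition stab :: real where "stab = 2 * K * exp (2 * (K * M) * T)"

lemma stab_pos: "stab > 0" using K by (simp add: stab_def)

lemma stability:
  assumes "mild_solution T S f x0 x" "mild_solution T S g x0 y"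
    and "integrable (lebesgue_on {0..T}) r" "\<And>t. t \<in> {0..T} \<Longrightarrow> r t \<ge> 0"
    and "\<And>t. t \<in> {0..T} \<Longrightarrow> norm (f t (x t) - g t (y t)) \<le> M * norm (x t - y t) + r t"
    and "t \<in> {0..T}"
  shows "norm (x t - y t) \<le> stab * (\<integral>s. r s \<partial>lebesgue_on {0..T})"
  using mild_solution_stability[OF K F.M_pos assms] by (simp add: stab_def mult_ac)

text \<open>A relation rather than a function: mild solutions are determined on [0,T] and arbitrary
  elsewhere.\<close>

definition state :: "(real \<Rightarrow> 'v) \<Rightarrow> (real \<Rightarrow> 'x) \<Rightarrow> bool" where
  "state u y \<longleftrightarrow> mild_solution T S (\<lambda>t y. F t y (u t)) y0 y"

lemma state_exists:
  assumes u: "u \<in> L2_space T"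
  shows "\<exists>y. state u y"
  unfolding state_def
proof (rule mild_solution_exists[OF S T0 F.M_pos])
  have m: "strongly_measurable (lebesgue_on {0..T}) (\<lambda>t. F t c (u t))" for c
    by (rule F.f_strongly_measurable[OF Icc.strongly_measurable_const L2_spaceD(1)[OF u]])
  then show "strongly_measurable (lebesgue_on {0..T}) (\<lambda>t. F t c (u t))" for c .
  show "integrable (lebesgue_on {0..T}) (\<lambda>t. norm (F t 0 (u t)))"
  proof (rule Bochner_Integration.integrable_bound)
    show "integrable (lebesgue_on {0..T}) (\<lambda>t. M * norm (u t))"
      using L2_space_integrable(1)[OF u T0] by simp
    show "(\<lambda>t. norm (F t 0 (u t))) \<in> borel_measurable (lebesgue_on {0..T})"
      by (rule Icc.strongly_measurable_norm[OF m])
    show "AE t in lebesgue_on {0..T}. norm (norm (F t 0 (u t))) \<le> norm (M * norm (u t))"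
      using F_growth M0 by (intro AE_I2) simp
  qed
  show "norm (F t a (u t) - F t b (u t)) \<le> M * norm (a - b)" if "t \<in> {0..T}" for t a b
    using F_Lipschitz[OF that, of a "u t" b "u t"] by simp
qed

definition lip :: real where "lip = stab * (M * sqrt T)"

lemma lip_nonneg: "lip \<ge> 0" using stab_pos M0 T0 by (simp add: lip_def)

lemma L2_forcing_bound:
  assumes d: "d \<in> L2_space T"
  shows "integrable (lebesgue_on {0..T}) (\<lambda>t. M * norm (d t))"
    "stab * (\<integral>t. M * norm (d t) \<partial>lebesgue_on {0..T}) \<le> lip * N d"
proof -
  show "integrable (lebesgue_on {0..T}) (\<lambda>t. M * norm (d t))"
    using L2_space_integrable(1)[OF d T0] by simp
  have "stab * (M * (\<integral>t. norm (d t) \<partial>lebesgue_on {0..T})) \<le> stab * (M * (sqrt T * N d))"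
    using L2_space_integrable(2)[OF d T0] M0 stab_pos by (intro mult_left_mono) auto
  then show "stab * (\<integral>t. M * norm (d t) \<partial>lebesgue_on {0..T}) \<le> lip * N d"
    by (simp add: lip_def mult_ac)
qed

lemma state_Lipschitz:
  assumes u: "u1 \<in> L2_space T" "u2 \<in> L2_space T" and y: "state u1 y1" "state u2 y2" and t: "t \<in> {0..T}"
  shows "norm (y1 t - y2 t) \<le> lip * N (\<lambda>t. u1 t - u2 t)"
proof -
  note f = L2_forcing_bound[OF L2_space_diff[OF u]]
  have "norm (y1 t - y2 t) \<le> stab * (\<integral>t. M * norm (u1 t - u2 t) \<partial>lebesgue_on {0..T})"
    by (rule stability[OF y[unfolded state_def] f(1) _ _ t]) (use F_Lipschitz M0 in auto)
  then show ?thesis using f(2) by linarith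
qed

definition lin :: "(real \<Rightarrow> 'v) \<Rightarrow> (real \<Rightarrow> 'x) \<Rightarrow> bool" where
  "lin v \<xi> \<longleftrightarrow> mild_solution T S (\<lambda>t \<eta>. Fy t (ybar t) (ubar t) \<eta>
      + Fu t (ybar t) (ubar t) (v t)) 0 \<xi>"

lemma ybar_meas: "strongly_measurable (lebesgue_on {0..T}) ybar"
  by (rule continuous_on_strongly_measurable[OF mild_continuous[OF ybar]])

lemmas ubar_meas = L2_spaceD(1)[OF ubar]

lemma Fy_apply_le: "t \<in> {0..T} \<Longrightarrow> norm (Fy t y u x) \<le> M * norm x"
  using order_trans[OF norm_blinfun mult_right_mono[OF Fy_bound norm_ge_zero]] .

lemma Fu_apply_le: "t \<in> {0..T} \<Longrightarrow> norm (Fu t y u x) \<le> M * norm x"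
  using order_trans[OF norm_blinfun mult_right_mono[OF Fu_bound norm_ge_zero]] .

lemma lin_exists:
  assumes v: "v \<in> L2_space T"
  shows "\<exists>\<xi>. lin v \<xi>"
  unfolding lin_def
proof (rule mild_solution_exists[OF S T0 F.M_pos])
  have m: "strongly_measurable (lebesgue_on {0..T}) (\<lambda>t. Fy t (ybar t) (ubar t) c
      + Fu t (ybar t) (ubar t) (v t))" for c
    by (intro Icc.strongly_measurable_add F.fy_apply_strongly_measurable F.fu_apply_strongly_measurable
      ybar_meas ubar_meas Icc.strongly_measurable_const L2_spaceD(1)[OF v])
  then show "strongly_measurable (lebesgue_on {0..T}) (\<lambda>t. Fy t (ybar t) (ubar t) c
      + Fu t (ybar t) (ubar t) (v t))" for c .
  show "integrable (lebesgue_on {0..T}) (\<lambda>t. norm (Fy t (ybar t) (ubar t) 0 + Fu t (ybar t) (ubar t) (v t)))"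
  proof (rule Bochner_Integration.integrable_bound[OF L2_forcing_bound(1)[OF v]])
    show "(\<lambda>t. norm (Fy t (ybar t) (ubar t) 0 + Fu t (ybar t) (ubar t) (v t)))
        \<in> borel_measurable (lebesgue_on {0..T})"
      by (rule Icc.strongly_measurable_norm[OF m])
    show "AE t in lebesgue_on {0..T}. norm (norm (Fy t (ybar t) (ubar t) 0
        + Fu t (ybar t) (ubar t) (v t))) \<le> norm (M * norm (v t))"
      using Fu_apply_le M0 by (intro AE_I2) simp
  qed
  show "norm (Fy t (ybar t) (ubar t) a + Fu t (ybar t) (ubar t) (v t) - (Fy t (ybar t) (ubar t) b
      + Fu t (ybar t) (ubar t) (v t))) \<le> M * norm (a - b)"
    if "t \<in> {0..T}" for t a b
    using Fy_apply_le[OF that, of "ybar t" "ubar t" "a - b"] by (simp add: blinfun.diff_right)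
qed

lemma lin_Lipschitz:
  assumes v: "v1 \<in> L2_space T" "v2 \<in> L2_space T" and l: "lin v1 \<xi>1" "lin v2 \<xi>2" and t: "t \<in> {0..T}"
  shows "norm (\<xi>1 t - \<xi>2 t) \<le> lip * N (\<lambda>t. v1 t - v2 t)"
proof -
  note f = L2_forcing_bound[OF L2_space_diff[OF v]]
  have "norm (\<xi>1 t - \<xi>2 t) \<le> stab * (\<integral>t. M * norm (v1 t - v2 t) \<partial>lebesgue_on {0..T})"
  proof (rule stability[OF l[unfolded lin_def] f(1) _ _ t])
    fix t assume t: "t \<in> {0..T}"
    have "norm (Fy t (ybar t) (ubar t) (\<xi>1 t - \<xi>2 t) + Fu t (ybar t) (ubar t) (v1 t - v2 t))
        \<le> M * norm (\<xi>1 t - \<xi>2 t) + M * norm (v1 t - v2 t)"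
      by (intro norm_triangle_mono Fy_apply_le Fu_apply_le t)
    then show "norm (Fy t (ybar t) (ubar t) (\<xi>1 t) + Fu t (ybar t) (ubar t) (v1 t)
        - (Fy t (ybar t) (ubar t) (\<xi>2 t) + Fu t (ybar t) (ubar t) (v2 t)))
            \<le> M * norm (\<xi>1 t - \<xi>2 t) + M * norm (v1 t - v2 t)"
      by (simp add: blinfun.diff_right add_diff_add)
  qed (use M0 in auto)
  then show ?thesis using f(2) by linarith
qed

lemma lin_combination:
  assumes "lin v \<xi>" "lin w \<eta>"
  shows "lin (\<lambda>t. a *\<^sub>R v t + b *\<^sub>R w t) (\<lambda>t. a *\<^sub>R \<xi> t + b *\<^sub>R \<eta> t)"
proof -
  have "mild_solution T S (\<lambda>t _. a *\<^sub>R (Fy t (ybar t) (ubar t) (\<xi> t) + Fu t (ybar t) (ubar t) (v t))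
      + b *\<^sub>R (Fy t (ybar t) (ubar t) (\<eta> t) + Fu t (ybar t) (ubar t) (w t))) (a *\<^sub>R 0
          + b *\<^sub>R 0) (\<lambda>t. a *\<^sub>R \<xi> t + b *\<^sub>R \<eta> t)"
    by (rule mild_solution_combination) (use assms in \<open>simp_all add: lin_def\<close>)
  then show ?thesis
    unfolding lin_def
    by (subst mild_solution_cong[where g="\<lambda>t _. a *\<^sub>R (Fy t (ybar t) (ubar t) (\<xi> t)
        + Fu t (ybar t) (ubar t) (v t))
      + b *\<^sub>R (Fy t (ybar t) (ubar t) (\<eta> t) + Fu t (ybar t) (ubar t) (w t))"])
      (simp_all add: blinfun.add_right blinfun.scaleR_right scaleR_add_right)
qed

lemma lin_zero: "lin (\<lambda>_. 0) (\<lambda>_. 0)"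
proof -
  have "bochner_has_integral (lebesgue_on {0..t}) (\<lambda>s. 0::'x) 0" for t :: real
  proof -
    obtain x where x: "bochner_has_integral (lebesgue_on {0..t}) (\<lambda>s. 0::'x) x"
      using Icc.bochner_has_integral_exists[of 0 t "\<lambda>_. 0::'x"] by auto
    then show ?thesis using Icc.bochner_has_integral_norm_le[OF x] by simp
  qed
  then show ?thesis by (simp add: lin_def mild_solution_def)
qed

lemma L2_zero: "(\<lambda>_. 0) \<in> L2_space T" by (rule L2_space_continuous) simp

lemma lin_bound:
  assumes "v \<in> L2_space T" "lin v \<xi>" "t \<in> {0..T}"
  shows "norm (\<xi> t) \<le> lip * N v"
  using lin_Lipschitz[OF assms(1) L2_zero assms(2) lin_zero assms(3)] by simp

section \<open>Strict differentiability of the state\<close>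

text \<open>The factor \<open>sqrt T * lip + 1\<close> bounds the \<open>L2\<close> norm of state
  and control increments together by that of the control increment. It occurs twice because the
  remainder is a product of two such increments.\<close>

definition second :: real where "second = stab * (M * ((sqrt T * lip + 1) * (sqrt T * lip + 1)))"

lemma second_nonneg: "second \<ge> 0" using stab_pos M0 by (simp add: second_def)

lemma L2_const_add_norm:
  assumes "d \<in> L2_space T" "c \<ge> 0"
  shows "(\<lambda>t. c + norm (d t)) \<in> L2_space T" "N (\<lambda>t. c + norm (d t)) \<le> sqrt T * c + N d"
proof -
  have c: "(\<lambda>_. c) \<in> L2_space T" by (rule L2_space_continuous) simp
  show "(\<lambda>t. c + norm (d t)) \<in> L2_space T"
    by (rule L2_space_add(1)[OF c L2_norm_fun(1)[OF assms(1)]])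
  show "N (\<lambda>t. c + norm (d t)) \<le> sqrt T * c + N d"
    using L2_space_add(2)[OF c L2_norm_fun(1)[OF assms(1)]] L2_norm_const[OF T0, of c] assms(2)
      by (simp add: L2_norm_fun(2))
qed

text \<open>State increments are bounded uniformly in time by Lipschitz dependence, so the remainder
  of \<open>F\<close> is at most \<open>M\<close> times a product of two \<open>L2\<close>
  functions. Cauchy-Schwarz bounds its \<open>L1\<close> norm, and stability turns that into a
  uniform bound.\<close>

lemma strict_differentiability:
  assumes u: "u1 \<in> L2_space T" "u2 \<in> L2_space T" and y: "state u1 y1" "state u2 y2"
    and \<eta>: "lin (\<lambda>t. u1 t - u2 t) \<eta>" and t: "t \<in> {0..T}"
  shows "norm (y1 t - y2 t - \<eta> t)
    \<le> second * (N (\<lambda>t. u1 t - ubar t) + N (\<lambda>t. u2 t - ubar t)) * N (\<lambda>t. u1 t - u2 t)"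
proof -
  let ?M = "lebesgue_on {0..T}"
  define d1 d2 d where "d1 = (\<lambda>t. u1 t - ubar t)" and "d2 = (\<lambda>t. u2 t - ubar t)" and "d
      = (\<lambda>t. u1 t - u2 t)"
  have dL: "d1 \<in> L2_space T" "d2 \<in> L2_space T" "d \<in> L2_space T"
    unfolding d1_def d2_def d_def by (intro L2_space_diff u ubar)+
  have sb: "state ubar ybar" using ybar by (simp add: state_def)
  have lp: "norm (y1 s - ybar s) \<le> lip * N d1" "norm (y2 s - ybar s) \<le> lip * N d2"
      "norm (y1 s - y2 s) \<le> lip * N d"
    if "s \<in> {0..T}" for s
    unfolding d1_def d2_def d_def using that by (auto intro!: state_Lipschitz u ubar y sb)
  define A where "A = (\<lambda>s. (lip * N d1 + norm (d1 s)) + (lip * N d2 + norm (d2 s)))"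
  define B where "B = (\<lambda>s. lip * N d + norm (d s))"
  have nn: "0 \<le> lip * N e" for e :: "real \<Rightarrow> 'v"
    by (intro mult_nonneg_nonneg lip_nonneg L2_norm_nonneg)
  note c1 = L2_const_add_norm[OF dL(1) nn[of d1]] and c2 = L2_const_add_norm[OF dL(2) nn[of d2]]
    and cB = L2_const_add_norm[OF dL(3) nn[of d]]
  have AL: "A \<in> L2_space T" unfolding A_def by (rule L2_space_add(1)[OF c1(1) c2(1)])
  have BL: "B \<in> L2_space T" unfolding B_def by (rule cB(1))
  have NA: "N A \<le> (sqrt T * lip + 1) * (N d1 + N d2)"
    using L2_space_add(2)[OF c1(1) c2(1)] c1(2) c2(2) unfolding A_def by (simp add: algebra_simps)
  have NB: "N B \<le> (sqrt T * lip + 1) * N d"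
    using cB(2) unfolding B_def by (simp add: algebra_simps)
  have A0: "A s \<ge> 0" "B s \<ge> 0" for s using nn by (simp_all add: A_def B_def)
  note AB = L2_mult[OF AL BL]
  \<comment> \<open>The difference of the two states solves an equation with prescribed right-hand
    side; stability compares it with the linear equation for eta, the defect being the Taylor
    remainder.\<close>
  have ms: "mild_solution T S (\<lambda>t _. F t (y1 t) (u1 t) - F t (y2 t) (u2 t)) 0 (\<lambda>t. y1 t - y2 t)"
    using mild_solution_combination[OF y[unfolded state_def], of 1 "-1"] by simp
  have "norm ((y1 t - y2 t) - \<eta> t) \<le> stab * (\<integral>s. M * (A s * B s) \<partial>?M)"
  proof (rule stability[OF ms \<eta>[unfolded lin_def] _ _ _ t])
    show "integrable ?M (\<lambda>s. M * (A s * B s))" using AB(1) by simp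
    show "0 \<le> M * (A s * B s)" for s using A0 M0 by simp
    fix s assume s: "s \<in> {0..T}"
    let ?L = "Fy s (ybar s) (ubar s)" and ?U = "Fu s (ybar s) (ubar s)"
    let ?r = "F s (y1 s) (u1 s) - F s (y2 s) (u2 s) - ?L (y1 s - y2 s) - ?U (u1 s - u2 s)"
    have "norm ?r \<le> M * (norm (y1 s - ybar s) + norm (y2 s - ybar s) + norm (u1 s - ubar s) + norm (u2 s - ubar s))
        * (norm (y1 s - y2 s) + norm (u1 s - u2 s))"
      by (rule F.remainder[OF s])
    also have "\<dots> \<le> M * A s * B s"
    proof (intro mult_mono)
      show "norm (y1 s - ybar s) + norm (y2 s - ybar s) + norm (u1 s - ubar s) + norm (u2 s - ubar s) \<le> A s"
        using lp[OF s] by (simp add: A_def d1_def d2_def)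
      show "norm (y1 s - y2 s) + norm (u1 s - u2 s) \<le> B s"
        using lp[OF s] by (simp add: B_def d_def)
    qed (use M0 A0 in auto)
    finally have r: "norm ?r \<le> M * (A s * B s)" by (simp add: mult.assoc)
    have eq: "F s (y1 s) (u1 s) - F s (y2 s) (u2 s) - (?L (\<eta> s) + ?U (u1 s - u2 s)) = ?L (y1 s - y2 s - \<eta> s) + ?r"
      by (simp add: blinfun.diff_right)
    show "norm (F s (y1 s) (u1 s) - F s (y2 s) (u2 s) - (?L (\<eta> s) + ?U (u1 s - u2 s)))
        \<le> M * norm (y1 s - y2 s - \<eta> s) + M * (A s * B s)"
      unfolding eq by (rule norm_triangle_mono[OF Fy_apply_le[OF s] r])
  qed
  also have "\<dots> \<le> stab * (M * (N A * N B))"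
    using AB(2) stab_pos M0 by (auto intro!: mult_left_mono)
  also have "\<dots> \<le> stab * (M * (((sqrt T * lip + 1) * (N d1 + N d2)) * ((sqrt T * lip + 1) * N d)))"
    using stab_pos M0 NA NB lip_nonneg T0
    by (intro mult_left_mono mult_mono) (auto intro!: mult_nonneg_nonneg add_nonneg_nonneg L2_norm_nonneg)
  also have "\<dots> = second * (N d1 + N d2) * N d" by (simp add: second_def mult_ac)
  finally show ?thesis by (simp add: d1_def d2_def d_def)
qed

end

lemma dual_op_id_blinfun [simp]: "dual_op B id_blinfun = B"
  by (rule blinfun_eqI) simp

lemma L2_mult_dominated:
  fixes f a b :: "real \<Rightarrow> real"
  assumes f: "strongly_measurable (lebesgue_on {0..T}) f" and a: "a \<in> L2_space T" and b: "b \<in> L2_space T"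
    and le: "\<And>t. t \<in> {0..T} \<Longrightarrow> \<bar>f t\<bar> \<le> C * (a t * b t)"
  shows "integrable (lebesgue_on {0..T}) f"
proof (rule Bochner_Integration.integrable_bound)
  show "integrable (lebesgue_on {0..T}) (\<lambda>t. C * (a t * b t))" using L2_mult(1)[OF a b] by simp
  show "f \<in> borel_measurable (lebesgue_on {0..T})" by (rule Icc.strongly_measurable_real[OF f])
  show "AE t in lebesgue_on {0..T}. norm (f t) \<le> norm (C * (a t * b t))"
    by (rule AE_I2) (use le in \<open>auto intro: order_trans[OF _ abs_ge_self]\<close>)
qed

context control_problem
begin

section \<open>Second order expansion of the cost\<close>

text \<open>The growth bound of the derivatives of \<open>g0\<close> along the reference pair. It
  lies in \<open>L2\<close>, which makes their pairings with \<open>L2\<close> functions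
  integrable.\<close>

definition weight :: "real \<Rightarrow> real" where "weight t = 1 + norm (ybar t) + norm (ubar t)"

lemma weight_pos: "weight t \<ge> 0" by (simp add: weight_def)

lemma weight_L2: "weight \<in> L2_space T"
proof -
  have "(\<lambda>t. 1 + norm (ybar t)) \<in> L2_space T"
    by (intro L2_space_continuous continuous_intros mild_continuous[OF ybar])
  from L2_space_add(1)[OF this L2_norm_fun(1)[OF ubar]] show ?thesis by (simp add: weight_def[abs_def])
qed

lemma g0y_apply_le: "t \<in> {0..T} \<Longrightarrow> \<bar>g0y t (ybar t) (ubar t) x\<bar> \<le> M * (weight t * norm x)"
  using order_trans[OF norm_blinfun mult_right_mono[OF g0y_growth norm_ge_zero], of t "ybar t" "ubar t" x]
  by (simp add: weight_def mult.assoc)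

lemma g0u_apply_le: "t \<in> {0..T} \<Longrightarrow> \<bar>g0u t (ybar t) (ubar t) x\<bar> \<le> M * (weight t * norm x)"
  using order_trans[OF norm_blinfun mult_right_mono[OF g0u_growth norm_ge_zero], of t "ybar t" "ubar t" x]
  by (simp add: weight_def mult.assoc)

lemma lin_continuous: "lin v \<xi> \<Longrightarrow> continuous_on {0..T} \<xi>"
  unfolding lin_def by (rule mild_continuous)

lemma continuous_norm_L2:
  "continuous_on {0..T} (\<xi> :: real \<Rightarrow> 'z::real_normed_vector) \<Longrightarrow>
      (\<lambda>t. norm (\<xi> t)) \<in> L2_space T"
  by (intro L2_space_continuous continuous_intros)

lemma g0y_integrable:
  assumes \<xi>: "continuous_on {0..T} \<xi>"
  shows "integrable (lebesgue_on {0..T}) (\<lambda>t. g0y t (ybar t) (ubar t) (\<xi> t))"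
  by (rule L2_mult_dominated[OF G.fy_apply_strongly_measurable[OF ybar_meas ubar_meas
      continuous_on_strongly_measurable[OF \<xi>]]
      weight_L2 continuous_norm_L2[OF \<xi>] g0y_apply_le])

lemma g0u_integrable:
  assumes v: "v \<in> L2_space T"
  shows "integrable (lebesgue_on {0..T}) (\<lambda>t. g0u t (ybar t) (ubar t) (v t))"
  by (rule L2_mult_dominated[OF G.fu_apply_strongly_measurable[OF ybar_meas ubar_meas L2_spaceD(1)[OF v]]
      weight_L2 L2_norm_fun(1)[OF v] g0u_apply_le])

definition dcost :: "(real \<Rightarrow> 'v) \<Rightarrow> (real \<Rightarrow> 'x) \<Rightarrow> real" where
  "dcost v \<xi> = (\<integral>t. g0y t (ybar t) (ubar t) (\<xi> t)
      + g0u t (ybar t) (ubar t) (v t) \<partial>lebesgue_on {0..T})"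

lemma cost_integrable:
  assumes u: "u \<in> L2_space T" and y: "state u y"
  shows "integrable (lebesgue_on {0..T}) (\<lambda>t. g0 t (y t) (u t))"
proof (rule Bochner_Integration.integrable_bound)
  have yc: "continuous_on {0..T} y" using y unfolding state_def by (rule mild_continuous)
  show "integrable (lebesgue_on {0..T}) (\<lambda>t. M * (1 + (norm (y t))\<^sup>2 + (norm (u t))\<^sup>2))"
    using L2_spaceD(2)[OF u] L2_spaceD(2)[OF L2_space_continuous[OF yc]] by simp
  show "(\<lambda>t. g0 t (y t) (u t)) \<in> borel_measurable (lebesgue_on {0..T})"
    by (intro Icc.strongly_measurable_real G.f_strongly_measurable L2_spaceD(1)[OF u] continuous_on_strongly_measurable yc)
  show "AE t in lebesgue_on {0..T}. norm (g0 t (y t) (u t))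
      \<le> norm (M * (1 + (norm (y t))\<^sup>2 + (norm (u t))\<^sup>2))"
    by (rule AE_I2) (use g0_growth in \<open>auto intro: order_trans[OF _ abs_ge_self]\<close>)
qed

definition third :: real where
  "third = M * ((sqrt T * lip + 1) * (sqrt T * lip + 1))
      + second * (M * (\<integral>t. weight t \<partial>lebesgue_on {0..T}))"

lemma weight_integrable: "integrable (lebesgue_on {0..T}) weight"
  using L2_space_integrable(1)[OF weight_L2 T0] weight_pos by simp

lemma third_nonneg: "third \<ge> 0"
  using M0 second_nonneg weight_pos unfolding third_def
  by (intro add_nonneg_nonneg mult_nonneg_nonneg zero_le_square integral_nonneg_AE AE_I2) auto

lemma state_ubar: "state ubar ybar" using ybar by (simp add: state_def)

text \<open>There are two errors: the Taylor remainder of \<open>g0\<close>, and the replacement of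
  the true state increment by the linearized one, which strict differentiability bounds
  quadratically and \<open>g0y\<close> weights. The constant \<open>third\<close> is the sum of
  both.\<close>

lemma cost_expansion:
  assumes u: "u \<in> L2_space T" and y: "state u y" and \<eta>: "lin (\<lambda>t. u t - ubar t) \<eta>"
  shows "\<bar>cost T g0 y u - cost T g0 ybar ubar - dcost (\<lambda>t. u t - ubar t) \<eta>\<bar>
      \<le> third * (N (\<lambda>t. u t - ubar t))\<^sup>2"
proof -
  let ?M = "lebesgue_on {0..T}"
  define d where "d = (\<lambda>t. u t - ubar t)"
  have dL: "d \<in> L2_space T" unfolding d_def by (rule L2_space_diff[OF u ubar])
  have nn: "0 \<le> lip * N d" by (intro mult_nonneg_nonneg lip_nonneg L2_norm_nonneg)
  define B where "B = (\<lambda>s. lip * N d + norm (d s))"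
  note cB = L2_const_add_norm[OF dL nn]
  have BL: "B \<in> L2_space T" unfolding B_def by (rule cB(1))
  have NB: "N B \<le> (sqrt T * lip + 1) * N d"
    using cB(2) unfolding B_def by (simp add: algebra_simps)
  have B0: "B s \<ge> 0" for s using nn by (simp add: B_def)
  define R where "R t = g0 t (y t) (u t) - g0 t (ybar t) (ubar t)
    - (g0y t (ybar t) (ubar t) (\<eta> t) + g0u t (ybar t) (ubar t) (d t))" for t
  have i: "integrable ?M (\<lambda>t. g0 t (y t) (u t))" "integrable ?M (\<lambda>t. g0 t (ybar t) (ubar t))"
    "integrable ?M (\<lambda>t. g0y t (ybar t) (ubar t) (\<eta> t) + g0u t (ybar t) (ubar t) (d t))"
    by (intro cost_integrable u y ubar state_ubar Bochner_Integration.integrable_add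
      g0y_integrable g0u_integrable dL lin_continuous[OF \<eta>])+
  have Ri: "integrable ?M R" unfolding R_def using i by (intro Bochner_Integration.integrable_diff)
  have eq: "cost T g0 y u - cost T g0 ybar ubar - dcost d \<eta> = (\<integral>t. R t \<partial>?M)"
    unfolding R_def cost_def dcost_def using i by simp
  have le: "\<bar>R t\<bar> \<le> M * (B t * B t) + second * (N d)\<^sup>2 * (M * weight t)" if t: "t \<in> {0..T}" for t
  proof -
    let ?r = "g0 t (y t) (u t) - g0 t (ybar t) (ubar t) - g0y t (ybar t) (ubar t) (y t - ybar t)
        - g0u t (ybar t) (ubar t) (u t - ubar t)"
    have "norm (y t - ybar t) \<le> lip * N d"
      unfolding d_def by (rule state_Lipschitz[OF u ubar y state_ubar t])
    then have nB: "norm (y t - ybar t) + norm (u t - ubar t) \<le> B t" by (simp add: B_def d_def)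
    have "\<bar>?r\<bar> \<le> M * (norm (y t - ybar t) + norm (u t - ubar t)) * (norm (y t - ybar t) + norm (u t - ubar t))"
      using G.remainder[OF t, of "y t" "u t" "ybar t" "ubar t" "ybar t" "ubar t"] by simp
    also have "\<dots> \<le> M * B t * B t"
      using nB M0 B0 by (intro mult_mono) auto
    finally have r: "\<bar>?r\<bar> \<le> M * (B t * B t)" by (simp add: mult.assoc)
    have "norm (y t - ybar t - \<eta> t) \<le> second * (N d)\<^sup>2"
      using strict_differentiability[OF u ubar y state_ubar \<eta> t]
      by (simp add: d_def L2_norm_def power2_eq_square mult.assoc)
    then have "M * weight t * norm (y t - ybar t - \<eta> t) \<le> M * weight t * (second * (N d)\<^sup>2)"
      using M0 weight_pos by (intro mult_left_mono mult_nonneg_nonneg) auto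
    then have s: "\<bar>g0y t (ybar t) (ubar t) (y t - ybar t - \<eta> t)\<bar>
        \<le> second * (N d)\<^sup>2 * (M * weight t)"
      using g0y_apply_le[OF t, of "y t - ybar t - \<eta> t"] by (simp add: mult_ac)
    have "R t = ?r + g0y t (ybar t) (ubar t) (y t - ybar t - \<eta> t)"
      by (simp add: R_def d_def blinfun.diff_right)
    then show ?thesis
      using r s abs_triangle_ineq[of ?r "g0y t (ybar t) (ubar t) (y t - ybar t - \<eta> t)"] by linarith
  qed
  have bi: "integrable ?M (\<lambda>t. M * (B t * B t) + second * (N d)\<^sup>2 * (M * weight t))"
    using L2_mult(1)[OF BL BL] weight_integrable by simp
  have "\<bar>\<integral>t. R t \<partial>?M\<bar> \<le> (\<integral>t. \<bar>R t\<bar> \<partial>?M)"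
    by (rule integral_abs_bound)
  also have "\<dots> \<le> (\<integral>t. M * (B t * B t) + second * (N d)\<^sup>2 * (M * weight t) \<partial>?M)"
    using Ri bi le by (intro integral_mono) auto
  also have "\<dots> = M * (\<integral>t. B t * B t \<partial>?M)
      + second * (N d)\<^sup>2 * (M * (\<integral>t. weight t \<partial>?M))"
    using L2_mult(1)[OF BL BL] weight_integrable by simp
  also have "M * (\<integral>t. B t * B t \<partial>?M) \<le> M * (((sqrt T * lip + 1) * N d) * ((sqrt T * lip + 1) * N d))"
  proof (rule mult_left_mono[OF _ M0])
    have "(\<integral>t. B t * B t \<partial>?M) \<le> N B * N B" using L2_mult(2)[OF BL BL] by linarith
    also have "\<dots> \<le> ((sqrt T * lip + 1) * N d) * ((sqrt T * lip + 1) * N d)"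
      using order_trans[OF L2_norm_nonneg NB] by (intro mult_mono NB L2_norm_nonneg)
    finally show "(\<integral>t. B t * B t \<partial>?M) \<le> ((sqrt T * lip + 1) * N d) * ((sqrt T * lip + 1) * N d)" .
  qed
  finally have "\<bar>\<integral>t. R t \<partial>?M\<bar> \<le> third * (N d)\<^sup>2"
    by (simp add: third_def power2_eq_square algebra_simps)
  then show ?thesis using eq by (simp add: d_def)
qed

section \<open>Adjoint states and gradients with respect to the control\<close>

text \<open>In \<open>adjoint_mild_solution\<close> the right-hand side enters the differential
  equation with a minus sign; the term z0 g0y of the adjoint equation therefore appears here with
  the opposite sign.\<close>

definition adj :: "real \<Rightarrow> ('x \<Rightarrow>\<^sub>L real) \<Rightarrow> (real \<Rightarrow> 'x
    \<Rightarrow>\<^sub>L real) \<Rightarrow> bool" where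
  "adj z0 \<psi>T \<psi> \<longleftrightarrow> adjoint_mild_solution T S
    (\<lambda>t p. dual_op (Fy t (ybar t) (ubar t)) p - z0 *\<^sub>R g0y t (ybar t) (ubar t)) \<psi>T \<psi>"

text \<open>For a real-valued map the dual operator, applied to the identity functional of the real
  line, returns the derivative itself.\<close>

lemma g0y_strongly_measurable: "strongly_measurable (lebesgue_on {0..T}) (\<lambda>t. g0y t (ybar t) (ubar t))"
  using G.dual_fy_strongly_measurable[OF ybar_meas ubar_meas Icc.strongly_measurable_const[where c=id_blinfun]]
    by simp

lemma g0u_strongly_measurable: "strongly_measurable (lebesgue_on {0..T}) (\<lambda>t. g0u t (ybar t) (ubar t))"
  using G.dual_fu_strongly_measurable[OF ybar_meas ubar_meas Icc.strongly_measurable_const[where c=id_blinfun]]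
    by simp

lemma dual_Fy_le: "t \<in> {0..T} \<Longrightarrow> norm (dual_op (Fy t y u) \<phi>) \<le> M * norm \<phi>"
  by (rule order_trans[OF norm_dual_op mult_right_mono[OF Fy_bound norm_ge_zero]])

lemma dual_Fu_le: "t \<in> {0..T} \<Longrightarrow> norm (dual_op (Fu t y u) \<phi>) \<le> M * norm \<phi>"
  by (rule order_trans[OF norm_dual_op mult_right_mono[OF Fu_bound norm_ge_zero]])

lemma adj_rhs_le:
  assumes t: "t \<in> {0..T}"
  shows "norm (dual_op (Fy t (ybar t) (ubar t)) \<phi> - z0 *\<^sub>R g0y t (ybar t) (ubar t))
      \<le> M * norm \<phi> + \<bar>z0\<bar> * (M * weight t)"
proof -
  have "norm (z0 *\<^sub>R g0y t (ybar t) (ubar t)) \<le> \<bar>z0\<bar> * (M * weight t)"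
    using mult_left_mono[OF g0y_growth[OF t, of "ybar t" "ubar t"], of "\<bar>z0\<bar>"]
      by (simp add: weight_def)
  then show ?thesis
    using norm_triangle_ineq4[of "dual_op (Fy t (ybar t) (ubar t)) \<phi>" "z0 *\<^sub>R g0y t (ybar t) (ubar t)"]
      dual_Fy_le[OF t, of "ybar t" "ubar t" \<phi>] by linarith
qed

lemma adj_rhs_strongly_measurable:
  assumes \<phi>: "strongly_measurable (lebesgue_on {0..T}) \<phi>"
  shows "strongly_measurable (lebesgue_on {0..T}) (\<lambda>t. dual_op (Fy t (ybar t) (ubar t)) (\<phi> t)
      - z0 *\<^sub>R g0y t (ybar t) (ubar t))"
  by (intro Icc.strongly_measurable_diff Icc.strongly_measurable_scaleR Icc.strongly_measurable_const
    F.dual_fy_strongly_measurable ybar_meas ubar_meas \<phi> g0y_strongly_measurable)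

lemma adj_rhs_integrable:
  assumes \<phi>: "continuous_on {0..T} \<phi>"
  shows "integrable (lebesgue_on {0..T}) (\<lambda>t. norm (dual_op (Fy t (ybar t) (ubar t)) (\<phi> t)
      - z0 *\<^sub>R g0y t (ybar t) (ubar t)))"
proof (rule Bochner_Integration.integrable_bound)
  show "integrable (lebesgue_on {0..T}) (\<lambda>t. M * norm (\<phi> t) + \<bar>z0\<bar> * (M * weight t))"
  proof (rule Bochner_Integration.integrable_add)
    show "integrable (lebesgue_on {0..T}) (\<lambda>t. M * norm (\<phi> t))"
      by (intro continuous_on_integrable_Icc continuous_intros \<phi>)
  qed (use weight_integrable in simp)
  show "(\<lambda>t. norm (dual_op (Fy t (ybar t) (ubar t)) (\<phi> t)
      - z0 *\<^sub>R g0y t (ybar t) (ubar t))) \<in> borel_measurable (lebesgue_on {0..T})"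
    by (intro Icc.strongly_measurable_norm adj_rhs_strongly_measurable continuous_on_strongly_measurable \<phi>)
  show "AE t in lebesgue_on {0..T}. norm (norm (dual_op (Fy t (ybar t) (ubar t)) (\<phi> t)
      - z0 *\<^sub>R g0y t (ybar t) (ubar t)))
      \<le> norm (M * norm (\<phi> t) + \<bar>z0\<bar> * (M * weight t))"
    by (rule AE_I2) (use adj_rhs_le in \<open>auto intro: order_trans[OF _ abs_ge_self]\<close>)
qed

lemma adj_exists: "\<exists>\<psi>. adj z0 \<psi>T \<psi>"
  unfolding adj_def
proof (rule adjoint_mild_solution_exists[OF S T0 F.M_pos])
  show "strongly_measurable (lebesgue_on {0..T}) (\<lambda>t. dual_op (Fy t (ybar t) (ubar t)) c
      - z0 *\<^sub>R g0y t (ybar t) (ubar t))" for c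
    by (rule adj_rhs_strongly_measurable) simp
  show "integrable (lebesgue_on {0..T}) (\<lambda>t. norm (dual_op (Fy t (ybar t) (ubar t)) 0
      - z0 *\<^sub>R g0y t (ybar t) (ubar t)))"
    by (rule adj_rhs_integrable) simp
  show "norm (dual_op (Fy t (ybar t) (ubar t)) a - z0 *\<^sub>R g0y t (ybar t) (ubar t)
      - (dual_op (Fy t (ybar t) (ubar t)) b - z0 *\<^sub>R g0y t (ybar t) (ubar t)))
          \<le> M * norm (a - b)" if "t \<in> {0..T}" for t a b
    using dual_Fy_le[OF that, of "ybar t" "ubar t" "a - b"] by (simp add: dual_op_diff)
qed

lemma adj_continuous: "adj z0 \<psi>T \<psi> \<Longrightarrow> continuous_on {0..T} \<psi>"
  by (simp add: adj_def adjoint_mild_solution_def)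

text \<open>The Riesz representative of \<open>H\<^sub>u(t, ybar(t), ubar(t), z0, \<psi>(t))\<close>.\<close>
definition hrep :: "real \<Rightarrow> (real \<Rightarrow> 'x \<Rightarrow>\<^sub>L real) \<Rightarrow> real
    \<Rightarrow> 'v" where
  "hrep z0 \<psi> t = riesz (dual_op (Fu t (ybar t) (ubar t)) (\<psi> t) - z0 *\<^sub>R g0u t (ybar t) (ubar t))"

lemma hrep_L2:
  assumes \<psi>: "continuous_on {0..T} \<psi>"
  shows "hrep z0 \<psi> \<in> L2_space T"
proof (rule L2_space_dominated[where C=1])
  have "(\<lambda>t. M * norm (\<psi> t)) \<in> L2_space T"
    by (intro L2_space_continuous continuous_intros \<psi>)
  from L2_space_add(1)[OF this L2_space_scaleR(1)[OF weight_L2, of "\<bar>z0\<bar> * M"]]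
  show "(\<lambda>t. M * norm (\<psi> t) + \<bar>z0\<bar> * M * weight t) \<in> L2_space T" by simp
  show "strongly_measurable (lebesgue_on {0..T}) (hrep z0 \<psi>)"
    unfolding hrep_def
    by (rule Icc.strongly_measurable_compose[OF _ linear_continuous_on[OF bounded_linear_riesz]])
      (intro Icc.strongly_measurable_diff Icc.strongly_measurable_scaleR Icc.strongly_measurable_const
        F.dual_fu_strongly_measurable ybar_meas ubar_meas continuous_on_strongly_measurable \<psi> g0u_strongly_measurable)
  fix t assume t: "t \<in> {0..T}"
  have "norm (z0 *\<^sub>R g0u t (ybar t) (ubar t)) \<le> \<bar>z0\<bar> * (M * weight t)"
    using mult_left_mono[OF g0u_growth[OF t, of "ybar t" "ubar t"], of "\<bar>z0\<bar>"]
      by (simp add: weight_def)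
  then have "norm (hrep z0 \<psi> t) \<le> M * norm (\<psi> t) + \<bar>z0\<bar> * (M * weight t)"
    using norm_triangle_ineq4[of "dual_op (Fu t (ybar t) (ubar t)) (\<psi> t)" "z0 *\<^sub>R g0u t (ybar t) (ubar t)"]
      dual_Fu_le[OF t, of "ybar t" "ubar t" "\<psi> t"] unfolding hrep_def norm_riesz by linarith
  also have "\<dots> \<le> \<bar>M * norm (\<psi> t) + \<bar>z0\<bar> * (M * weight t)\<bar>"
    by (rule abs_ge_self)
  finally show "norm (hrep z0 \<psi> t) \<le> 1 * norm (M * norm (\<psi> t) + \<bar>z0\<bar> * M * weight t)"
    by (simp add: mult.assoc)
qed

text \<open>When the adjoint equation is paired with the linearized one, the terms with
  \<open>Fy\<close> cancel and the terminal value and the cost derivative remain. Thus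
  \<open>hrep\<close> is the \<open>L2\<close> gradient of a combination of end-point derivative and
  cost derivative. It yields the adjoint of the end-point derivative for \<open>z0 = 0\<close>, and
  the negative cost gradient for \<open>z0 = 1\<close> with zero terminal value.\<close>

lemma hrep_inner:
  assumes \<psi>: "adj z0 \<psi>T \<psi>" and v: "v \<in> L2_space T" and \<xi>: "lin v \<xi>"
  shows "L2_inner T (hrep z0 \<psi>) v = \<psi>T (\<xi> T) - z0 * dcost v \<xi>"
proof -
  let ?M = "lebesgue_on {0..T}" and ?L = "\<lambda>t. Fy t (ybar t) (ubar t)" and ?U = "\<lambda>t. Fu t (ybar t) (ubar t)"
    and ?gy = "\<lambda>t. g0y t (ybar t) (ubar t)" and ?gu = "\<lambda>t. g0u t (ybar t) (ubar t)"
  have c\<psi>: "continuous_on {0..T} \<psi>" and c\<xi>: "continuous_on {0..T} \<xi>"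
    using adj_continuous[OF \<psi>] lin_continuous[OF \<xi>] by auto
  have m\<psi>: "strongly_measurable ?M \<psi>" and m\<xi>: "strongly_measurable ?M \<xi>"
    using c\<psi> c\<xi> by (auto intro: continuous_on_strongly_measurable)
  have mL: "strongly_measurable ?M (\<lambda>t. ?L t (\<xi> t))"
    by (rule F.fy_apply_strongly_measurable[OF ybar_meas ubar_meas m\<xi>])
  have mU: "strongly_measurable ?M (\<lambda>t. ?U t (v t))"
    by (rule F.fu_apply_strongly_measurable[OF ybar_meas ubar_meas L2_spaceD(1)[OF v]])
  have a: "integrable ?M (\<lambda>t. \<psi> t (?L t (\<xi> t)))"
  proof (rule L2_mult_dominated[OF Icc.strongly_measurable_blinfun_apply[OF m\<psi> mL] continuous_norm_L2[OF
      c\<psi>] continuous_norm_L2[OF c\<xi>]])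
    show "\<bar>\<psi> t (?L t (\<xi> t))\<bar> \<le> M * (norm (\<psi> t) * norm (\<xi> t))"
      if "t \<in> {0..T}" for t
      using order_trans[OF norm_blinfun mult_left_mono[OF Fy_apply_le[OF that, of "ybar t" "ubar t"
          "\<xi> t"] norm_ge_zero], of "\<psi> t"]
      by (simp add: mult_ac)
  qed
  have b: "integrable ?M (\<lambda>t. \<psi> t (?U t (v t)))"
  proof (rule L2_mult_dominated[OF Icc.strongly_measurable_blinfun_apply[OF m\<psi> mU] continuous_norm_L2[OF
      c\<psi>] L2_norm_fun(1)[OF v]])
    show "\<bar>\<psi> t (?U t (v t))\<bar> \<le> M * (norm (\<psi> t) * norm (v t))"
      if "t \<in> {0..T}" for t
      using order_trans[OF norm_blinfun mult_left_mono[OF Fu_apply_le[OF that, of "ybar t" "ubar t"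
          "v t"] norm_ge_zero], of "\<psi> t"]
      by (simp add: mult_ac)
  qed
  note c = g0y_integrable[OF c\<xi>] and d = g0u_integrable[OF v]
  have qi: "integrable ?M (\<lambda>t. norm (?L t (\<xi> t) + ?U t (v t)))"
  proof (rule Bochner_Integration.integrable_bound)
    show "integrable ?M (\<lambda>t. M * norm (\<xi> t) + M * norm (v t))"
      by (intro Bochner_Integration.integrable_add L2_forcing_bound(1)[OF v] continuous_on_integrable_Icc
          continuous_intros c\<xi>)
    show "(\<lambda>t. norm (?L t (\<xi> t) + ?U t (v t))) \<in> borel_measurable ?M"
      by (intro Icc.strongly_measurable_norm Icc.strongly_measurable_add mL mU)
    show "AE t in ?M. norm (norm (?L t (\<xi> t) + ?U t (v t))) \<le> norm (M * norm (\<xi> t) + M * norm (v t))"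
    proof (rule AE_I2)
      fix t assume "t \<in> space ?M"
      then have "norm (?L t (\<xi> t) + ?U t (v t)) \<le> M * norm (\<xi> t) + M * norm (v t)"
        by (intro norm_triangle_mono Fy_apply_le Fu_apply_le) auto
      then show "norm (norm (?L t (\<xi> t) + ?U t (v t))) \<le> norm (M * norm (\<xi> t) + M * norm (v t))"
        by simp
    qed
  qed
  have "(\<integral>t. \<psi> t (?L t (\<xi> t) + ?U t (v t)) \<partial>?M)
    = \<psi>T (\<xi> T) + (\<integral>s. (dual_op (?L s) (\<psi> s) - z0 *\<^sub>R ?gy s) (\<xi> s) \<partial>?M)"
  proof (rule mild_duality[OF S T0 adj_rhs_strongly_measurable[OF m\<psi>] Icc.strongly_measurable_add[OF mL mU]
      adj_rhs_integrable[OF c\<psi>] qi])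
    show "bochner_has_integral (lebesgue_on {t..T}) (\<lambda>s. dual_op (S (s
        - t)) (dual_op (?L s) (\<psi> s) - z0 *\<^sub>R ?gy s))
        (\<psi> t - dual_op (S (T - t)) \<psi>T)" if "t \<in> {0..T}" for t
      using \<psi> that by (simp add: adj_def adjoint_mild_solution_def)
    show "bochner_has_integral (lebesgue_on {0..t}) (\<lambda>s. S (t - s) (?L s (\<xi> s) + ?U s (v s))) (\<xi> t)"
      if "t \<in> {0..T}" for t
      using \<xi> that by (simp add: lin_def mild_solution_def)
  qed
  moreover have "(\<integral>t. \<psi> t (?L t (\<xi> t) + ?U t (v t)) \<partial>?M)
      = (\<integral>t. \<psi> t (?L t (\<xi> t)) \<partial>?M) + (\<integral>t. \<psi> t (?U t (v t)) \<partial>?M)"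
    using a b by (simp add: blinfun.add_right)
  moreover have "(\<integral>s. (dual_op (?L s) (\<psi> s) - z0 *\<^sub>R ?gy s) (\<xi> s) \<partial>?M)
      = (\<integral>t. \<psi> t (?L t (\<xi> t)) \<partial>?M) - z0 * (\<integral>t. ?gy t (\<xi> t) \<partial>?M)"
    using a c by (simp add: blinfun.diff_left blinfun.scaleR_left)
  moreover have "L2_inner T (hrep z0 \<psi>) v = (\<integral>t. \<psi> t (?U t (v t)) \<partial>?M)
      - z0 * (\<integral>t. ?gu t (v t) \<partial>?M)"
    using b d by (simp add: L2_inner_def hrep_def riesz_inner blinfun.diff_left blinfun.scaleR_left)
  moreover have "dcost v \<xi> = (\<integral>t. ?gy t (\<xi> t) \<partial>?M) + (\<integral>t. ?gu t (v t) \<partial>?M)"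
    unfolding dcost_def using c d by simp
  ultimately show ?thesis by (simp add: distrib_left)
qed

text \<open>Testing the duality formula with \<open>hrep\<close> itself shows that its seminorm
  vanishes; hence it is zero almost everywhere, and it represents the control derivative of the
  Hamiltonian.\<close>

lemma Hamiltonian_stationary:
  assumes \<psi>: "adj z0 \<psi>T \<psi>" and ann: "\<And>v \<xi>. v \<in> L2_space T \<Longrightarrow>
      lin v \<xi> \<Longrightarrow> \<psi>T (\<xi> T) = z0 * dcost v \<xi>"
  shows "AE t in lebesgue_on {0<..<T}. ((\<lambda>u. Hamiltonian F g0 t (ybar t) u z0 (\<psi> t))
      has_derivative (\<lambda>_. 0)) (at (ubar t))"
proof -
  have h: "hrep z0 \<psi> \<in> L2_space T" by (rule hrep_L2[OF adj_continuous[OF \<psi>]])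
  obtain \<xi> where \<xi>: "lin (hrep z0 \<psi>) \<xi>" using lin_exists[OF h] by blast
  have "(N (hrep z0 \<psi>))\<^sup>2 = 0"
    using hrep_inner[OF \<psi> h \<xi>] ann[OF h \<xi>] by (simp add: L2_inner_self)
  then have "AE t in lebesgue_on {0..T}. hrep z0 \<psi> t = 0" using L2_norm_eq_0_AE[OF h] by simp
  then have "AE t in lebesgue. t \<in> {0..T} \<longrightarrow> hrep z0 \<psi> t = 0"
    by (subst (asm) AE_restrict_space_iff) auto
  then have "AE t in lebesgue. t \<in> {0<..<T} \<longrightarrow> ((\<lambda>u. Hamiltonian F g0 t (ybar t) u
      z0 (\<psi> t)) has_derivative (\<lambda>_. 0)) (at (ubar t))"
  proof eventually_elim
    case (elim t)
    show ?case
    proof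
      assume "t \<in> {0<..<T}"
      then have t: "t \<in> {0..T}" by simp
      have "norm (dual_op (Fu t (ybar t) (ubar t)) (\<psi> t) - z0 *\<^sub>R g0u t (ybar t) (ubar t)) = 0"
        using elim t by (simp add: hrep_def flip: norm_riesz)
      then have z: "dual_op (Fu t (ybar t) (ubar t)) (\<psi> t) - z0 *\<^sub>R g0u t (ybar t) (ubar t) = 0"
        by simp
      have "((\<lambda>u. \<psi> t (F t (ybar t) u) - z0 * g0 t (ybar t) u) has_derivative
          (\<lambda>h. \<psi> t (Fu t (ybar t) (ubar t) h) - z0 * g0u t (ybar t) (ubar t) h)) (at (ubar t))"
        by (intro has_derivative_diff has_derivative_mult_right G.fu_deriv[OF t]
          bounded_linear.has_derivative[OF blinfun.bounded_linear_right F.fu_deriv[OF t]])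
      moreover have "\<psi> t (Fu t (ybar t) (ubar t) h) - z0 * g0u t (ybar t) (ubar t) h = 0" for h
        using arg_cong[OF z, of "\<lambda>B. blinfun_apply B h"]
          by (simp add: blinfun.diff_left blinfun.scaleR_left)
      ultimately show "((\<lambda>u. Hamiltonian F g0 t (ybar t) u z0 (\<psi> t)) has_derivative (\<lambda>_.
          0)) (at (ubar t))"
        by (simp add: Hamiltonian_def)
    qed
  qed
  then show ?thesis by (subst AE_restrict_space_iff) auto
qed

end

section \<open>The multiplier rule\<close>

context control_problem
begin

section \<open>The end-point derivative and its adjoint\<close>

text \<open>The choice is harmless for square integrable controls, since two solutions of the
  linearized equation with the same control agree at \<open>T\<close>.\<close>

definition Lam :: "(real \<Rightarrow> 'v) \<Rightarrow> 'x" where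
  "Lam v = (SOME \<xi>. lin v \<xi>) T"

lemma T_in: "T \<in> {0..T}" using T_pos by simp

lemma Lam_eq:
  assumes v: "v \<in> L2_space T" and \<xi>: "lin v \<xi>"
  shows "\<xi> T = Lam v"
proof -
  have "lin v (SOME \<xi>. lin v \<xi>)" using \<xi> by (rule someI[of "lin v"])
  from lin_Lipschitz[OF v v \<xi> this T_in] show ?thesis by (simp add: Lam_def L2_norm_def)
qed

lemma Lam_combination:
  assumes v: "v \<in> L2_space T" and w: "w \<in> L2_space T"
  shows "Lam (\<lambda>t. a *\<^sub>R v t + b *\<^sub>R w t) = a *\<^sub>R Lam v + b *\<^sub>R Lam w"
proof -
  obtain \<xi> \<eta> where l: "lin v \<xi>" "lin w \<eta>" using lin_exists v w by blast
  have "(\<lambda>t. a *\<^sub>R v t + b *\<^sub>R w t) \<in> L2_space T"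
    by (intro L2_space_add L2_space_scaleR v w)
  from Lam_eq[OF this lin_combination[OF l]] show ?thesis
    by (simp add: Lam_eq[OF v l(1)] Lam_eq[OF w l(2)])
qed

lemma Lam_diff:
  assumes v: "v \<in> L2_space T" and w: "w \<in> L2_space T"
  shows "Lam (\<lambda>t. v t - w t) = Lam v - Lam w"
  using Lam_combination[OF v w, of 1 "-1"] by simp

lemma Lam_le:
  assumes v: "v \<in> L2_space T"
  shows "norm (Lam v) \<le> lip * N v"
proof -
  obtain \<xi> where l: "lin v \<xi>" using lin_exists v by blast
  show ?thesis using lin_bound[OF v l T_in] by (simp add: Lam_eq[OF v l])
qed

text \<open>The adjoint of \<open>Lam\<close>, computed from an adjoint state with terminal value p
  and without cost term. As the adjoint state is chosen separately for each p, linearity is only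
  asserted up to functions of seminorm zero.\<close>

definition Ladj :: "'x \<Rightarrow> real \<Rightarrow> 'v" where
  "Ladj p = hrep 0 (SOME \<psi>. adj 0 (blinfun_inner_right p) \<psi>)"

lemma Ladj:
  shows Ladj_L2: "Ladj p \<in> L2_space T"
    and Ladj_inner: "v \<in> L2_space T \<Longrightarrow> L2_inner T (Ladj p) v = p \<bullet> Lam v"
proof -
  have a: "adj 0 (blinfun_inner_right p) (SOME \<psi>. adj 0 (blinfun_inner_right p) \<psi>)"
    using adj_exists by (rule someI_ex)
  show "Ladj p \<in> L2_space T"
    unfolding Ladj_def by (rule hrep_L2[OF adj_continuous[OF a]])
  assume v: "v \<in> L2_space T"
  obtain \<xi> where l: "lin v \<xi>" using lin_exists v by blast
  show "L2_inner T (Ladj p) v = p \<bullet> Lam v"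
    unfolding Ladj_def using hrep_inner[OF a v l] by (simp add: Lam_eq[OF v l])
qed

lemma Ladj_diff_norm_le: "N (\<lambda>t. Ladj r t - Ladj s t) \<le> lip * norm (r - s)"
proof -
  let ?w = "\<lambda>t. Ladj r t - Ladj s t"
  have w: "?w \<in> L2_space T" by (intro L2_space_diff Ladj_L2)
  have "(N ?w)\<^sup>2 = (r - s) \<bullet> Lam ?w"
    unfolding L2_inner_self[symmetric] L2_inner_diff_left[OF Ladj_L2 Ladj_L2 w]
    by (simp add: Ladj_inner[OF w] inner_diff_left)
  also have "\<dots> \<le> norm (r - s) * (lip * N ?w)"
    by (rule order_trans[OF norm_cauchy_schwarz mult_left_mono[OF Lam_le[OF w] norm_ge_zero]])
  finally have "N ?w * N ?w \<le> (lip * norm (r - s)) * N ?w" by (simp add: power2_eq_square mult_ac)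
  then show ?thesis
    using L2_norm_nonneg[of T ?w] lip_nonneg by (cases "N ?w = 0") auto
qed

definition Gram :: "'x \<Rightarrow> 'x" where "Gram p = Lam (Ladj p)"

text \<open>The additivity defect of \<open>Ladj\<close> has zero inner product with itself, hence
  seminorm zero, and \<open>Lam\<close> annihilates such functions. Thus \<open>Gram\<close> is
  additive as an honest map on the state space.\<close>

lemma Gram_diff: "Gram r - Gram s = Gram (r - s)"
proof -
  define w where "w = (\<lambda>t. (Ladj r t - Ladj s t) - Ladj (r - s) t)"
  have rs: "(\<lambda>t. Ladj r t - Ladj s t) \<in> L2_space T" by (intro L2_space_diff Ladj_L2)
  have w: "w \<in> L2_space T" unfolding w_def by (rule L2_space_diff[OF rs Ladj_L2])
  have "(N w)\<^sup>2 = L2_inner T w w" by (simp add: L2_inner_self)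
  also have "\<dots> = 0"
  proof -
    have "L2_inner T (\<lambda>t. (Ladj r t - Ladj s t) - Ladj (r - s) t) w = 0"
      unfolding L2_inner_diff_left[OF rs Ladj_L2 w] L2_inner_diff_left[OF Ladj_L2 Ladj_L2 w]
      by (simp add: Ladj_inner[OF w] inner_diff_left)
    then show ?thesis by (simp add: w_def)
  qed
  finally have "Lam w = 0" using Lam_le[OF w] by simp
  moreover have "Lam w = Gram r - Gram s - Gram (r - s)"
    unfolding w_def Lam_diff[OF rs Ladj_L2] Lam_diff[OF Ladj_L2 Ladj_L2] Gram_def ..
  ultimately show ?thesis by simp
qed

lemma Gram_0: "Gram 0 = 0" using Gram_diff[of 0 0] by simp

lemma Ladj_norm_le: "N (Ladj p) \<le> lip * norm p"
proof -
  have "(N (Ladj p))\<^sup>2 = p \<bullet> Lam (Ladj p)"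
    unfolding L2_inner_self[symmetric] by (rule Ladj_inner[OF Ladj_L2])
  also have "\<dots> \<le> norm p * (lip * N (Ladj p))"
    by (rule order_trans[OF norm_cauchy_schwarz mult_left_mono[OF Lam_le[OF Ladj_L2] norm_ge_zero]])
  finally have "N (Ladj p) * N (Ladj p) \<le> (lip * norm p) * N (Ladj p)"
    by (simp add: power2_eq_square mult_ac)
  then show ?thesis
    using L2_norm_nonneg[of T "Ladj p"] lip_nonneg by (cases "N (Ladj p) = 0") auto
qed

lemma Gram_le: "norm (Gram p) \<le> lip * lip * norm p"
  unfolding Gram_def
  using order_trans[OF Lam_le[OF Ladj_L2] mult_left_mono[OF Ladj_norm_le lip_nonneg], of p]
    by (simp add: mult.assoc)

lemma Gram_inner: "p \<bullet> Gram p = (N (Ladj p))\<^sup>2"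
  unfolding Gram_def L2_inner_self[symmetric] by (rule Ladj_inner[OF Ladj_L2, symmetric])

text \<open>The negative gradient of the cost with respect to the control, as
  \<open>descent_inner\<close> states.\<close>

definition descent :: "real \<Rightarrow> 'v" where
  "descent = hrep 1 (SOME \<psi>. adj 1 0 \<psi>)"

lemma descent:
  shows descent_L2: "descent \<in> L2_space T"
    and descent_inner: "v \<in> L2_space T \<Longrightarrow> lin v \<xi> \<Longrightarrow>
        L2_inner T descent v = - dcost v \<xi>"
proof -
  have a: "adj 1 0 (SOME \<psi>. adj 1 0 \<psi>)" using adj_exists by (rule someI_ex)
  show "descent \<in> L2_space T" unfolding descent_def by (rule hrep_L2[OF adj_continuous[OF a]])
  show "v \<in> L2_space T \<Longrightarrow> lin v \<xi> \<Longrightarrow> L2_inner T descent v = - dcost v \<xi>"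
    unfolding descent_def using hrep_inner[OF a] by simp
qed

section \<open>Attainable set and approachable directions\<close>

text \<open>Written with solution curves so that it unfolds to the set in the finite
  codimensionality hypothesis; \<open>attainable_eq\<close> is the working form with
  \<open>Lam\<close>.\<close>

definition attainable :: "'x set" where
  "attainable = {\<xi> T |\<xi> v. v \<in> L2_space T \<and> N v \<le> 1 \<and> lin v \<xi>}"

lemma attainable_eq: "attainable = {Lam v |v. v \<in> L2_space T \<and> N v \<le> 1}"
proof (intro set_eqI iffI)
  fix x assume "x \<in> attainable"
  then show "x \<in> {Lam v |v. v \<in> L2_space T \<and> N v \<le> 1}"
    unfolding attainable_def using Lam_eq by blast
next
  fix x assume "x \<in> {Lam v |v. v \<in> L2_space T \<and> N v \<le> 1}"
  then obtain v where v: "x = Lam v" "v \<in> L2_space T" "N v \<le> 1" by blast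
  obtain \<xi> where "lin v \<xi>" using lin_exists v by blast
  then show "x \<in> attainable" unfolding attainable_def using v Lam_eq[OF v(2)] by force
qed

lemma attainable_convex: "convex attainable"
proof (rule convexI)
  fix x y and a b :: real
  assume "x \<in> attainable" "y \<in> attainable" and ab: "0 \<le> a" "0 \<le> b" "a + b = 1"
  then obtain v w where v: "x = Lam v" "v \<in> L2_space T" "N v \<le> 1" and w: "y = Lam w" "w
      \<in> L2_space T" "N w \<le> 1"
    unfolding attainable_eq by blast
  note av = L2_space_scaleR[OF v(2), of a] and bw = L2_space_scaleR[OF w(2), of b]
  have "N (\<lambda>t. a *\<^sub>R v t + b *\<^sub>R w t) \<le> a * N v + b * N w"
    using L2_space_add(2)[OF av(1) bw(1)] av(2) bw(2) ab by simp
  also have "\<dots> \<le> a * 1 + b * 1" using ab v w by (intro add_mono mult_left_mono)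
  finally have "N (\<lambda>t. a *\<^sub>R v t + b *\<^sub>R w t) \<le> 1" using ab by simp
  moreover have "a *\<^sub>R x + b *\<^sub>R y = Lam (\<lambda>t. a *\<^sub>R v t + b *\<^sub>R w t)"
    using Lam_combination[OF v(2) w(2)] v w by simp
  ultimately show "a *\<^sub>R x + b *\<^sub>R y \<in> attainable"
    unfolding attainable_eq using L2_space_add(1)[OF av(1) bw(1)] by blast
qed

lemma attainable_scaleR:
  assumes v: "v \<in> L2_space T" and "\<bar>a\<bar> * N v \<le> 1"
  shows "a *\<^sub>R Lam v \<in> attainable"
proof -
  have "Lam (\<lambda>t. a *\<^sub>R v t + 0 *\<^sub>R v t) = a *\<^sub>R Lam v + 0 *\<^sub>R Lam v"
    by (rule Lam_combination[OF v v])
  then have "a *\<^sub>R Lam v = Lam (\<lambda>t. a *\<^sub>R v t)" by simp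
  then show ?thesis unfolding attainable_eq using L2_space_scaleR[OF v, of a] assms(2) by auto
qed

text \<open>This is what conclusion (ii) demands of z, in neighbourhood form. The strict inequality
  also forces z to be nonzero and the end point to differ from the target.\<close>

definition approachable :: "'x \<Rightarrow> bool" where
  "approachable z \<longleftrightarrow> (\<forall>\<epsilon>>0. \<exists>u y. u
      \<in> L2_space T \<and> state u y \<and> N (\<lambda>t. u t - ubar t) < \<epsilon>
      \<and> z \<bullet> (y T - ybar T) > 0)"

lemma strict_differentiability_end:
  assumes "u1 \<in> L2_space T" "u2 \<in> L2_space T" "state u1 y1" "state u2 y2"
  shows "norm (y1 T - y2 T - Lam (\<lambda>t. u1 t - u2 t))
    \<le> second * (N (\<lambda>t. u1 t - ubar t) + N (\<lambda>t. u2 t - ubar t)) * N (\<lambda>t. u1 t - u2 t)"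
proof -
  have d: "(\<lambda>t. u1 t - u2 t) \<in> L2_space T" using assms by (intro L2_space_diff)
  obtain \<eta> where l: "lin (\<lambda>t. u1 t - u2 t) \<eta>" using lin_exists[OF d] by blast
  show ?thesis using strict_differentiability[OF assms l T_in] by (simp add: Lam_eq[OF d l])
qed

lemma differentiability_end:
  assumes "u \<in> L2_space T" "state u y"
  shows "norm (y T - ybar T - Lam (\<lambda>t. u t - ubar t)) \<le> second * (N (\<lambda>t. u t - ubar t))\<^sup>2"
  using strict_differentiability_end[OF assms(1) ubar assms(2) state_ubar]
  by (simp add: L2_norm_def power2_eq_square mult.assoc)

text \<open>A step of length delta along v gains delta times the positive number
  \<open>z . Lam v\<close>, while the error of differentiability is quadratic in delta.\<close>

lemma approachable_if_controllable:
  assumes v: "v \<in> L2_space T" and pos: "z \<bullet> Lam v > 0"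
  shows "approachable z"
  unfolding approachable_def
proof (intro allI impI)
  fix \<epsilon> :: real assume \<epsilon>: "\<epsilon> > 0"
  define Q where "Q = norm z * (second * (N v)\<^sup>2)"
  have Q0: "Q \<ge> 0" using second_nonneg by (simp add: Q_def)
  \<comment> \<open>The quotient delta = b / (2 a) makes delta times every quantity below
    \<open>a\<close> smaller than every bound above \<open>b\<close>. Several smallness conditions
    are thus met by one choice; the regular case fixes its step size in the same way.\<close>
  define b where "b = min \<epsilon> (z \<bullet> Lam v)"
  define a where "a = N v + Q + 1"
  have ab: "a > 0" "b > 0" using Q0 L2_norm_nonneg[of T v] \<epsilon> pos by (auto simp: a_def b_def)
  define \<delta> where "\<delta> = b / (2 * a)"
  have \<delta>: "\<delta> > 0" "\<delta> * a < b" using ab by (auto simp: \<delta>_def)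
  define u where "u = (\<lambda>t. ubar t + \<delta> *\<^sub>R v t)"
  have \<delta>v: "(\<lambda>t. \<delta> *\<^sub>R v t) \<in> L2_space T"
      "N (\<lambda>t. \<delta> *\<^sub>R v t) = \<delta> * N v"
    using L2_space_scaleR[OF v, of \<delta>] \<delta> by auto
  have u: "u \<in> L2_space T" unfolding u_def by (rule L2_space_add(1)[OF ubar \<delta>v(1)])
  obtain y where y: "state u y" using state_exists[OF u] by blast
  have du: "(\<lambda>t. u t - ubar t) = (\<lambda>t. \<delta> *\<^sub>R v t)" by (simp add: u_def)
  have "\<delta> * N v \<le> \<delta> * a" "\<delta> * Q \<le> \<delta> * a"
    using \<delta> Q0 L2_norm_nonneg[of T v] by (auto simp: a_def)
  then have small: "\<delta> * N v < \<epsilon>" "\<delta> * Q < z \<bullet> Lam v"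
    using \<delta>(2) by (auto simp: b_def)
  have Ld: "Lam (\<lambda>t. \<delta> *\<^sub>R v t) = \<delta> *\<^sub>R Lam v"
    using Lam_combination[OF v v, of \<delta> 0] by simp
  have "norm (y T - ybar T - \<delta> *\<^sub>R Lam v) \<le> second * (\<delta> * N v)\<^sup>2"
    using differentiability_end[OF u y] by (simp add: du Ld \<delta>v(2))
  then have "norm z * norm (y T - ybar T - \<delta> *\<^sub>R Lam v) \<le> norm z * (second * (\<delta> * N v)\<^sup>2)"
    by (rule mult_left_mono) simp
  also have "\<dots> = \<delta> * (\<delta> * Q)" by (simp add: Q_def power2_eq_square mult_ac)
  finally have "\<bar>z \<bullet> (y T - ybar T - \<delta> *\<^sub>R Lam v)\<bar> \<le> \<delta> * (\<delta> * Q)"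
    using Cauchy_Schwarz_ineq2[of z "y T - ybar T - \<delta> *\<^sub>R Lam v"] by linarith
  moreover have "\<delta> * (\<delta> * Q) < \<delta> * (z \<bullet> Lam v)"
    using small(2) \<delta>(1) by simp
  moreover have "z \<bullet> (y T - ybar T - \<delta> *\<^sub>R Lam v)
      = z \<bullet> (y T - ybar T) - \<delta> * (z \<bullet> Lam v)"
    by (simp add: inner_diff_right)
  ultimately have "z \<bullet> (y T - ybar T) > 0" by linarith
  moreover have "N (\<lambda>t. u t - ubar t) < \<epsilon>" unfolding du \<delta>v(2) by (rule small(1))
  ultimately show "\<exists>u y. u \<in> L2_space T \<and> state u y \<and> N (\<lambda>t. u t
      - ubar t) < \<epsilon> \<and> z \<bullet> (y T - ybar T) > 0"
    using u y by blast
qed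

text \<open>Failure for z and for -z gives both inequalities, hence equality, for all controls near
  \<open>ubar\<close>; finitely many z have a common radius.\<close>

lemma not_approachable_imp_in_subspace:
  assumes Z: "finite Z" "\<And>z. z \<in> Z \<Longrightarrow> \<not> approachable z \<and> \<not> approachable (- z)"
  shows "\<exists>\<epsilon>>0. \<forall>u y. u \<in> L2_space T \<longrightarrow> state u y \<longrightarrow>
      N (\<lambda>t. u t - ubar t) < \<epsilon> \<longrightarrow> (\<forall>z\<in>Z. z \<bullet> (y T - ybar T) = 0)"
  using Z
proof (induction rule: finite_induct)
  case empty
  then show ?case by (intro exI[of _ 1]) simp
next
  case (insert z Z)
  then obtain \<epsilon> where \<epsilon>: "\<epsilon> > 0" "\<And>u y. u \<in> L2_space T \<Longrightarrow>
      state u y \<Longrightarrow> N (\<lambda>t. u t - ubar t) < \<epsilon> \<Longrightarrow>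
      (\<forall>z\<in>Z. z \<bullet> (y T - ybar T) = 0)"
    by blast
  obtain e1 where e1: "e1 > 0" "\<And>u y. u \<in> L2_space T \<Longrightarrow> state u y \<Longrightarrow>
      N (\<lambda>t. u t - ubar t) < e1 \<Longrightarrow> z \<bullet> (y T - ybar T) \<le> 0"
  proof -
    have "\<not> approachable z" using insert.prems[of z] by simp
    then obtain e where e: "e > 0"
      "\<not> (\<exists>u y. u \<in> L2_space T \<and> state u y \<and> N (\<lambda>t. u t - ubar t) < e
          \<and> z \<bullet> (y T - ybar T) > 0)"
      unfolding approachable_def by blast
    have "z \<bullet> (y T - ybar T) \<le> 0"
      if "u \<in> L2_space T" "state u y" "N (\<lambda>t. u t - ubar t) < e" for u y
    proof -
      have "\<not> z \<bullet> (y T - ybar T) > 0" using e(2) that by blast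
      then show ?thesis by linarith
    qed
    with e(1) show thesis by (rule that)
  qed
  obtain e2 where e2: "e2 > 0" "\<And>u y. u \<in> L2_space T \<Longrightarrow> state u y \<Longrightarrow>
      N (\<lambda>t. u t - ubar t) < e2 \<Longrightarrow> (- z) \<bullet> (y T - ybar T) \<le> 0"
  proof -
    have "\<not> approachable (- z)" using insert.prems[of z] by simp
    then obtain e where e: "e > 0"
      "\<not> (\<exists>u y. u \<in> L2_space T \<and> state u y \<and> N (\<lambda>t. u t - ubar t) < e
          \<and> (- z) \<bullet> (y T - ybar T) > 0)"
      unfolding approachable_def by blast
    have "(- z) \<bullet> (y T - ybar T) \<le> 0"
      if "u \<in> L2_space T" "state u y" "N (\<lambda>t. u t - ubar t) < e" for u y
    proof -
      have "\<not> (- z) \<bullet> (y T - ybar T) > 0" using e(2) that by blast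
      then show ?thesis by linarith
    qed
    with e(1) show thesis by (rule that)
  qed
  show ?case
  proof (intro exI[of _ "min \<epsilon> (min e1 e2)"] conjI allI impI ballI)
    show "min \<epsilon> (min e1 e2) > 0" using \<epsilon>(1) e1(1) e2(1) by simp
    fix u y x assume u: "u \<in> L2_space T" "state u y"
        "N (\<lambda>t. u t - ubar t) < min \<epsilon> (min e1 e2)" and x: "x \<in> insert z Z"
    show "x \<bullet> (y T - ybar T) = 0"
    proof (cases "x = z")
      case True
      then show ?thesis using e1(2)[OF u(1,2)] e2(2)[OF u(1,2)] u(3) by simp
    next
      case False
      then show ?thesis using \<epsilon>(2)[OF u(1,2)] u(3) x by simp
    qed
  qed
qed

text \<open>A critical direction \<open>h\<close> in the kernel of the derivative is corrected to an admissible curve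
  \<open>ubar + \<epsilon> h + O(\<epsilon>\<^sup>2)\<close>.\<close>
lemma regular_multiplier:
  assumes optimal: "\<And>u y. u \<in> L2_space T \<Longrightarrow> state u y \<Longrightarrow>
      y T = ybar T \<Longrightarrow> cost T g0 ybar ubar \<le> cost T g0 y u"
    and L: "subspace L" "closed L" and range: "\<And>v. v \<in> L2_space T \<Longrightarrow> Lam v \<in> L"
    and c: "c > 0" and coercive: "\<And>r. r \<in> L \<Longrightarrow> c * (norm r)\<^sup>2 \<le> r \<bullet> Gram r"
    and \<epsilon>0: "\<epsilon>0 > 0" and near: "\<And>u y. u \<in> L2_space T \<Longrightarrow>
        state u y \<Longrightarrow> N (\<lambda>t. u t - ubar t) < \<epsilon>0 \<Longrightarrow> y T - ybar T \<in> L"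
  shows "\<exists>z\<in>L. \<forall>v \<xi>. v \<in> L2_space T \<longrightarrow> lin v \<xi> \<longrightarrow>
      z \<bullet> Lam v + dcost v \<xi> = 0"
proof -
  have GL: "Gram r \<in> L" for r unfolding Gram_def by (rule range[OF Ladj_L2])
  have H: "descent \<in> L2_space T" by (rule descent_L2)
  \<comment> \<open>The equation \<open>Gram r = Lam descent\<close> is a perturbation of the
    coercive operator by a constant. The repeated bound on the norm of r takes the radius to be 4/c
    times the value at 0, so that the smallness condition holds with equality.\<close>
  have "\<exists>r\<in>L. Gram r - Lam descent = 0 \<and> norm r \<le> 4 / c * norm (Gram 0 - Lam descent)
      \<and> norm r \<le> 4 / c * norm (Gram 0 - Lam descent)"
  proof (rule coercive_perturbation_zero[OF L GL Gram_diff Gram_le c coercive])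
    show "Gram r - Lam descent \<in> L" for r by (intro subspace_diff L GL range H)
    show "norm (Gram r - Lam descent - (Gram s - Lam descent) - (Gram r - Gram s)) \<le> c / 4 * norm (r - s)" for r s
      using c by simp
  qed (use c in auto)
  then obtain z where z: "z \<in> L" "Gram z = Lam descent" by auto
  \<comment> \<open>By the choice of z, this is the part of the negative cost gradient in the kernel
    of \<open>Lam\<close>. Once its seminorm is zero, \<open>descent\<close> and
    \<open>Ladj z\<close> have the same inner products, which is the claim.\<close>
  define h where "h = (\<lambda>t. descent t - Ladj z t)"
  have h: "h \<in> L2_space T" unfolding h_def by (rule L2_space_diff[OF H Ladj_L2])
  have Lh: "Lam h = 0" unfolding h_def Lam_diff[OF H Ladj_L2] using z(2) by (simp add: Gram_def)
  have hv: "L2_inner T h v = L2_inner T descent v - z \<bullet> Lam v" if v: "v \<in> L2_space T" for v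
    unfolding h_def L2_inner_diff_left[OF H Ladj_L2 v] Ladj_inner[OF v] ..
  have gh: "L2_inner T descent h = (N h)\<^sup>2" using hv[OF h] Lh by (simp add: L2_inner_self)
  have "N h = 0"
  proof (rule ccontr)
    assume "N h \<noteq> 0"
    then have Nh: "N h > 0" using L2_norm_nonneg[of T h] by simp
    \<comment> \<open>\<open>A\<close> times the step size bounds the control increments, because
      the corrections are no larger than the step. \<open>Q\<close> collects the second order errors
      of the cost: the effect of the correction through \<open>descent\<close>, and the remainder of
      the cost expansion.\<close>
    define A where "A = N h + lip"
    define Q where "Q = N descent * (lip * (4 / c * (second * A\<^sup>2))) + third * A\<^sup>2"
    define a where "a = A + second * (2 * A) * lip + second * A\<^sup>2 + Q + 1"
    define b where "b = min \<epsilon>0 (min (c / 4) ((N h)\<^sup>2))"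
    have A0: "A \<ge> 0" using Nh lip_nonneg by (simp add: A_def)
    have Q0: "Q \<ge> 0" unfolding Q_def using c second_nonneg third_nonneg lip_nonneg
      by (intro add_nonneg_nonneg mult_nonneg_nonneg L2_norm_nonneg) auto
    have parts: "0 \<le> second * (2 * A) * lip" "0 \<le> second * A\<^sup>2"
      using second_nonneg A0 lip_nonneg by auto
    have "a > 0" using parts Q0 A0 unfolding a_def by linarith
    moreover have "b > 0" using \<epsilon>0 c Nh by (simp add: b_def)
    ultimately have ab: "a > 0" "b > 0" by blast+
    define \<epsilon> where "\<epsilon> = b / (2 * a)"
    have \<epsilon>: "\<epsilon> > 0" "\<epsilon> * a < b" using ab by (auto simp: \<epsilon>_def)
    have sm: "\<epsilon> * x < b" if "x \<le> a" for x
      using mult_left_mono[OF that, of \<epsilon>] \<epsilon> by linarith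
    have small: "\<epsilon> * A < \<epsilon>0" "\<epsilon> * (second * (2 * A) * lip) < c / 4"
        "\<epsilon> * (second * A\<^sup>2) < c / 4" "\<epsilon> * Q < (N h)\<^sup>2"
      using sm[of A] sm[of "second * (2 * A) * lip"] sm[of "second * A\<^sup>2"] sm[of Q] parts Q0 A0
      by (auto simp: a_def b_def)
    \<comment> \<open>To first order this control increment moves the end point by
      \<open>Gram r\<close>, since \<open>Lam h = 0\<close>. The unknown r in \<open>L\<close> is
      the correction that brings the end point back to the target.\<close>
    define d where "d r = (\<lambda>t. \<epsilon> *\<^sub>R h t + Ladj r t)" for r
    define U where "U r = (\<lambda>t. ubar t + d r t)" for r
    have \<epsilon>h: "(\<lambda>t. \<epsilon> *\<^sub>R h t) \<in> L2_space T"
        "N (\<lambda>t. \<epsilon> *\<^sub>R h t) = \<epsilon> * N h"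
      using L2_space_scaleR[OF h, of \<epsilon>] \<epsilon> by auto
    have d: "d r \<in> L2_space T" for r unfolding d_def by (rule L2_space_add(1)[OF \<epsilon>h(1) Ladj_L2])
    have U: "U r \<in> L2_space T" for r unfolding U_def by (rule L2_space_add(1)[OF ubar d])
    have dU: "(\<lambda>t. U r t - ubar t) = d r" for r by (simp add: U_def)
    have Nd: "N (d r) \<le> \<epsilon> * N h + lip * norm r" for r
      using L2_space_add(2)[OF \<epsilon>h(1) Ladj_L2[of r]] \<epsilon>h(2) Ladj_norm_le[of r]
        unfolding d_def by linarith
    have Nd': "N (d r) \<le> \<epsilon> * A" if "norm r \<le> \<epsilon>" for r
      using Nd[of r] mult_left_mono[OF that lip_nonneg] by (simp add: A_def algebra_simps)
    have Ld: "Lam (d r) = Gram r" for r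
      using Lam_combination[OF h Ladj_L2, of \<epsilon> 1 r] Lh by (simp add: d_def Gram_def)
    have UU: "(\<lambda>t. U r t - U s t) = (\<lambda>t. Ladj r t - Ladj s t)" for r s
      by (simp add: U_def d_def)
    define Y where "Y r = (SOME y. state (U r) y)" for r
    have Y: "state (U r) (Y r)" for r unfolding Y_def using state_exists[OF U] by (rule someI_ex)
    define \<Psi> where "\<Psi> r = Y r T - ybar T" for r
    have \<Psi>0: "norm (\<Psi> 0) \<le> second * (\<epsilon> * A)\<^sup>2"
    proof -
      have "norm (\<Psi> 0 - Lam (d 0)) \<le> second * (N (d 0))\<^sup>2"
        unfolding \<Psi>_def using differentiability_end[OF U Y, of 0] by (simp add: dU)
      moreover have "second * (N (d 0))\<^sup>2 \<le> second * (\<epsilon> * A)\<^sup>2"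
        using Nd'[of 0] \<epsilon> by (intro mult_left_mono second_nonneg power_mono L2_norm_nonneg) auto
      ultimately show ?thesis by (simp add: Ld Gram_0)
    qed
    \<comment> \<open>The uncorrected control misses the target only to second order, and the
      solution r inherits that order through its bound by the value at 0. Keeping r within radius
      \<epsilon> keeps all trial controls in the region where end points stay in
      \<open>L\<close>.\<close>
    have "\<exists>r\<in>L. \<Psi> r = 0 \<and> norm r \<le> \<epsilon> \<and> norm r \<le> 4 / c * norm (\<Psi> 0)"
    proof (rule coercive_perturbation_zero[OF L GL Gram_diff Gram_le c coercive])
      show "\<Psi> r \<in> L" if "norm r \<le> \<epsilon>" for r
        unfolding \<Psi>_def using Nd'[OF that] small(1) by (intro near[OF U Y]) (simp add: dU)
      show "norm (\<Psi> r - \<Psi> s - (Gram r - Gram s)) \<le> c / 4 * norm (r - s)"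
        if "norm r \<le> \<epsilon>" "norm s \<le> \<epsilon>" for r s
      proof -
        have "norm (Y r T - Y s T - Lam (\<lambda>t. U r t - U s t))
            \<le> second * (N (d r) + N (d s)) * N (\<lambda>t. U r t - U s t)"
          using strict_differentiability_end[OF U U Y Y, of r s] by (simp only: dU)
        moreover have "Lam (\<lambda>t. U r t - U s t) = Gram r - Gram s"
          unfolding UU Gram_def by (rule Lam_diff[OF Ladj_L2 Ladj_L2])
        moreover have "second * (N (d r) + N (d s)) * N (\<lambda>t. U r t - U s t)
            \<le> second * (2 * (\<epsilon> * A)) * (lip * norm (r - s))"
          unfolding UU using Nd'[OF that(1)] Nd'[OF that(2)] Ladj_diff_norm_le[of r s] \<epsilon>(1) A0
          by (intro mult_mono mult_left_mono second_nonneg mult_nonneg_nonneg L2_norm_nonneg) auto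
        moreover have "second * (2 * (\<epsilon> * A)) * (lip * norm (r - s))
            = \<epsilon> * (second * (2 * A) * lip) * norm (r - s)"
          by (simp add: mult_ac)
        moreover have "\<epsilon> * (second * (2 * A) * lip) * norm (r - s) \<le> c / 4 * norm (r - s)"
          using small(2) by (intro mult_right_mono) auto
        ultimately show ?thesis by (simp add: \<Psi>_def)
      qed
      have "second * (\<epsilon> * A)\<^sup>2 = \<epsilon> * (\<epsilon> * (second * A\<^sup>2))"
        by (simp add: power2_eq_square mult_ac)
      also have "\<dots> \<le> \<epsilon> * (c / 4)"
        using small(3) \<epsilon>(1) by (intro mult_left_mono) auto
      finally show "norm (\<Psi> 0) \<le> c * \<epsilon> / 4" using \<Psi>0 by (simp add: mult.commute)
    qed (use \<epsilon>(1) in auto)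
    then obtain r where r: "\<Psi> r = 0" "norm r \<le> \<epsilon>" "norm r \<le> 4 / c * norm (\<Psi> 0)"
      by blast
    have "cost T g0 ybar ubar \<le> cost T g0 (Y r) (U r)"
      using r(1) by (intro optimal U Y) (simp add: \<Psi>_def)
    moreover obtain \<eta> where \<eta>: "lin (d r) \<eta>" using lin_exists[OF d] by blast
    have "\<bar>cost T g0 (Y r) (U r) - cost T g0 ybar ubar - dcost (d r) \<eta>\<bar> \<le> third * (N (d r))\<^sup>2"
      using cost_expansion[OF U Y, of r \<eta>] \<eta> by (simp add: dU)
    moreover have "third * (N (d r))\<^sup>2 \<le> third * (\<epsilon> * A)\<^sup>2"
      using Nd'[OF r(2)] by (intro mult_left_mono third_nonneg power_mono L2_norm_nonneg)
    \<comment> \<open>The linear change of the cost is a first order gain from h plus a second order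
      loss from the correction; for a small step the gain wins, against optimality.\<close>
    moreover have "dcost (d r) \<eta> \<le> - \<epsilon> * (N h)\<^sup>2
        + N descent * (lip * (4 / c * (second * (\<epsilon> * A)\<^sup>2)))"
    proof -
      have "dcost (d r) \<eta> = - L2_inner T descent (d r)" using descent_inner[OF d \<eta>] by simp
      also have "L2_inner T descent (d r) = \<epsilon> * (N h)\<^sup>2 + L2_inner T descent (Ladj r)"
        using L2_inner_integrable(1)[OF H h] L2_inner_integrable(1)[OF H Ladj_L2[of r]] gh
        by (simp add: L2_inner_def d_def inner_add_right)
      finally have "dcost (d r) \<eta> \<le> - \<epsilon> * (N h)\<^sup>2 + N descent * N (Ladj r)"
        using L2_inner_integrable(2)[OF H Ladj_L2[of r]] by simp
      moreover have "norm r \<le> 4 / c * (second * (\<epsilon> * A)\<^sup>2)"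
        using r(3) mult_left_mono[OF \<Psi>0, of "4 / c"] c by simp
      then have "lip * norm r \<le> lip * (4 / c * (second * (\<epsilon> * A)\<^sup>2))"
        by (rule mult_left_mono[OF _ lip_nonneg])
      then have "N (Ladj r) \<le> lip * (4 / c * (second * (\<epsilon> * A)\<^sup>2))"
        using Ladj_norm_le[of r] by linarith
      then have "N descent * N (Ladj r) \<le> N descent * (lip * (4 / c * (second * (\<epsilon> * A)\<^sup>2)))"
        by (rule mult_left_mono[OF _ L2_norm_nonneg])
      ultimately show ?thesis by linarith
    qed
    ultimately have "0 \<le> - \<epsilon> * (N h)\<^sup>2
        + N descent * (lip * (4 / c * (second * (\<epsilon> * A)\<^sup>2))) + third * (\<epsilon> * A)\<^sup>2"
      by linarith
    also have "\<dots> = \<epsilon> * (\<epsilon> * Q - (N h)\<^sup>2)"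
      by (simp add: Q_def power2_eq_square algebra_simps)
    finally have "0 \<le> \<epsilon> * Q - (N h)\<^sup>2" using \<epsilon>(1) by (simp add: zero_le_mult_iff)
    then show False using small(4) by linarith
  qed
  have "z \<bullet> Lam v + dcost v \<xi> = 0" if v: "v \<in> L2_space T" and l: "lin v \<xi>" for v \<xi>
    using L2_inner_integrable(2)[OF h v] hv[OF v] descent_inner[OF v l] \<open>N h = 0\<close> by simp
  with z(1) show ?thesis by blast
qed

section \<open>The two cases of the multiplier rule\<close>

theorem multiplier_exists:
  assumes optimal: "\<And>u y. u \<in> L2_space T \<Longrightarrow> state u y \<Longrightarrow>
      y T = ybar T \<Longrightarrow> cost T g0 ybar ubar \<le> cost T g0 y u"
    and fc: "finite_codimensional attainable"
  shows "\<exists>z0 z. (z0 = 0 \<or> z0 = 1) \<and> (z0 \<noteq> 0 \<or> z \<noteq> 0) \<and>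
    (\<forall>v \<xi>. v \<in> L2_space T \<longrightarrow> lin v \<xi> \<longrightarrow> z \<bullet> \<xi> T
        + z0 * dcost v \<xi> = 0) \<and> (z \<noteq> 0 \<longrightarrow> approachable z)"
proof -
  have sym: "- d \<in> attainable" if d: "d \<in> attainable" for d
  proof -
    obtain v where v: "d = Lam v" "v \<in> L2_space T" "N v \<le> 1" using d unfolding attainable_eq by blast
    show ?thesis using attainable_scaleR[OF v(2), of "-1"] v by simp
  qed
  have "N (\<lambda>_. 0::'v) = 0" by (simp add: L2_norm_def)
  then have zero: "0 \<in> attainable" unfolding attainable_def using L2_zero lin_zero by force
  obtain L e B where L: "subspace L" "closed L" and DL: "attainable \<subseteq> L" and e: "e > 0"
    and ball: "\<And>l. l \<in> L \<Longrightarrow> norm l < e \<Longrightarrow> l \<in> closure attainable"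
    and B: "finite B" "\<And>w. \<exists>a\<in>L. \<exists>b\<in>span B. w = a + b"
  proof (rule finite_codimensional_symmetric[OF fc attainable_convex _ zero])
    show "- d \<in> attainable" if "d \<in> attainable" for d using that by (rule sym)
  qed (rule that)
  obtain Z where Z: "finite Z" "\<And>z l. z \<in> Z \<Longrightarrow> l \<in> L \<Longrightarrow>
      z \<bullet> l = 0" "\<And>w. (\<And>z. z \<in> Z \<Longrightarrow> z \<bullet> w = 0) \<Longrightarrow> w \<in> L"
    by (rule finite_codim_annihilators[OF L B]) blast
  \<comment> \<open>Dividing by \<open>N v + 1\<close> instead of \<open>N v\<close> brings every
    control into the unit ball without treating seminorm zero separately.\<close>
  have range: "Lam v \<in> L" if v: "v \<in> L2_space T" for v
  proof -
    have p: "N v + 1 > 0" using L2_norm_nonneg[of T v] by linarith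
    have "\<bar>inverse (N v + 1)\<bar> * N v \<le> 1"
      using p L2_norm_nonneg[of T v] by (simp add: field_simps)
    then have "inverse (N v + 1) *\<^sub>R Lam v \<in> L" using attainable_scaleR[OF v] DL by blast
    then have "(N v + 1) *\<^sub>R (inverse (N v + 1) *\<^sub>R Lam v) \<in> L"
      by (rule subspace_scale[OF L(1)])
    then show ?thesis using p by simp
  qed
  \<comment> \<open>On the attainable set the functional of r is at most \<open>N (Ladj r)\<close>,
    by Cauchy-Schwarz, and so also on the closure. The closure contains the multiple of r of norm
    e/2, whence \<open>e / 2 * norm r\<close> is at most \<open>N (Ladj r)\<close>; squaring gives
    the claim.\<close>
  have coercive: "(e / 2)\<^sup>2 * (norm r)\<^sup>2 \<le> r \<bullet> Gram r" if r: "r \<in> L" for r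
  proof (cases "r = 0")
    case False
    have "r \<bullet> d \<le> N (Ladj r)" if "d \<in> closure attainable" for d
    proof -
      have "closure attainable \<subseteq> {d. r \<bullet> d \<le> N (Ladj r)}"
      proof (rule closure_minimal)
        show "attainable \<subseteq> {d. r \<bullet> d \<le> N (Ladj r)}"
        proof
          fix d assume "d \<in> attainable"
          then obtain v where v: "d = Lam v" "v \<in> L2_space T" "N v \<le> 1"
            unfolding attainable_eq by blast
          have "r \<bullet> d \<le> N (Ladj r) * N v"
            using L2_inner_integrable(2)[OF Ladj_L2[of r] v(2)] Ladj_inner[OF v(2), of r] v(1) by simp
          also have "\<dots> \<le> N (Ladj r) * 1" by (rule mult_left_mono[OF v(3) L2_norm_nonneg])
          finally show "d \<in> {d. r \<bullet> d \<le> N (Ladj r)}" by simp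
        qed
      qed (rule closed_halfspace_le)
      then show ?thesis using that by blast
    qed
    moreover have "(e / 2 / norm r) *\<^sub>R r \<in> closure attainable"
      using False e r L(1) by (intro ball subspace_scale) auto
    ultimately have le: "r \<bullet> ((e / 2 / norm r) *\<^sub>R r) \<le> N (Ladj r)" by blast
    have eq: "r \<bullet> ((e / 2 / norm r) *\<^sub>R r) = e / 2 * norm r"
      using False by (simp add: power2_norm_eq_inner[symmetric] power2_eq_square)
    have "(e / 2 * norm r)\<^sup>2 \<le> (N (Ladj r))\<^sup>2"
      using le[unfolded eq] e by (intro power_mono) auto
    then show ?thesis unfolding Gram_inner power_mult_distrib .
  qed simp
  show ?thesis
  proof (cases "\<exists>z. (\<forall>l\<in>L. z \<bullet> l = 0) \<and> approachable z")
    case True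
    then obtain z where z: "\<forall>l\<in>L. z \<bullet> l = 0" "approachable z" by blast
    have "z \<noteq> 0"
    proof
      assume "z = 0"
      then show False using z(2) unfolding approachable_def by (auto dest: spec[of _ 1])
    qed
    moreover have "z \<bullet> \<xi> T + 0 * dcost v \<xi> = 0"
      if "v \<in> L2_space T" "lin v \<xi>" for v \<xi>
      using z(1) range[OF that(1)] Lam_eq[OF that] by simp
    ultimately show ?thesis using z(2) by (intro exI[of _ 0] exI[of _ z]) blast
  next
    case False
    have na: "\<not> approachable z \<and> \<not> approachable (- z)" if "z \<in> Z" for z
    proof -
      have "\<forall>l\<in>L. z \<bullet> l = 0" "\<forall>l\<in>L. (- z) \<bullet> l = 0"
        using Z(2)[OF that] by auto
      then show ?thesis using False by blast
    qed
    obtain \<epsilon>0 where \<epsilon>0: "\<epsilon>0 > 0" and *: "\<And>u y. u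
        \<in> L2_space T \<Longrightarrow> state u y \<Longrightarrow>
        N (\<lambda>t. u t - ubar t) < \<epsilon>0 \<Longrightarrow> (\<forall>z\<in>Z. z \<bullet> (y T - ybar T) = 0)"
      using not_approachable_imp_in_subspace[OF Z(1) na] by blast
    have near: "y T - ybar T \<in> L"
      if "u \<in> L2_space T" "state u y" "N (\<lambda>t. u t - ubar t) < \<epsilon>0" for u y
      using *[OF that] by (intro Z(3)) blast
    have "\<exists>z\<in>L. \<forall>v \<xi>. v \<in> L2_space T \<longrightarrow> lin v \<xi>
        \<longrightarrow> z \<bullet> Lam v + dcost v \<xi> = 0"
    proof (rule regular_multiplier[where L=L and c="(e / 2)\<^sup>2" and ?\<epsilon>0.0=\<epsilon>0])
      show "(e / 2)\<^sup>2 > 0" using e by simp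
    qed (fact optimal L range coercive \<epsilon>0 near)+
    then obtain z where z: "z \<in> L" "\<And>v \<xi>. v \<in> L2_space T \<Longrightarrow>
        lin v \<xi> \<Longrightarrow> z \<bullet> Lam v + dcost v \<xi> = 0"
      by blast
    \<comment> \<open>The direction is \<open>Ladj z\<close>: because z lies in \<open>L\<close>,
      coercivity makes its pairing with \<open>Gram z\<close> positive.\<close>
    have "approachable z" if "z \<noteq> 0"
    proof (rule approachable_if_controllable[OF Ladj_L2[of z]])
      have "(e / 2)\<^sup>2 * (norm z)\<^sup>2 > 0" using that e by simp
      then show "z \<bullet> Lam (Ladj z) > 0" using coercive[OF z(1)] by (simp add: Gram_def)
    qed
    moreover have "z \<bullet> \<xi> T + 1 * dcost v \<xi> = 0"
      if "v \<in> L2_space T" "lin v \<xi>" for v \<xi>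
      using z(2)[OF that] Lam_eq[OF that] by simp
    ultimately show ?thesis by (intro exI[of _ 1] exI[of _ z]) simp
  qed
qed

text \<open>The radii are \<open>1 / Suc k\<close>. End points converge by Lipschitz dependence on
  the control; costs converge by the second order expansion, whose linear term is controlled by the
  norm of \<open>descent\<close>.\<close>

lemma approaching_sequence:
  assumes z: "approachable z"
  shows "\<exists>(u :: nat \<Rightarrow> real \<Rightarrow> 'v) (y :: nat \<Rightarrow> real \<Rightarrow> 'x).
    (\<forall>k. u k \<in> L2_space T \<and> state (u k) (y k)) \<and> (\<lambda>k. N (\<lambda>t. u k t
        - ubar t)) \<longlonglongrightarrow> 0 \<and>
    (\<lambda>k. y k T) \<longlonglongrightarrow> ybar T
        \<and> (\<lambda>k. cost T g0 (y k) (u k)) \<longlonglongrightarrow> cost T g0 ybar ubar \<and>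
    (\<forall>k. z \<bullet> (y k T - ybar T) > 0)"
proof -
  have "\<forall>k. \<exists>p. fst p \<in> L2_space T \<and> state (fst p) (snd p)
      \<and> N (\<lambda>t. fst p t - ubar t) < inverse (real (Suc k)) \<and> z \<bullet> (snd p T - ybar T) > 0"
  proof
    fix k
    have "inverse (real (Suc k)) > 0" by simp
    then obtain u y where "u \<in> L2_space T" "state u y"
        "N (\<lambda>t. u t - ubar t) < inverse (real (Suc k))" "z \<bullet> (y T - ybar T) > 0"
      using z unfolding approachable_def by blast
    then show "\<exists>p. fst p \<in> L2_space T \<and> state (fst p) (snd p) \<and> N (\<lambda>t. fst p t
        - ubar t) < inverse (real (Suc k)) \<and> z \<bullet> (snd p T - ybar T) > 0"
      by (intro exI[of _ "(u, y)"]) simp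
  qed
  then obtain p where p: "\<And>k. fst (p k) \<in> L2_space T" "\<And>k. state (fst (p k)) (snd (p k))"
    "\<And>k. N (\<lambda>t. fst (p k) t - ubar t) < inverse (real (Suc k))"
        "\<And>k. z \<bullet> (snd (p k) T - ybar T) > 0"
    unfolding choice_iff by blast
  define n where "n k = N (\<lambda>t. fst (p k) t - ubar t)" for k
  have n0: "n \<longlonglongrightarrow> 0"
  proof (rule tendsto_sandwich[OF _ _ tendsto_const LIMSEQ_inverse_real_of_nat])
    show "\<forall>\<^sub>F k in sequentially. 0 \<le> n k" by (simp add: n_def L2_norm_nonneg)
    show "\<forall>\<^sub>F k in sequentially. n k \<le> inverse (real (Suc k))"
      using p(3) by (intro always_eventually allI) (simp add: n_def less_imp_le)
  qed
  have yb: "norm (snd (p k) T - ybar T) \<le> lip * n k" for k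
    unfolding n_def by (rule state_Lipschitz[OF p(1) ubar p(2) state_ubar T_in])
  have ylim: "(\<lambda>k. snd (p k) T - ybar T) \<longlonglongrightarrow> 0"
  proof (rule Lim_null_comparison[OF always_eventually[OF allI[OF yb]]])
    show "(\<lambda>k. lip * n k) \<longlonglongrightarrow> 0"
      using tendsto_mult[OF tendsto_const n0, of lip] by simp
  qed
  have cb: "norm (cost T g0 (snd (p k)) (fst (p k)) - cost T g0 ybar ubar)
      \<le> N descent * n k + third * (n k)\<^sup>2" for k
  proof -
    have d: "(\<lambda>t. fst (p k) t - ubar t) \<in> L2_space T" by (rule L2_space_diff[OF p(1) ubar])
    obtain \<eta> where \<eta>: "lin (\<lambda>t. fst (p k) t - ubar t) \<eta>"
      using lin_exists[OF d] by blast
    show ?thesis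
      using cost_expansion[OF p(1) p(2) \<eta>] descent_inner[OF d \<eta>] L2_inner_integrable(2)[OF descent_L2 d]
      unfolding n_def real_norm_def by linarith
  qed
  have clim: "(\<lambda>k. cost T g0 (snd (p k)) (fst (p k)) - cost T g0 ybar ubar) \<longlonglongrightarrow> 0"
  proof (rule Lim_null_comparison[OF always_eventually[OF allI[OF cb]]])
    have "(\<lambda>k. N descent * n k + third * (n k)\<^sup>2)
        \<longlonglongrightarrow> N descent * 0 + third * 0\<^sup>2"
      by (intro tendsto_intros n0)
    then show "(\<lambda>k. N descent * n k + third * (n k)\<^sup>2) \<longlonglongrightarrow> 0" by simp
  qed
  show ?thesis
    using p(1,2,4) n0 LIM_zero_cancel[OF ylim] LIM_zero_cancel[OF clim]
    by (intro exI[of _ "\<lambda>k. fst (p k)"] exI[of _ "\<lambda>k. snd (p k)"]) (simp add: n_def[abs_def])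
qed

end

section \<open>From the hypotheses to the abstract control problem\<close>

text \<open>Quadratic growth of a function with Lipschitz derivative bounds the derivative at 0:
  along a unit vector it is at most the two values, 2C and C, plus the linearization error L. The
  growth of \<open>g0u\<close> is obtained in this way.\<close>

lemma derivative_bound_at_origin:
  fixes g :: "'v::real_normed_vector \<Rightarrow> real" and g' :: "'v \<Rightarrow> ('v \<Rightarrow>\<^sub>L real)"
  assumes der: "\<And>u. (g has_derivative blinfun_apply (g' u)) (at u)"
    and lip: "\<And>u. norm (g' u - g' 0) \<le> L * norm u" and L: "L > 0"
    and growth: "\<And>u. \<bar>g u\<bar> \<le> C * (1 + (norm u)\<^sup>2)" and C: "C > 0"
  shows "norm (g' 0) \<le> 3 * C + L"
proof (rule norm_blinfun_bound)
  fix w :: 'v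
  show "norm (g' 0 w) \<le> (3 * C + L) * norm w"
  proof (cases "w = 0")
    case False
    define e where "e = (1 / norm w) *\<^sub>R w"
    have e: "norm e = 1" using False by (simp add: e_def)
    have "norm (g e - g 0 - g' 0 (e - 0)) \<le> L * norm (e - 0)"
    proof (rule linearization_error[OF der])
      fix x assume "x \<in> closed_segment e 0"
      then have "norm (x - 0) \<le> norm (e - 0) + norm (0 - 0 :: 'v)" by (rule norm_in_segment_le)
      then have "L * norm x \<le> L * 1" using e L by (intro mult_left_mono) auto
      then show "norm (g' x - g' 0) \<le> L" using lip[of x] by linarith
    qed
    then have "\<bar>g e - g 0 - g' 0 e\<bar> \<le> L" using e by simp
    moreover have "\<bar>g e\<bar> \<le> 2 * C" "\<bar>g 0\<bar> \<le> C"
      using growth[of e] growth[of 0] e by simp_all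
    ultimately have "\<bar>g' 0 e\<bar> \<le> 3 * C + L" by linarith
    moreover have "g' 0 e = g' 0 w / norm w" by (simp add: e_def blinfun.scaleR_right)
    ultimately show ?thesis using False by (simp add: field_simps)
  qed simp
qed (use L C in simp)

theorem corollary3p1:
  fixes T :: real
    and D :: "'x::{real_inner, banach} set" and A :: "'x \<Rightarrow> 'x"
    and S :: "real \<Rightarrow> ('x \<Rightarrow>\<^sub>L 'x)"
    and y0 y1 :: 'x
    and F :: "real \<Rightarrow> 'x \<Rightarrow> 'v::{real_inner, banach} \<Rightarrow> 'x"
    and Fy :: "real \<Rightarrow> 'x \<Rightarrow> 'v \<Rightarrow> ('x \<Rightarrow>\<^sub>L 'x)"
    and Fu :: "real \<Rightarrow> 'x \<Rightarrow> 'v \<Rightarrow> ('v \<Rightarrow>\<^sub>L 'x)"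
    and g0 :: "real \<Rightarrow> 'x \<Rightarrow> 'v \<Rightarrow> real"
    and g0y :: "real \<Rightarrow> 'x \<Rightarrow> 'v \<Rightarrow> ('x \<Rightarrow>\<^sub>L real)"
    and g0u :: "real \<Rightarrow> 'x \<Rightarrow> 'v \<Rightarrow> ('v \<Rightarrow>\<^sub>L real)"
    and L3 L4 L5 L6 \<delta>2 \<delta>3 :: real
    and ubar :: "real \<Rightarrow> 'v" and ybar :: "real \<Rightarrow> 'x"
  assumes T_pos: "T > 0"
    and semigroup: "C0_semigroup S"
    and generator: "generator_of D A S"
    and F_meas: "\<And>y u. strongly_measurable (lebesgue_on {0..T}) (\<lambda>t. F t y u)"
    and g0_meas: "\<And>y u. strongly_measurable (lebesgue_on {0..T}) (\<lambda>t. g0 t y u)"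
    and F_C1: "\<And>t. t \<in> {0..T} \<Longrightarrow> C1_with_partials (F t) (Fy t) (Fu t)"
    and g0_C1: "\<And>t. t \<in> {0..T} \<Longrightarrow> C1_with_partials (g0 t) (g0y t) (g0u t)"
    and F_partials_meas: "partials_strongly_measurable T Fy Fu"
    and g0_partials_meas: "partials_strongly_measurable T g0y g0u"
    and const_pos: "L3 > 0" "L4 > 0" "L5 > 0" "L6 > 0" "\<delta>2 > 0" "\<delta>3 > 0"
    and F_bound: "\<And>t u. t \<in> {0..T} \<Longrightarrow> norm (F t 0 u) \<le> L3 * norm u"
    and dF_bound: "\<And>t y u. t \<in> {0..T} \<Longrightarrow> norm (Fy t y u) + norm (Fu t y u) \<le> L3"
    and g0_bound: "\<And>t y u. t \<in> {0..T} \<Longrightarrow> \<bar>g0 t y u\<bar> \<le> L3 * (1 + (norm y)\<^sup>2 + (norm u)\<^sup>2)"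
    and g0y_bound: "\<And>t y u. t \<in> {0..T} \<Longrightarrow> norm (g0y t y u) \<le> L3 * (1 + norm y + norm u)"
    and dF_Lipschitz_y: "\<And>t u a b. t \<in> {0..T} \<Longrightarrow> norm (a - b) \<le> \<delta>2 \<Longrightarrow>
          norm (Fy t a u - Fy t b u) + norm (Fu t a u - Fu t b u) \<le> L4 * norm (a - b)"
    and dF_Lipschitz_u: "\<And>t y u1 u2. t \<in> {0..T} \<Longrightarrow>
          norm (Fy t y u1 - Fy t y u2) + norm (Fu t y u1 - Fu t y u2) \<le> L5 * norm (u1 - u2)"
    and dg0_Lipschitz: "\<And>t a b u1 u2. t \<in> {0..T} \<Longrightarrow> norm (a - b) \<le> \<delta>3 \<Longrightarrow>
          norm (g0y t a u1 - g0y t b u2) + norm (g0u t a u1 - g0u t b u2)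
            \<le> L6 * (norm (a - b) + norm (u1 - u2))"
    and ubar_L2: "ubar \<in> L2_space T"
    and ybar_state: "mild_solution T S (\<lambda>t y. F t y (ubar t)) y0 ybar"
    and ybar_target: "ybar T = y1"
    and optimal: "\<And>u y. u \<in> L2_space T \<Longrightarrow> mild_solution T S (\<lambda>t y. F t y (u t)) y0 y \<Longrightarrow>
          y T = y1 \<Longrightarrow> cost T g0 ybar ubar \<le> cost T g0 y u"
    and finite_codim: "finite_codimensional
          {\<xi> T |\<xi> v. v \<in> L2_space T \<and> L2_norm T v \<le> 1 \<and>
             mild_solution T S
               (\<lambda>t \<eta>. Fy t (ybar t) (ubar t) \<eta> + Fu t (ybar t) (ubar t) (v t)) 0 \<xi>}"
  shows "\<exists>(z0::real) (z :: 'x \<Rightarrow>\<^sub>L real).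
    z0 \<ge> 0 \<and> (z0, z) \<noteq> (0, 0) \<and>
    (\<exists>\<psi>. adjoint_mild_solution T S
       (\<lambda>t p. dual_op (Fy t (ybar t) (ubar t)) p - z0 *\<^sub>R g0y t (ybar t) (ubar t)) (- z) \<psi>) \<and>
    (\<forall>\<psi>. adjoint_mild_solution T S
       (\<lambda>t p. dual_op (Fy t (ybar t) (ubar t)) p - z0 *\<^sub>R g0y t (ybar t) (ubar t)) (- z) \<psi> \<longrightarrow>
       (AE t in lebesgue_on {0<..<T}.
          ((\<lambda>u. Hamiltonian F g0 t (ybar t) u z0 (\<psi> t)) has_derivative (\<lambda>_. 0)) (at (ubar t)))) \<and>
    (z0 \<noteq> 0 \<longrightarrow>
       (\<exists>\<psi>. adjoint_mild_solution T S
          (\<lambda>t p. dual_op (Fy t (ybar t) (ubar t)) p - g0y t (ybar t) (ubar t)) (- (z /\<^sub>R z0)) \<psi>) \<and>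
       (\<forall>\<psi>. adjoint_mild_solution T S
          (\<lambda>t p. dual_op (Fy t (ybar t) (ubar t)) p - g0y t (ybar t) (ubar t)) (- (z /\<^sub>R z0)) \<psi> \<longrightarrow>
          (AE t in lebesgue_on {0<..<T}.
             ((\<lambda>u. Hamiltonian F g0 t (ybar t) u 1 (\<psi> t)) has_derivative (\<lambda>_. 0)) (at (ubar t))))) \<and>
    (z \<noteq> 0 \<longrightarrow>
       (\<exists>zhat. (\<forall>x. z x = zhat \<bullet> x) \<and>
          (\<exists>(u :: nat \<Rightarrow> real \<Rightarrow> 'v) (y :: nat \<Rightarrow> real \<Rightarrow> 'x).
             (\<forall>k. u k \<in> L2_space T \<and> mild_solution T S (\<lambda>t x. F t x (u k t)) y0 (y k)) \<and>
             (\<lambda>k. L2_norm T (\<lambda>t. u k t - ubar t)) \<longlonglongrightarrow> 0 \<and>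
             (\<forall>k. y k T \<noteq> y1) \<and>
             (\<lambda>k. y k T) \<longlonglongrightarrow> y1 \<and>
             (\<lambda>k. cost T g0 (y k) (u k)) \<longlonglongrightarrow> cost T g0 ybar ubar \<and>
             (\<forall>k. zhat \<bullet> (y k T - y1) > 0))))"
proof -
  \<comment> \<open>The sum dominates each given constant, and \<open>3 * L3 + 2 * L6\<close> covers
    the bound \<open>3 * L3 + L6\<close> for \<open>g0u\<close> at the origin.\<close>
  define M where "M = 3 * L3 + L4 + L5 + 2 * L6"
  have M: "M > 0" "L3 \<le> M" "L4 \<le> M" "L5 \<le> M" "L6 \<le> M" "3 * L3 + 2 * L6 \<le> M"
    using const_pos by (simp_all add: M_def)
  obtain K where K: "K \<ge> 1" "\<And>t. 0 \<le> t \<Longrightarrow> t \<le> T \<Longrightarrow> norm (S t) \<le> K"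
    by (rule C0_semigroup_bounded[OF semigroup, where T=T]) blast
  have Fyu: "norm (Fy t y u) \<le> L3" "norm (Fu t y u) \<le> L3" if "t \<in> {0..T}" for t y u
    using dF_bound[OF that, of y u] norm_ge_zero[of "Fy t y u"] norm_ge_zero[of "Fu t y u"] by linarith+
  have joint: "norm (f y u - f y' u') \<le> M * (norm (y - y') + norm (u - u'))"
    if "\<And>y y' u. norm (f y u - f y' u) \<le> C * norm (y - y')" "\<And>y u u'. norm (f y u - f y u')
        \<le> C' * norm (u - u')" "C \<le> M" "C' \<le> M"
    for f :: "'x \<Rightarrow> 'v \<Rightarrow> 'b::real_normed_vector" and y y' u u' C C'
  proof -
    have "norm (f y u - f y' u') \<le> norm (f y u - f y' u) + norm (f y' u - f y' u')"
      using norm_triangle_ineq[of "f y u - f y' u" "f y' u - f y' u'"] by simp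
    also have "\<dots> \<le> M * norm (y - y') + M * norm (u - u')"
      using that(1)[of y u y'] that(2)[of y' u u'] mult_right_mono[OF that(3) norm_ge_zero[of "y - y'"]]
        mult_right_mono[OF that(4) norm_ge_zero[of "u - u'"]] by linarith
    finally show ?thesis by (simp add: distrib_left)
  qed
  have Fy_lip: "norm (Fy t y u - Fy t y' u') \<le> M * (norm (y - y') + norm (u - u'))"
    and Fu_lip: "norm (Fu t y u - Fu t y' u') \<le> M * (norm (y - y') + norm (u - u'))"
    if t: "t \<in> {0..T}" for t y u y' u'
  proof -
    have y1: "norm (Fy t a u - Fy t b u) \<le> L4 * norm (a - b)" and y2: "norm (Fu t a u - Fu t b u)
        \<le> L4 * norm (a - b)" for a b u
    proof -
      have "norm (Fy t a u - Fy t b u) \<le> L4 * norm (a - b)" "norm (Fu t a u - Fu t b u) \<le> L4 * norm (a - b)"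
        if "norm (a - b) \<le> \<delta>2" for a b
        using dF_Lipschitz_y[OF t that, of u] norm_ge_zero[of "Fy t a u - Fy t b u"] norm_ge_zero[of "Fu t a u - Fu t b u"]
        by linarith+
      then show "norm (Fy t a u - Fy t b u) \<le> L4 * norm (a - b)" "norm (Fu t a u - Fu t b u) \<le> L4 * norm (a - b)"
        using Lipschitz_local_to_global[OF const_pos(5), of "\<lambda>a. Fy t a u" L4 a b]
          Lipschitz_local_to_global[OF const_pos(5), of "\<lambda>a. Fu t a u" L4 a b] by blast+
    qed
    have u1: "norm (Fy t y a - Fy t y b) \<le> L5 * norm (a - b)" and u2: "norm (Fu t y a - Fu t y b)
        \<le> L5 * norm (a - b)" for a b y
      using dF_Lipschitz_u[OF t, of y a b] norm_ge_zero[of "Fy t y a - Fy t y b"] norm_ge_zero[of "Fu t y a - Fu t y b"]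
      by linarith+
    show "norm (Fy t y u - Fy t y' u') \<le> M * (norm (y - y') + norm (u - u'))"
      by (rule joint[OF y1 u1 M(3,4)])
    show "norm (Fu t y u - Fu t y' u') \<le> M * (norm (y - y') + norm (u - u'))"
      by (rule joint[OF y2 u2 M(3,4)])
  qed
  have g0_loc: "norm (g0y t a u1 - g0y t b u2) \<le> L6 * (norm (a - b) + norm (u1 - u2))"
    "norm (g0u t a u1 - g0u t b u2) \<le> L6 * (norm (a - b) + norm (u1 - u2))"
    if "t \<in> {0..T}" "norm (a - b) \<le> \<delta>3" for t a b u1 u2
    using dg0_Lipschitz[OF that, of u1 u2] norm_ge_zero[of "g0y t a u1
        - g0y t b u2"] norm_ge_zero[of "g0u t a u1 - g0u t b u2"]
    by linarith+
  \<comment> \<open>The hypothesis is joint in state and control but local in the state. Varying one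
    argument at a time separates it, and only the variation of the state has to be
    globalized.\<close>
  have g0y_lip: "norm (g0y t y u - g0y t y' u') \<le> M * (norm (y - y') + norm (u - u'))"
    and g0u_lip: "norm (g0u t y u - g0u t y' u') \<le> M * (norm (y - y') + norm (u - u'))"
    and g0u_lip0: "norm (g0u t 0 u - g0u t 0 0) \<le> L6 * norm u"
    if t: "t \<in> {0..T}" for t y u y' u'
  proof -
    have y1: "norm (g0y t a u - g0y t b u) \<le> L6 * norm (a - b)" and y2: "norm (g0u t a u - g0u t b u)
        \<le> L6 * norm (a - b)" for a b u
      using Lipschitz_local_to_global[OF const_pos(6), of "\<lambda>a. g0y t a u" L6 a b]
        Lipschitz_local_to_global[OF const_pos(6), of "\<lambda>a. g0u t a u" L6 a b] g0_loc[OF t, of _ _ u u]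
          by simp_all
    have u1: "norm (g0y t y a - g0y t y b) \<le> L6 * norm (a - b)" and u2: "norm (g0u t y a - g0u t y b)
        \<le> L6 * norm (a - b)" for a b y
      using g0_loc[OF t, of y y a b] const_pos(6) by simp_all
    show "norm (g0y t y u - g0y t y' u') \<le> M * (norm (y - y') + norm (u - u'))"
      by (rule joint[OF y1 u1 M(5,5)])
    show "norm (g0u t y u - g0u t y' u') \<le> M * (norm (y - y') + norm (u - u'))"
      by (rule joint[OF y2 u2 M(5,5)])
    show "norm (g0u t 0 u - g0u t 0 0) \<le> L6 * norm u" using u2[of 0 u 0] by simp
  qed
  have g0u_growth: "norm (g0u t y u) \<le> M * (1 + norm y + norm u)" if t: "t \<in> {0..T}" for t y u
  proof -
    have "norm (g0u t 0 0) \<le> 3 * L3 + L6"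
    proof (rule derivative_bound_at_origin[where g="\<lambda>u. g0 t 0 u" and g'="\<lambda>u. g0u t 0 u"])
      show "((\<lambda>u. g0 t 0 u) has_derivative blinfun_apply (g0u t 0 u)) (at u)" for u
        using g0_C1[OF t] by (simp add: C1_with_partials_def)
      show "norm (g0u t 0 u - g0u t 0 0) \<le> L6 * norm u" for u by (rule g0u_lip0[OF t])
      show "\<bar>g0 t 0 u\<bar> \<le> L3 * (1 + (norm u)\<^sup>2)" for u using g0_bound[OF t, of 0 u] by simp
    qed (use const_pos in auto)
    moreover have "norm (g0u t y u) \<le> norm (g0u t y u - g0u t 0 0) + norm (g0u t 0 0)"
      using norm_triangle_ineq[of "g0u t y u - g0u t 0 0" "g0u t 0 0"] by simp
    ultimately show ?thesis
      using g0u_lip[OF t, of y u 0 0] M(6) const_pos(4) by (simp add: distrib_left)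
  qed
  have le_M: "L3 * r \<le> M * r" if "r \<ge> 0" for r using M(2) that by (rule mult_right_mono)
  interpret control_problem T M F Fy Fu g0 g0y g0u S K y0 ubar ybar
  proof unfold_locales
    show "((\<lambda>y'. F t y' u) has_derivative blinfun_apply (Fy t y u)) (at y)"
      "((\<lambda>u'. F t y u') has_derivative blinfun_apply (Fu t y u)) (at u)" if "t \<in> {0..T}" for t y u
      using F_C1[OF that] by (simp_all add: C1_with_partials_def)
    show "((\<lambda>y'. g0 t y' u) has_derivative blinfun_apply (g0y t y u)) (at y)"
      "((\<lambda>u'. g0 t y u') has_derivative blinfun_apply (g0u t y u)) (at u)"
        if "t \<in> {0..T}" for t y u
      using g0_C1[OF that] by (simp_all add: C1_with_partials_def)
    show "norm (F t 0 u) \<le> M * norm u" if "t \<in> {0..T}" for t u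
      using order_trans[OF F_bound[OF that] le_M] by simp
    show "norm (Fy t y u) \<le> M" "norm (Fu t y u) \<le> M" if "t \<in> {0..T}" for t y u
      using order_trans[OF Fyu(1)[OF that] M(2)] order_trans[OF Fyu(2)[OF that] M(2)] by blast+
    show "\<bar>g0 t y u\<bar> \<le> M * (1 + (norm y)\<^sup>2 + (norm u)\<^sup>2)"
      if "t \<in> {0..T}" for t y u
      using order_trans[OF g0_bound[OF that] le_M] by simp
    show "norm (g0y t y u) \<le> M * (1 + norm y + norm u)" if "t \<in> {0..T}" for t y u
      using order_trans[OF g0y_bound[OF that] le_M] by simp
  qed (use M(1) F_meas g0_meas Fy_lip Fu_lip g0y_lip g0u_lip F_partials_meas g0_partials_meas T_pos semigroup K
      g0u_growth ubar_L2 ybar_state in auto)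
  have fc: "finite_codimensional attainable"
    using finite_codim unfolding attainable_def lin_def .
  have opt: "cost T g0 ybar ubar \<le> cost T g0 y u"
    if "u \<in> L2_space T" "state u y" "y T = ybar T" for u y
    using optimal[OF that(1) that(2)[unfolded state_def]] that(3) ybar_target by simp
  obtain z0 zh where z: "z0 = 0 \<or> z0 = 1" "z0 \<noteq> 0 \<or> zh \<noteq> 0"
    and ann: "\<And>v \<xi>. v \<in> L2_space T \<Longrightarrow> lin v \<xi> \<Longrightarrow>
        zh \<bullet> \<xi> T + z0 * dcost v \<xi> = 0"
    and app: "zh \<noteq> 0 \<Longrightarrow> approachable zh"
    using multiplier_exists[OF opt fc] by blast
  define z where "z = blinfun_inner_right zh"
  have zh0: "z = 0 \<longleftrightarrow> zh = 0"
    unfolding z_def by (metis norm_eq_zero norm_riesz riesz_blinfun_inner_right)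
  \<comment> \<open>The terminal value -z turns the relation
    \<open>zh . xi T + z0 * dcost = 0\<close> into the annihilation condition of
    \<open>Hamiltonian_stationary\<close>; this is where the sign in the terminal condition comes
    from.\<close>
  have stat: "AE t in lebesgue_on {0<..<T}.
      ((\<lambda>u. Hamiltonian F g0 t (ybar t) u z0 (\<psi> t)) has_derivative (\<lambda>_. 0)) (at (ubar t))"
    if "adj z0 (- z) \<psi>" for \<psi>
  proof (rule Hamiltonian_stationary[OF that])
    fix v \<xi> assume "v \<in> L2_space T" "lin v \<xi>"
    from ann[OF this] show "(- z) (\<xi> T) = z0 * dcost v \<xi>" by (simp add: z_def uminus_blinfun.rep_eq)
  qed
  \<comment> \<open>A nonzero \<open>z0\<close> equals 1 here, so the rescaled adjoint equation
    coincides with the original one.\<close>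
  have "(\<exists>\<psi>. adj 1 (- (z /\<^sub>R z0)) \<psi>)
      \<and> (\<forall>\<psi>. adj 1 (- (z /\<^sub>R z0)) \<psi> \<longrightarrow> (AE t in lebesgue_on {0<..<T}.
      ((\<lambda>u. Hamiltonian F g0 t (ybar t) u 1 (\<psi> t)) has_derivative (\<lambda>_. 0)) (at (ubar
          t))))" if "z0 \<noteq> 0"
  proof -
    have "z0 = 1" using z(1) that by simp
    then show ?thesis using adj_exists[of 1 "- z"] stat by simp
  qed
  note normal = this[unfolded adj_def scaleR_one]
  have seq: "\<exists>zhat. (\<forall>x. z x = zhat \<bullet> x) \<and>
          (\<exists>(u :: nat \<Rightarrow> real \<Rightarrow> 'v) (y :: nat \<Rightarrow> real \<Rightarrow> 'x).
             (\<forall>k. u k \<in> L2_space T \<and> mild_solution T S (\<lambda>t x. F t x (u k t)) y0 (y k)) \<and>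
             (\<lambda>k. L2_norm T (\<lambda>t. u k t - ubar t)) \<longlonglongrightarrow> 0 \<and>
             (\<forall>k. y k T \<noteq> y1) \<and>
             (\<lambda>k. y k T) \<longlonglongrightarrow> y1 \<and>
             (\<lambda>k. cost T g0 (y k) (u k)) \<longlonglongrightarrow> cost T g0 ybar ubar \<and>
             (\<forall>k. zhat \<bullet> (y k T - y1) > 0))" if "z \<noteq> 0"
  proof -
    have "approachable zh" using app that zh0 by blast
    from approaching_sequence[OF this] obtain u y where
      *: "\<And>k. u k \<in> L2_space T" "\<And>k. mild_solution T S (\<lambda>t x. F t x (u k t)) y0 (y k)"
        "(\<lambda>k. L2_norm T (\<lambda>t. u k t - ubar t)) \<longlonglongrightarrow> 0"
            "(\<lambda>k. y k T) \<longlonglongrightarrow> y1"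
        "(\<lambda>k. cost T g0 (y k) (u k)) \<longlonglongrightarrow> cost T g0 ybar ubar"
            "\<And>k. zh \<bullet> (y k T - y1) > 0"
      unfolding state_def ybar_target by blast
    have "y k T \<noteq> y1" for k using *(6)[of k] by auto
    with * show ?thesis by (intro exI[of _ zh] conjI exI[of _ u] exI[of _ y]) (auto simp: z_def)
  qed
  have "z0 \<ge> 0" "(z0, z) \<noteq> (0, 0)" using z zh0 by auto
  moreover note adj_exists[of z0 "- z", unfolded adj_def] stat[unfolded adj_def] normal seq
  ultimately show ?thesis by (intro exI[of _ z0] exI[of _ z] conjI allI impI) blast+
qed

end
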